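(* The number of tilings $T(D_n)$ of the Aztec dungeon $D_n$ is given by the equalities $T(D_0)=1$, $T(D_1)=2$, $T(D_2)=13$, $T(D_3)=13^3$, $T(D_4)=2\cdot13^5$, $T(D_5)=13^8$, and for $n\geq5$ by the recurrence $$T(D_{n+1})=13^{4n-8}\,T(D_{n-5}).$$
   Context: The lattice $G_2$ is obtained from the equilateral triangular lattice (vertex set $\Lambda=\mathbb Z(1,0)+\mathbb Z(\tfrac12,\tfrac{\sqrt3}2)$, unit side triangles) by drawing in all altitudes of all unit triangles. It divides the plane into elementary regions: each unit triangle is cut by its three altitudes into six congruent right triangles. A tile is the union of two elementary regions sharing an edge; a tiling of a region is a partition of its elementary regions into disjoint tiles. The horizontal lattice lines $Y=j\sqrt3/2$ and the vertical lattice lines $X=i/2$ ($i,j\in\mathbb Z$) form a grid of $\frac12\times\frac{\sqrt3}2$ rectangles, isomorphic to the square lattice. The Aztec dungeon $D_n$ of order $n$ is the Aztec diamond region of order $n$ drawn on this grid, as follows. Let $p_n$ be a point of $\Lambda$ if $n$ is even, and the midpoint of a horizontal unit edge of the triangular lattice if $n$ is odd. Then $D_n$ is the union of all rectangles $p_n+[\frac i2,\frac{i+1}2]\times[\frac{j\sqrt3}2,\frac{(j+1)\sqrt3}2]$, $i,j\in\mathbb Z$, with $\max(|i|,|i+1|)+\max(|j|,|j+1|)\le n+1$. $D_0$ is the empty region (one tiling). *)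

theory Defs
  imports "HOL-Analysis.Analysis" "HOL-Library.Disjoint_Sets"
begin

type_synonym point = "real \<times> real"

definition Lam :: "point set" where
  "Lam = {of_int a *\<^sub>R (1, 0) + of_int b *\<^sub>R (1 / 2, sqrt 3 / 2) | a b :: int. True}"

definition unit_triangle :: "point \<Rightarrow> point \<Rightarrow> point \<Rightarrow> bool" where
  "unit_triangle A B C \<longleftrightarrow> A \<in> Lam \<and> B \<in> Lam \<and> C \<in> Lam \<and>
     dist A B = 1 \<and> dist B C = 1 \<and> dist C A = 1"

definition altitude :: "point \<Rightarrow> point \<Rightarrow> point \<Rightarrow> point set \<Rightarrow> bool" where
  "altitude A B C s \<longleftrightarrow>
     (\<exists>F \<in> closed_segment B C. orthogonal (A - F) (B - C) \<and> s = closed_segment A F)"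

text \<open>The lattice as a drawing, that is, as the subset of the plane covered by its edges.\<close>

definition G2 :: "point set" where
  "G2 = \<Union> {closed_segment A B | A B. A \<in> Lam \<and> B \<in> Lam \<and> dist A B = 1} \<union>
        \<Union> {s. \<exists>A B C. unit_triangle A B C \<and> altitude A B C s}"

text \<open>Elementary regions are taken to be closed, so that they share their boundary edges.\<close>

definition elementary_region :: "point set \<Rightarrow> bool" where
  "elementary_region R \<longleftrightarrow> (\<exists>K \<in> components (- G2). R = closure K)"

text \<open>A tile is represented by the set of its two elementary regions rather than by their
  union, so that a tiling of a region is literally a set partition of the elementary regions
  contained in it.\<close>

definition tile :: "point set set \<Rightarrow> bool" where
  "tile t \<longleftrightarrow> (\<exists>R S. elementary_region R \<and> elementary_region S \<and> R \<noteq> S \<and>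
     (\<exists>e. e edge_of R \<and> e edge_of S) \<and> t = {R, S})"

definition tilings :: "point set \<Rightarrow> point set set set set" where
  "tilings U = {P. partition_on {R. elementary_region R \<and> R \<subseteq> U} P \<and> (\<forall>t \<in> P. tile t)}"

definition T :: "point set \<Rightarrow> nat" where
  "T U = card (tilings U)"

text \<open>The centre of the dungeon of order \<open>n\<close> is determined only up to a lattice translation.\<close>

definition dungeon_center :: "nat \<Rightarrow> point \<Rightarrow> bool" where
  "dungeon_center n p \<longleftrightarrow>
     (if even n then p \<in> Lam
      else \<exists>A \<in> Lam. \<exists>B \<in> Lam. dist A B = 1 \<and> snd A = snd B \<and> p = midpoint A B)"

definition grid_rectangle :: "point \<Rightarrow> int \<Rightarrow> int \<Rightarrow> point set" where
  "grid_rectangle p i j =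
     (+) p ` ({of_int i / 2 .. of_int (i + 1) / 2} \<times>
              {of_int j * sqrt 3 / 2 .. of_int (j + 1) * sqrt 3 / 2})"

definition aztec_dungeon :: "point \<Rightarrow> nat \<Rightarrow> point set" where
  "aztec_dungeon p n =
     \<Union> {grid_rectangle p i j | i j.
          max \<bar>i\<bar> \<bar>i + 1\<bar> + max \<bar>j\<bar> \<bar>j + 1\<bar> \<le> int n + 1}"

end

theory Submission
  imports Defs
begin

text \<open>
  A tiling is a perfect matching of the adjacency graph of the elementary regions. If the edges of
  a weighted graph are distributed over cells, its matching sum is a sum over the assignments of
  vertices to cells of a product over the cells. When a cell is a 4-cycle with weights
  \<open>\<alpha>, \<beta>, \<gamma>, \<delta>\<close> and \<open>\<Delta> = \<alpha>\<gamma> + \<beta>\<delta>\<close>, replacing the set of vertices matched inside the cell by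
  its complement in the cell costs a factor \<open>\<Delta>\<close> and exchanges opposite weights, divided by \<open>\<Delta>\<close>
  (urban renewal). Done in all cells at once, this only deletes the vertices that lie in a single cell.

  Renewal at the midpoints of the horizontal edges turns the dungeon of order \<open>n\<close> into an Aztec
  diamond of order \<open>2n\<close> with periodic weights. For an Aztec diamond, renewal in the faces of one
  colour lowers the order by one. Two such steps preserve the shape of the weights and act on
  their five parameters by a rational map, whose sixth iterate multiplies the initial parameters
  by \<open>(15/26)^4\<close>.
\<close>

section \<open>Weighted partitions and renewal of cells\<close>

text \<open>Renewal at the midpoints changes which of their regions are matched inside a rectangle,
  and a rectangle is not a 4-cycle: its six regions form a 4-cycle with one pendant region at each
  of two opposite vertices. The pendants are the regions at midpoints, and complementing them leaves
  a different 4-cycle and a separate edge (\<open>block_flip\<close>). This coincidence is what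
  makes a square grid appear. The midpoints, \<open>n * n\<close> in number, contribute a factor 2
  each and get weights 1/2, which explains the starting parameters 1, 1/2, 1, 1/2, 1.

  The parameter map is homogeneous of degree 1, so returning to a multiple of the start is as good
  as returning to the start. Each double step costs a factor
  \<open>a ^ m\<^sup>2 * b ^ m * c\<close>. Over six of them the quadratic exponents cancel against
  the scaling factor, and what remains is a power of 13 with exponent linear in \<open>m\<close>.

  The regions are closures of components of the complement of a drawing. They become accessible by
  enclosing the drawing in the mirrors of a reflection group: the components turn out to be the open
  triangles cut out by these mirrors, and common edges become pairs of common vertices.\<close>

text \<open>Blocks of any size are allowed: the weight is meant to vanish on all but the two-element blocks that are edges.\<close>

definition pmsum :: "'a set \<Rightarrow> ('a set \<Rightarrow> real) \<Rightarrow> real" where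
  "pmsum V w = (\<Sum>M | partition_on V M. \<Prod>e\<in>M. w e)"

lemma pmsum_empty [simp]: "pmsum {} w = 1"
proof -
  have "{M. partition_on {} M} = {{}::'a set set}"
    by (auto simp: partition_on_empty)
  then show ?thesis
    by (simp add: pmsum_def)
qed

lemma pmsum_cong:
  assumes "\<And>e. e \<subseteq> V \<Longrightarrow> w e = w' e"
  shows "pmsum V w = pmsum V w'"
  unfolding pmsum_def
proof (rule sum.cong[OF refl], rule prod.cong[OF refl])
  fix M e assume "M \<in> {M. partition_on V M}" "e \<in> M"
  then show "w e = w' e"
    by (intro assms) (auto simp: partition_on_def)
qed

section \<open>Expansion of matching sums along a vertex\<close>

lemma partition_on_block:
  assumes "partition_on V M" "v \<in> V"
  shows "(THE e. e \<in> M \<and> v \<in> e) \<in> M" "v \<in> (THE e. e \<in> M \<and> v \<in> e)"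
proof -
  have "\<exists>!e. e \<in> M \<and> v \<in> e"
    using assms by (auto simp: partition_on_def disjoint_def)
  from theI'[OF this] show "(THE e. e \<in> M \<and> v \<in> e) \<in> M" "v \<in> (THE e. e \<in> M \<and> v \<in> e)"
    by auto
qed

lemma partition_on_block_eq:
  assumes "partition_on V M" "v \<in> e" "e \<in> M"
  shows "(THE e. e \<in> M \<and> v \<in> e) = e"
  using assms by (intro the_equality) (auto simp: partition_on_def disjoint_def)

text \<open>Removing the block through \<open>v\<close> is a bijection from the partitions of
  \<open>V\<close> to pairs of a block through \<open>v\<close> and a partition of the rest.\<close>

lemma pmsum_rec:
  assumes "finite V" "v \<in> V"
  shows "pmsum V w = (\<Sum>e | e \<subseteq> V \<and> v \<in> e. w e * pmsum (V - e) w)"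
proof -
  define b where "b M = (THE e. e \<in> M \<and> v \<in> e)" for M
  have ins: "partition_on V (insert e M)" "e \<notin> M"
    if "e \<subseteq> V" "v \<in> e" "partition_on (V - e) M" for e M
  proof -
    have "disjnt e (\<Union>M)"
      using that(3) by (auto simp: partition_on_def disjnt_def)
    from partition_on_insert[OF this] that show "partition_on V (insert e M)"
      by auto
    show "e \<notin> M"
      using that by (auto simp: partition_on_def)
  qed
  have del: "partition_on (V - b M) (M - {b M})" if "partition_on V M" for M
  proof -
    have *: "b M \<in> M"
      using partition_on_block[OF that assms(2)] by (simp add: b_def)
    have "disjnt (b M) (\<Union>(M - {b M}))"
      using that * by (auto simp: partition_on_def disjoint_def disjnt_def)
    from partition_on_insert[OF this, of V] that show ?thesis
      using * by (simp add: insert_absorb)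
  qed
  have b_ins: "b (insert e M) = e"
    if "e \<subseteq> V" "v \<in> e" "partition_on (V - e) M" for e M
    unfolding b_def by (rule partition_on_block_eq[OF ins(1)[OF that]]) (use that in auto)
  have fin: "finite M" if "partition_on (V - e) M" for e M
    using assms that by (meson finite_Diff finite_elements)
  have bM: "b M \<in> M" "v \<in> b M" if "partition_on V M" for M
    using partition_on_block[OF that assms(2)] by (simp_all add: b_def)
  have "(\<Sum>e | e \<subseteq> V \<and> v \<in> e. w e * pmsum (V - e) w) =
    (\<Sum>(e, M) \<in> (SIGMA e:{e. e \<subseteq> V \<and> v \<in> e}. {M. partition_on (V - e) M}). w e * prod w M)"
    unfolding pmsum_def sum_distrib_left
    by (rule sum.Sigma) (use assms in \<open>auto simp: finitely_many_partition_on\<close>)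
  also have "\<dots> = pmsum V w"
    unfolding pmsum_def
  proof (rule sum.reindex_bij_witness[where i = "\<lambda>M. (b M, M - {b M})" and j = "\<lambda>(e, M). insert e M"])
    fix M assume "M \<in> {M. partition_on V M}"
    then have M: "partition_on V M" by simp
    show "(case (b M, M - {b M}) of (e, M) \<Rightarrow> insert e M) = M"
      using bM[OF M] by auto
    show "(b M, M - {b M}) \<in> (SIGMA e:{e. e \<subseteq> V \<and> v \<in> e}. {M. partition_on (V - e) M})"
      using bM[OF M] del[OF M] M by (auto simp: partition_on_def)
  next
    fix p assume "p \<in> (SIGMA e:{e. e \<subseteq> V \<and> v \<in> e}. {M. partition_on (V - e) M})"
    then obtain e M where p: "p = (e, M)" "e \<subseteq> V" "v \<in> e" "partition_on (V - e) M"
      by auto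
    note i = ins[OF p(2-4)] and bi = b_ins[OF p(2-4)] and f = fin[OF p(4)]
    show "(b (case p of (e, M) \<Rightarrow> insert e M),
        (case p of (e, M) \<Rightarrow> insert e M) - {b (case p of (e, M) \<Rightarrow> insert e M)}) = p"
      using i bi p by simp
    show "(case p of (e, M) \<Rightarrow> insert e M) \<in> {M. partition_on V M}"
      using i p by simp
    show "(\<Prod>e\<in>(case p of (e, M) \<Rightarrow> insert e M). w e) = (case p of (e, M) \<Rightarrow> w e * prod w M)"
      using i f p by simp
  qed
  finally show ?thesis ..
qed

lemma pmsum_rec_graph:
  assumes "finite V" "v \<in> V" and graph: "\<And>e. e \<subseteq> V \<Longrightarrow> w e \<noteq> 0 \<Longrightarrow> card e = 2"
  shows "pmsum V w = (\<Sum>u\<in>V - {v}. w {v, u} * pmsum (V - {v, u}) w)"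
proof -
  have inj: "inj_on (\<lambda>u. {v, u}) (V - {v})"
    by (auto simp: inj_on_def doubleton_eq_iff)
  have "pmsum V w = (\<Sum>e \<in> (\<lambda>u. {v, u}) ` (V - {v}). w e * pmsum (V - e) w)"
    unfolding pmsum_rec[OF assms(1,2)]
  proof (rule sum.mono_neutral_right)
    show "\<forall>e\<in>{e. e \<subseteq> V \<and> v \<in> e} - (\<lambda>u. {v, u}) ` (V - {v}). w e * pmsum (V - e) w = 0"
    proof
      fix e assume e: "e \<in> {e. e \<subseteq> V \<and> v \<in> e} - (\<lambda>u. {v, u}) ` (V - {v})"
      have "w e = 0"
      proof (rule ccontr)
        assume "w e \<noteq> 0"
        with e graph have "card e = 2" by auto
        then obtain a b where "e = {a, b}" "a \<noteq> b"
          by (auto simp: card_2_iff)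
        with e show False
          by (cases "a = v") (auto simp: insert_commute)
      qed
      then show "w e * pmsum (V - e) w = 0" by simp
    qed
  qed (use assms in auto)
  also have "\<dots> = (\<Sum>u\<in>V - {v}. w {v, u} * pmsum (V - {v, u}) w)"
    by (subst sum.reindex[OF inj]) simp
  finally show ?thesis .
qed

text \<open>The cells that get renewed have four or six vertices, so these expansions reduce the
  identities for single cells to finite case checks.\<close>

lemma pmsum_graph_small:
  assumes graph: "\<And>e. w e \<noteq> 0 \<Longrightarrow> card e = 2"
  shows "pmsum {x} w = 0"
    and "x \<noteq> y \<Longrightarrow> pmsum {x, y} w = w {x, y}"
    and "distinct [x, y, z] \<Longrightarrow> pmsum {x, y, z} w = 0"
    and "distinct [x, y, z, t] \<Longrightarrow> pmsum {x, y, z, t} w =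
      w {x, y} * w {z, t} + w {x, z} * w {y, t} + w {x, t} * w {y, z}"
    and "distinct [x, y, z, t, u] \<Longrightarrow> pmsum {x, y, z, t, u} w = 0"
    and "distinct [x, y, z, t, u, v] \<Longrightarrow> pmsum {x, y, z, t, u, v} w =
      w {x, y} * pmsum {z, t, u, v} w + w {x, z} * pmsum {y, t, u, v} w + w {x, t} * pmsum {y, z, u, v} w +
      w {x, u} * pmsum {y, z, t, v} w + w {x, v} * pmsum {y, z, t, u} w"
proof -
  note rec = pmsum_rec_graph[OF _ _ graph]
  have 1: "pmsum {x} w = 0" for x
    by (subst rec[of _ x]) auto
  have 2: "pmsum {x, y} w = w {x, y}" if "x \<noteq> y" for x y
    by (subst rec[of _ x]) (use that in \<open>auto simp: insert_Diff_if\<close>)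
  have 3: "pmsum {x, y, z} w = 0" if "distinct [x, y, z]" for x y z
    by (subst rec[of _ x]) (use that 1 in \<open>auto simp: insert_Diff_if\<close>)
  have 4: "pmsum {x, y, z, t} w = w {x, y} * w {z, t} + w {x, z} * w {y, t} + w {x, t} * w {y, z}"
    if "distinct [x, y, z, t]" for x y z t
    by (subst rec[of _ x]) (use that 2 in \<open>auto simp: insert_Diff_if\<close>)
  show "pmsum {x} w = 0" "x \<noteq> y \<Longrightarrow> pmsum {x, y} w = w {x, y}" "distinct [x, y, z] \<Longrightarrow> pmsum {x, y, z} w = 0"
    "distinct [x, y, z, t] \<Longrightarrow> pmsum {x, y, z, t} w = w {x, y} * w {z, t} + w {x, z} * w {y, t} + w {x, t} * w {y, z}"
    by (fact 1 2 3 4)+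
  show "pmsum {x, y, z, t, u} w = 0" if "distinct [x, y, z, t, u]"
  proof -
    have "x \<noteq> y" "x \<noteq> z" "x \<noteq> t" "x \<noteq> u" "y \<noteq> x" "y \<noteq> z" "y \<noteq> t" "y \<noteq> u" "z \<noteq> x" "z \<noteq> y"
      "z \<noteq> t" "z \<noteq> u" "t \<noteq> x" "t \<noteq> y" "t \<noteq> z" "t \<noteq> u" "u \<noteq> x" "u \<noteq> y" "u \<noteq> z" "u \<noteq> t"
      using that by auto
    then show ?thesis
      by (subst rec[of _ x]) (simp_all add: insert_Diff_if 3)
  qed
  show "pmsum {x, y, z, t, u, v} w =
      w {x, y} * pmsum {z, t, u, v} w + w {x, z} * pmsum {y, t, u, v} w + w {x, t} * pmsum {y, z, u, v} w +
      w {x, u} * pmsum {y, z, t, v} w + w {x, v} * pmsum {y, z, t, u} w" if "distinct [x, y, z, t, u, v]"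
  proof -
    have "x \<noteq> y" "x \<noteq> z" "x \<noteq> t" "x \<noteq> u" "x \<noteq> v" "y \<noteq> x" "y \<noteq> z" "y \<noteq> t" "y \<noteq> u" "y \<noteq> v"
      "z \<noteq> x" "z \<noteq> y" "z \<noteq> t" "z \<noteq> u" "z \<noteq> v" "t \<noteq> x" "t \<noteq> y" "t \<noteq> z" "t \<noteq> u" "t \<noteq> v"
      "u \<noteq> x" "u \<noteq> y" "u \<noteq> z" "u \<noteq> t" "u \<noteq> v" "v \<noteq> x" "v \<noteq> y" "v \<noteq> z" "v \<noteq> t" "v \<noteq> u"
      using that by auto
    then show ?thesis
      by (subst rec[of _ x]) (simp_all add: insert_Diff_if)
  qed
qed

text \<open>Relabelling along an injection. It serves twice: to replace regions by index triples,
  and to identify the renewed dungeon with a grid.\<close>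

lemma pmsum_image:
  assumes "inj_on f V"
  shows "pmsum (f ` V) w = pmsum V (\<lambda>e. w (f ` e))"
  unfolding pmsum_def
proof (rule sum.reindex_bij_witness[symmetric, where i = "\<lambda>M. (\<lambda>e. {v\<in>V. f v \<in> e}) ` M" and j = "\<lambda>M. (`) f ` M"])
  fix M assume "M \<in> {M. partition_on V M}"
  then have M: "partition_on V M" by simp
  then have sub: "e \<subseteq> V" if "e \<in> M" for e
    using that by (auto simp: partition_on_def)
  have e: "{v \<in> V. f v \<in> f ` e} = e" if "e \<in> M" for e
    using sub[OF that] assms by (auto simp: inj_on_def)
  show "(\<lambda>e. {v \<in> V. f v \<in> e}) ` (`) f ` M = M"
    using e by (simp add: image_image)
  have "{} \<notin> M" using M by (auto simp: partition_on_def)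
  then have "(`) f ` M - {{}} = (`) f ` M" by auto
  with partition_on_inj_image[OF M assms] show "(`) f ` M \<in> {M. partition_on (f ` V) M}"
    by simp
  have "inj_on ((`) f) M"
    by (rule inj_onI) (metis e)
  then show "prod w ((`) f ` M) = (\<Prod>e\<in>M. w (f ` e))"
    by (simp add: prod.reindex)
next
  fix M assume "M \<in> {M. partition_on (f ` V) M}"
  then have M: "partition_on (f ` V) M" by simp
  then have sub: "e \<subseteq> f ` V" if "e \<in> M" for e
    using that by (auto simp: partition_on_def)
  have e: "f ` {v \<in> V. f v \<in> e} = e" if "e \<in> M" for e
    using sub[OF that] by auto
  show "(`) f ` (\<lambda>e. {v \<in> V. f v \<in> e}) ` M = M"
    using e by (simp add: image_image)
  have "inv_into V f ` e = {v \<in> V. f v \<in> e}" if "e \<in> M" for e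
  proof -
    have "inv_into V f ` e = inv_into V f ` f ` {v \<in> V. f v \<in> e}"
      by (simp only: e[OF that])
    also have "\<dots> = {v \<in> V. f v \<in> e}"
      by (rule inv_into_image_cancel) (use assms in auto)
    finally show ?thesis .
  qed
  then have eq: "(\<lambda>e. {v \<in> V. f v \<in> e}) ` M = (`) (inv_into V f) ` M"
    by (intro image_cong) auto
  have "{} \<notin> M" using M by (auto simp: partition_on_def)
  then have "(`) (inv_into V f) ` M - {{}} = (`) (inv_into V f) ` M" by auto
  with partition_on_inj_image[OF M inj_on_inv_into[OF subset_refl]]
  show "(\<lambda>e. {v \<in> V. f v \<in> e}) ` M \<in> {M. partition_on V M}"
    using assms by (simp add: eq)
qed


text \<open>Expanding the product of sums chooses a cell for every block. If the choice is recorded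
  at the vertices instead, the blocks in cell \<open>c\<close> form an arbitrary partition of the
  vertices assigned to \<open>c\<close>, and the sum factors over the cells.\<close>

lemma pmsum_sum:
  fixes V :: "'a set" and C :: "'c set"
  assumes V: "finite V" and C: "finite C"
  shows "pmsum V (\<lambda>e. \<Sum>c\<in>C. w c e) =
    (\<Sum>\<sigma>\<in>V \<rightarrow>\<^sub>E C. \<Prod>c\<in>C. pmsum {v\<in>V. \<sigma> v = c} (w c))"
proof -
  define A where "A = (SIGMA M:{M. partition_on V M}. M \<rightarrow>\<^sub>E C)"
  define B where "B = (SIGMA \<sigma>:V \<rightarrow>\<^sub>E C. \<Pi>\<^sub>E c\<in>C. {M. partition_on {v\<in>V. \<sigma> v = c} M})"
  define blk where "blk M v = (THE e. e \<in> M \<and> v \<in> e)" for M and v :: 'a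
  \<comment> \<open>A vertex inherits the cell of its block. Conversely all vertices of a block
    carry the same cell, so any representative recovers it.\<close>
  define F where "F = (\<lambda>(M :: 'a set set, f :: 'a set \<Rightarrow> 'c). (\<lambda>v\<in>V. f (blk M v), \<lambda>c\<in>C. {e\<in>M. f e = c}))"
  define G where "G = (\<lambda>(\<sigma> :: 'a \<Rightarrow> 'c, g :: 'c \<Rightarrow> 'a set set). (\<Union>c\<in>C. g c, \<lambda>e\<in>(\<Union>c\<in>C. g c). \<sigma> (SOME v. v \<in> e)))"
  have finM: "finite M" if "partition_on V M" for M
    using finite_elements[OF V that] .
  have L: "pmsum V (\<lambda>e. \<Sum>c\<in>C. w c e) = (\<Sum>(M, f)\<in>A. \<Prod>e\<in>M. w (f e) e)"
  proof -
    have "pmsum V (\<lambda>e. \<Sum>c\<in>C. w c e) = (\<Sum>M | partition_on V M. \<Sum>f\<in>M \<rightarrow>\<^sub>E C. \<Prod>e\<in>M. w (f e) e)"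
      unfolding pmsum_def
      by (intro sum.cong refl prod_sum_PiE) (use finM C in auto)
    also have "\<dots> = (\<Sum>(M, f)\<in>A. \<Prod>e\<in>M. w (f e) e)"
      unfolding A_def
      by (rule sum.Sigma) (use V C finM in \<open>auto simp: finitely_many_partition_on intro!: finite_PiE\<close>)
    finally show ?thesis .
  qed
  have R: "(\<Sum>\<sigma>\<in>V \<rightarrow>\<^sub>E C. \<Prod>c\<in>C. pmsum {v\<in>V. \<sigma> v = c} (w c)) =
    (\<Sum>(\<sigma>, g)\<in>B. \<Prod>c\<in>C. \<Prod>e\<in>g c. w c e)"
  proof -
    have "(\<Sum>\<sigma>\<in>V \<rightarrow>\<^sub>E C. \<Prod>c\<in>C. pmsum {v\<in>V. \<sigma> v = c} (w c)) =
      (\<Sum>\<sigma>\<in>V \<rightarrow>\<^sub>E C. \<Sum>g\<in>(\<Pi>\<^sub>E c\<in>C. {M. partition_on {v\<in>V. \<sigma> v = c} M}). \<Prod>c\<in>C. \<Prod>e\<in>g c. w c e)"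
      unfolding pmsum_def
      by (intro sum.cong refl prod_sum_PiE) (use V C in \<open>auto simp: finitely_many_partition_on\<close>)
    also have "\<dots> = (\<Sum>(\<sigma>, g)\<in>B. \<Prod>c\<in>C. \<Prod>e\<in>g c. w c e)"
      unfolding B_def
      by (rule sum.Sigma) (use V C in \<open>auto simp: finitely_many_partition_on intro!: finite_PiE\<close>)
    finally show ?thesis .
  qed
  have "(\<Sum>(M, f)\<in>A. \<Prod>e\<in>M. w (f e) e) = (\<Sum>(\<sigma>, g)\<in>B. \<Prod>c\<in>C. \<Prod>e\<in>g c. w c e)"
  proof (rule sum.reindex_bij_witness[where j = F and i = G])
    fix a assume "a \<in> A"
    then obtain M f where a: "a = (M, f)" and M: "partition_on V M" and f: "f \<in> M \<rightarrow>\<^sub>E C"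
      by (auto simp: A_def)
    have Un: "(\<Union>c\<in>C. {e\<in>M. f e = c}) = M"
      using f by auto
    have bv: "blk M v = e" if "e \<in> M" "v \<in> e" for e v
      unfolding blk_def by (rule partition_on_block_eq[OF M that(2,1)])
    have ne: "(SOME v. v \<in> e) \<in> e" if "e \<in> M" for e
      using that M some_in_eq[of e] by (auto simp: partition_on_def)
    have sub: "e \<subseteq> V" if "e \<in> M" for e
      using that M by (auto simp: partition_on_def)
    show "G (F a) = a"
    proof -
      have "G (F a) = (M, \<lambda>e\<in>M. (\<lambda>v\<in>V. f (blk M v)) (SOME v. v \<in> e))"
        using Un by (simp add: G_def F_def a)
      also have "(\<lambda>e\<in>M. (\<lambda>v\<in>V. f (blk M v)) (SOME v. v \<in> e)) = f"
      proof
        fix e show "(\<lambda>e\<in>M. (\<lambda>v\<in>V. f (blk M v)) (SOME v. v \<in> e)) e = f e"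
        proof (cases "e \<in> M")
          case True
          then show ?thesis
            using ne[OF True] sub[OF True] bv[OF True ne[OF True]] by auto
        next
          case False
          then show ?thesis using f by (auto simp: PiE_def extensional_def)
        qed
      qed
      finally show ?thesis by (simp add: a)
    qed
    have blkM: "blk M v \<in> M" "v \<in> blk M v" if "v \<in> V" for v
      using partition_on_block[OF M that] by (simp_all add: blk_def)
    have part: "partition_on {v\<in>V. f (blk M v) = c} {e\<in>M. f e = c}" for c
    proof -
      have "\<Union>{e\<in>M. f e = c} = {v\<in>V. f (blk M v) = c}"
        using blkM bv subsetD[OF sub] by auto
      then show ?thesis
        using M by (auto simp: partition_on_def disjoint_def)
    qed
    have cl: "{v. (v \<in> V \<longrightarrow> f (blk M v) = c) \<and> v \<in> V} = {v\<in>V. f (blk M v) = c}" for c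
      by auto
    show "F a \<in> B"
      using blkM f part by (auto simp: F_def B_def a cl)
    show "(case F a of (\<sigma>, g) \<Rightarrow> \<Prod>c\<in>C. \<Prod>e\<in>g c. w c e) = (case a of (M, f) \<Rightarrow> \<Prod>e\<in>M. w (f e) e)"
    proof -
      have "(case F a of (\<sigma>, g) \<Rightarrow> \<Prod>c\<in>C. \<Prod>e\<in>g c. w c e) = (\<Prod>c\<in>C. \<Prod>e\<in>{e\<in>M. f e = c}. w (f e) e)"
        by (simp add: F_def a)
      also have "\<dots> = (\<Prod>e\<in>M. w (f e) e)"
        by (rule prod.group) (use finM[OF M] C f in auto)
      finally show ?thesis by (simp add: a)
    qed
  next
    fix b assume "b \<in> B"
    then obtain \<sigma> g where b: "b = (\<sigma>, g)" and s: "\<sigma> \<in> V \<rightarrow>\<^sub>E C"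
      and g: "g \<in> (\<Pi>\<^sub>E c\<in>C. {M. partition_on {v\<in>V. \<sigma> v = c} M})"
      by (auto simp: B_def)
    have gp: "partition_on {v\<in>V. \<sigma> v = c} (g c)" if "c \<in> C" for c
      using g that by auto
    define M where "M = (\<Union>c\<in>C. g c)"
    have gsub: "e \<subseteq> V \<and> (\<forall>v\<in>e. \<sigma> v = c) \<and> e \<noteq> {}" if "c \<in> C" "e \<in> g c" for c e
      using gp[OF that(1)] that(2) by (auto simp: partition_on_def)
    have sig: "\<sigma> (SOME v. v \<in> e) = c" if "c \<in> C" "e \<in> g c" for c e
      using gsub[OF that] some_in_eq[of e] by auto
    have M: "partition_on V M"
    proof (rule partition_onI)
      show "\<Union>M = V"
      proof
        show "\<Union>M \<subseteq> V" using gsub by (auto simp: M_def)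
        show "V \<subseteq> \<Union>M"
        proof
          fix v assume v: "v \<in> V"
          then have "\<sigma> v \<in> C" using s by auto
          from gp[OF this] v have "v \<in> \<Union>(g (\<sigma> v))"
            by (simp add: partition_on_def)
          then show "v \<in> \<Union>M"
            using \<open>\<sigma> v \<in> C\<close> by (auto simp: M_def)
        qed
      qed
      show "{} \<notin> M" using gsub by (auto simp: M_def)
      fix p q assume pq: "p \<in> M" "q \<in> M" "p \<noteq> q"
      then obtain c d where cd: "c \<in> C" "p \<in> g c" "d \<in> C" "q \<in> g d" by (auto simp: M_def)
      show "disjnt p q"
      proof (cases "c = d")
        case True
        then show ?thesis
          using gp[OF cd(1)] cd pq(3) by (auto simp: partition_on_def disjoint_def disjnt_def)
      next
        case False
        then show ?thesis
          using gsub[OF cd(1,2)] gsub[OF cd(3,4)] by (auto simp: disjnt_def)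
      qed
    qed
    have Gb: "G b = (M, \<lambda>e\<in>M. \<sigma> (SOME v. v \<in> e))"
      by (simp add: G_def b M_def)
    show "G b \<in> A"
      using M s sig by (auto simp: Gb A_def M_def)
    show "F (G b) = b"
    proof -
      have "\<sigma> (SOME u. u \<in> blk M v) = \<sigma> v" "blk M v \<in> M" if "v \<in> V" for v
      proof -
        show 1: "blk M v \<in> M" using partition_on_block[OF M that] by (simp add: blk_def)
        have 2: "v \<in> blk M v" using partition_on_block[OF M that] by (simp add: blk_def)
        from 1 obtain c where c: "c \<in> C" "blk M v \<in> g c" by (auto simp: M_def)
        show "\<sigma> (SOME u. u \<in> blk M v) = \<sigma> v"
          using sig[OF c] gsub[OF c] 2 by auto
      qed
      then have 1: "(\<lambda>v\<in>V. (\<lambda>e\<in>M. \<sigma> (SOME v. v \<in> e)) (blk M v)) = \<sigma>"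
        using s by (auto simp: fun_eq_iff PiE_def extensional_def)
      have "{e\<in>M. (\<lambda>e\<in>M. \<sigma> (SOME v. v \<in> e)) e = c} = g c" if "c \<in> C" for c
        using sig that by (auto simp: M_def)
      then have 2: "(\<lambda>c\<in>C. {e\<in>M. (\<lambda>e\<in>M. \<sigma> (SOME v. v \<in> e)) e = c}) = g"
        using g by (auto simp: fun_eq_iff PiE_def extensional_def)
      show ?thesis
        unfolding Gb unfolding F_def prod.case 1 2 b ..
    qed
  qed
  with L R show ?thesis by simp
qed

text \<open>\<open>I v\<close> is the set of cells that contain \<open>v\<close>. A vertex of \<open>K\<close> in two cells moves from one to the other; a vertex of \<open>K\<close> in a single cell is matched there before the move and is deleted by it.\<close>

lemma state_sum_flip:
  fixes W W' :: "'c \<Rightarrow> 'v set \<Rightarrow> real"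
  assumes fin: "finite V" "finite C" and sub: "V' \<subseteq> V"
    and I: "\<And>v. v \<in> V \<Longrightarrow> I v \<subseteq> C"
    and two: "\<And>v. v \<in> V' \<Longrightarrow> v \<in> K \<Longrightarrow> card (I v) = 2"
    and one: "\<And>v. v \<in> V - V' \<Longrightarrow> v \<in> K \<and> card (I v) = 1"
    and loc: "\<And>c S v. c \<in> C \<Longrightarrow> S \<subseteq> V \<Longrightarrow> W c S \<noteq> 0 \<Longrightarrow> v \<in> S \<Longrightarrow> c \<in> I v"
    and loc': "\<And>c S v. c \<in> C \<Longrightarrow> S \<subseteq> V' \<Longrightarrow> W' c S \<noteq> 0 \<Longrightarrow> v \<in> S \<Longrightarrow> c \<in> I v"
    and flip: "\<And>c S. c \<in> C \<Longrightarrow> S \<subseteq> {v\<in>V. c \<in> I v} \<Longrightarrow> {v\<in>V. I v = {c}} \<subseteq> S \<Longrightarrow>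
       W c S = k c * W' c (S - K \<union> ({v\<in>V. c \<in> I v} \<inter> K - S))"
  shows "(\<Sum>\<sigma>\<in>V \<rightarrow>\<^sub>E C. \<Prod>c\<in>C. W c {v\<in>V. \<sigma> v = c}) =
     (\<Prod>c\<in>C. k c) * (\<Sum>\<sigma>\<in>V' \<rightarrow>\<^sub>E C. \<Prod>c\<in>C. W' c {v\<in>V'. \<sigma> v = c})"
proof -
  \<comment> \<open>An assignment that sends some vertex to a cell not containing it contributes
    zero, so the sums may be restricted to choices from \<open>I v\<close>.\<close>
  have restrict: "(\<Sum>\<sigma>\<in>U \<rightarrow>\<^sub>E C. \<Prod>c\<in>C. X c {v\<in>U. \<sigma> v = c}) = (\<Sum>\<sigma>\<in>PiE U I. \<Prod>c\<in>C. X c {v\<in>U. \<sigma> v = c})"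
    if U: "U \<subseteq> V" and X: "\<And>c S v. c \<in> C \<Longrightarrow> S \<subseteq> U \<Longrightarrow> X c S \<noteq> 0 \<Longrightarrow> v \<in> S \<Longrightarrow> c \<in> I v"
    for U and X :: "'c \<Rightarrow> 'v set \<Rightarrow> real"
  proof (rule sum.mono_neutral_right)
    show "finite (U \<rightarrow>\<^sub>E C)" using fin U by (auto intro!: finite_PiE finite_subset[of U V])
    show "PiE U I \<subseteq> U \<rightarrow>\<^sub>E C" using I U by (intro PiE_mono) auto
    show "\<forall>\<sigma>\<in>(U \<rightarrow>\<^sub>E C) - PiE U I. (\<Prod>c\<in>C. X c {v\<in>U. \<sigma> v = c}) = 0"
    proof
      fix \<sigma> assume s: "\<sigma> \<in> (U \<rightarrow>\<^sub>E C) - PiE U I"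
      then obtain v where v: "v \<in> U" "\<sigma> v \<notin> I v" "\<sigma> v \<in> C"
        by (auto simp: PiE_iff)
      have "X (\<sigma> v) {u\<in>U. \<sigma> u = \<sigma> v} = 0"
        using X[of "\<sigma> v" "{u\<in>U. \<sigma> u = \<sigma> v}" v] v by auto
      then show "(\<Prod>c\<in>C. X c {v\<in>U. \<sigma> v = c}) = 0"
        using v fin by (auto intro!: prod_zero)
    qed
  qed
  define sw where "sw v c = (THE d. d \<in> I v \<and> d \<noteq> c)" for v c
  have sw: "sw v c \<in> I v \<and> sw v c \<noteq> c \<and> (\<forall>d\<in>I v. d = c \<or> d = sw v c)"
    if "v \<in> V'" "v \<in> K" "c \<in> I v" for v c
  proof -
    have "card (I v) = 2" by (rule two[OF that(1,2)])
    then obtain a b where ab: "I v = {a, b}" "a \<noteq> b"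
      by (auto simp: card_2_iff)
    then have "sw v a = b" "sw v b = a"
      by (auto simp: sw_def intro!: the_equality)
    with ab that show ?thesis by auto
  qed
  have sole: "I v = {c}" if "v \<in> V - V'" "c \<in> I v" for v c
    using one[OF that(1)] that by (auto simp: card_1_singleton_iff)
  define F where "F \<sigma> = (\<lambda>v\<in>V'. if v \<in> K then sw v (\<sigma> v) else \<sigma> v)" for \<sigma>
  \<comment> \<open>A deleted vertex has only one cell, and the inverse map puts it back
    there.\<close>
  define G where "G \<sigma> = (\<lambda>v\<in>V. if v \<in> V' then if v \<in> K then sw v (\<sigma> v) else \<sigma> v else (THE c. c \<in> I v))" for \<sigma>
  have "(\<Sum>\<sigma>\<in>V \<rightarrow>\<^sub>E C. \<Prod>c\<in>C. W c {v\<in>V. \<sigma> v = c}) = (\<Sum>\<sigma>\<in>PiE V I. \<Prod>c\<in>C. W c {v\<in>V. \<sigma> v = c})"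
    by (rule restrict) (use loc in auto)
  also have "\<dots> = (\<Sum>\<sigma>\<in>PiE V' I. (\<Prod>c\<in>C. k c) * (\<Prod>c\<in>C. W' c {v\<in>V'. \<sigma> v = c}))"
  proof (rule sum.reindex_bij_witness[where j = F and i = G])
    fix \<sigma> assume s: "\<sigma> \<in> PiE V I"
    have sv: "\<sigma> v \<in> I v" if "v \<in> V" for v using s that by auto
    have swsw: "sw v (sw v (\<sigma> v)) = \<sigma> v" "sw v (\<sigma> v) \<in> I v" if "v \<in> V'" "v \<in> K" for v
      using sw[OF that] sv[of v] that sub by (metis subsetD)+
    show "F \<sigma> \<in> PiE V' I"
      using sub sv swsw by (auto simp: F_def)
    show "G (F \<sigma>) = \<sigma>"
    proof
      fix v show "G (F \<sigma>) v = \<sigma> v"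
      proof (cases "v \<in> V")
        case True
        then have "(THE c. c \<in> I v) = \<sigma> v" if "v \<notin> V'"
          using sole[of v "\<sigma> v"] sv[OF True] that by simp
        then show ?thesis
          using True swsw by (auto simp: G_def F_def)
      next
        case False
        then show ?thesis using s by (auto simp: G_def PiE_def extensional_def)
      qed
    qed
    have "W c {v\<in>V. \<sigma> v = c} = k c * W' c {v\<in>V'. F \<sigma> v = c}" if c: "c \<in> C" for c
    proof -
      define S where "S = {v\<in>V. \<sigma> v = c}"
      have "W c S = k c * W' c (S - K \<union> ({v\<in>V. c \<in> I v} \<inter> K - S))"
        by (rule flip[OF c]) (use sv in \<open>auto simp: S_def\<close>)
      \<comment> \<open>A surviving vertex of \<open>K\<close> is in \<open>c\<close> after the move
        iff \<open>c\<close> is one of its cells and it was not there before. A deleted vertex of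
        \<open>c\<close> has no other cell, so it was in \<open>S\<close> and disappears.\<close>
      also have "S - K \<union> ({v\<in>V. c \<in> I v} \<inter> K - S) = {v\<in>V'. F \<sigma> v = c}"
      proof (intro set_eqI iffI)
        fix v assume v: "v \<in> S - K \<union> ({v\<in>V. c \<in> I v} \<inter> K - S)"
        show "v \<in> {v\<in>V'. F \<sigma> v = c}"
        proof (cases "v \<in> K")
          case True
          with v have v': "v \<in> V" "c \<in> I v" "\<sigma> v \<noteq> c" by (auto simp: S_def)
          then have "v \<in> V'" using sole[of v c] sv[of v] by auto
          then show ?thesis using True v' sw[OF _ True sv[of v]] by (auto simp: F_def)
        next
          case False
          with v one[of v] show ?thesis by (auto simp: F_def S_def)
        qed
      next
        fix v assume "v \<in> {v\<in>V'. F \<sigma> v = c}"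
        then show "v \<in> S - K \<union> ({v\<in>V. c \<in> I v} \<inter> K - S)"
          using sub sw[of v "\<sigma> v"] sv[of v] by (auto simp: F_def S_def split: if_splits)
      qed
      finally show ?thesis by (simp add: S_def)
    qed
    then show "(\<Prod>c\<in>C. k c) * (\<Prod>c\<in>C. W' c {v\<in>V'. F \<sigma> v = c}) = (\<Prod>c\<in>C. W c {v\<in>V. \<sigma> v = c})"
      by (simp add: prod.distrib)
  next
    fix \<sigma> assume s: "\<sigma> \<in> PiE V' I"
    have sv: "\<sigma> v \<in> I v" if "v \<in> V'" for v using s that by auto
    have swsw: "sw v (sw v (\<sigma> v)) = \<sigma> v" "sw v (\<sigma> v) \<in> I v" if "v \<in> V'" "v \<in> K" for v
      using sw[OF that] sv[of v] that sub by (metis subsetD)+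
    have "(THE c. c \<in> I v) \<in> I v" if "v \<in> V - V'" for v
    proof -
      have "card (I v) = 1" using one[OF that] by simp
      then obtain c where "I v = {c}" by (auto simp: card_1_singleton_iff)
      then show ?thesis by simp
    qed
    then show "G \<sigma> \<in> PiE V I"
      using sub sv swsw by (auto simp: G_def)
    show "F (G \<sigma>) = \<sigma>"
    proof
      fix v show "F (G \<sigma>) v = \<sigma> v"
        using s sub swsw by (cases "v \<in> V'") (auto simp: G_def F_def PiE_def extensional_def)
    qed
  qed
  also have "\<dots> = (\<Prod>c\<in>C. k c) * (\<Sum>\<sigma>\<in>V' \<rightarrow>\<^sub>E C. \<Prod>c\<in>C. W' c {v\<in>V'. \<sigma> v = c})"
    unfolding sum_distrib_left[symmetric]
    by (subst restrict[of V' W']) (use sub loc' in auto)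
  finally show ?thesis .
qed

section \<open>Aztec diamonds\<close>

lemma pmsum_eq_0:
  assumes "finite V" "v \<in> V" "\<And>e. e \<subseteq> V \<Longrightarrow> v \<in> e \<Longrightarrow> w e = 0"
  shows "pmsum V w = 0"
  unfolding pmsum_rec[OF assms(1,2)] using assms(3) by (intro sum.neutral) auto

definition four_cycle :: "'a \<Rightarrow> 'a \<Rightarrow> 'a \<Rightarrow> 'a \<Rightarrow> real \<Rightarrow> real \<Rightarrow> real \<Rightarrow> real \<Rightarrow> 'a set \<Rightarrow> real" where
  "four_cycle a b c d \<alpha> \<beta> \<gamma> \<delta> e =
     (if e = {a, b} then \<alpha> else if e = {b, c} then \<beta> else if e = {c, d} then \<gamma>
      else if e = {d, a} then \<delta> else 0)"

text \<open>Urban renewal. The new weights have determinant \<open>1 / D\<close>, which settles the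
  empty set and the whole cycle; two adjacent vertices are traded for the opposite edge; every other
  subset gives zero on both sides.\<close>

lemma four_cycle_flip:
  assumes dist: "distinct [a, b, c, d]" and nz: "\<alpha> * \<gamma> + \<beta> * \<delta> \<noteq> 0" and S: "S \<subseteq> {a, b, c, d}"
  defines "D \<equiv> \<alpha> * \<gamma> + \<beta> * \<delta>"
  shows "pmsum S (four_cycle a b c d \<alpha> \<beta> \<gamma> \<delta>) =
    D * pmsum ({a, b, c, d} - S) (four_cycle a b c d (\<gamma> / D) (\<delta> / D) (\<alpha> / D) (\<beta> / D))"
proof -
  have ne: "a \<noteq> b" "b \<noteq> a" "a \<noteq> c" "c \<noteq> a" "a \<noteq> d" "d \<noteq> a" "b \<noteq> c" "c \<noteq> b" "b \<noteq> d" "d \<noteq> b" "c \<noteq> d" "d \<noteq> c"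
    using dist by auto
  have graph: "card e = 2" if "four_cycle a b c d p q r s e \<noteq> 0" for e p q r s
    using that ne by (auto simp: four_cycle_def split: if_splits)
  have D: "D \<noteq> 0" using nz by (simp add: D_def)
  have s1: "pmsum {x} (four_cycle a b c d p q r s) = 0" for x p q r s
    by (rule pmsum_graph_small(1)[OF graph])
  have s2: "pmsum {x, y} (four_cycle a b c d p q r s) = four_cycle a b c d p q r s {x, y}" if "x \<noteq> y" for x y p q r s
    by (rule pmsum_graph_small(2)[OF graph that])
  have s3: "pmsum {x, y, z} (four_cycle a b c d p q r s) = 0" if "distinct [x, y, z]" for x y z p q r s
    by (rule pmsum_graph_small(3)[OF graph that])
  have four: "pmsum {a, b, c, d} (four_cycle a b c d p q r s) = p * r + q * s" for p q r s
    using pmsum_graph_small(4)[of "four_cycle a b c d p q r s" a b c d, OF graph] ne by (simp add: four_cycle_def doubleton_eq_iff)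
  have "D * (\<gamma> / D * (\<alpha> / D) + \<delta> / D * (\<beta> / D)) = 1"
  proof -
    have "\<gamma> / D * (\<alpha> / D) + \<delta> / D * (\<beta> / D) = D / (D * D)"
      by (simp add: D_def add_divide_distrib mult.commute)
    with D show ?thesis by simp
  qed
  moreover from S have "S \<in> Pow {a, b, c, d}" by blast
  ultimately show ?thesis
    using ne D unfolding Pow_insert Pow_empty
    by (auto simp: insert_Diff_if s1 s2 s3 four four_cycle_def doubleton_eq_iff D_def[symmetric])
qed

text \<open>An edge is addressed by its left or lower endpoint, which \<open>Min\<close> recovers
  from the unordered pair.\<close>

definition grid :: "(int \<Rightarrow> int \<Rightarrow> real) \<Rightarrow> (int \<Rightarrow> int \<Rightarrow> real) \<Rightarrow> (int \<times> int) set \<Rightarrow> real" where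
  "grid H U e =
     (if \<exists>x y. e = {(x, y), (x + 1, y)} then H (Min (fst ` e)) (Min (snd ` e))
      else if \<exists>x y. e = {(x, y), (x, y + 1)} then U (Min (fst ` e)) (Min (snd ` e)) else 0)"

lemma grid_horizontal: "grid H U {(x, y), (x + 1, y)} = H x y"
  by (auto simp: grid_def)

lemma grid_vertical: "grid H U {(x, y), (x, y + 1)} = U x y"
  by (auto simp: grid_def doubleton_eq_iff)

lemma grid_other:
  assumes "\<And>x y. e \<noteq> {(x, y), (x + 1, y)}" "\<And>x y. e \<noteq> {(x, y), (x, y + 1)}"
  shows "grid H U e = 0"
  using assms by (simp add: grid_def)

text \<open>The diamonds are centred at \<open>(-1/2, -1/2)\<close>; the face \<open>(x, y)\<close> has the corners \<open>(x - 1, y - 1)\<close>, \<open>(x, y - 1)\<close>, \<open>(x, y)\<close>, \<open>(x - 1, y)\<close>. The edges of the diamond of order \<open>N\<close> are partitioned by the faces in \<open>faces N\<close>, one of the two colour classes.\<close>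

definition diamond :: "nat \<Rightarrow> (int \<times> int) set" where
  "diamond N = {(x, y). \<bar>2 * x + 1\<bar> + \<bar>2 * y + 1\<bar> \<le> 2 * int N}"

definition faces :: "nat \<Rightarrow> (int \<times> int) set" where
  "faces N = {(x, y). \<bar>x\<bar> + \<bar>y\<bar> < int N \<and> odd (x + y + int N)}"

text \<open>The number \<open>\<bar>x\<bar> + \<bar>y\<bar>\<close> has the parity of
  \<open>x + y\<close>, so in this colour class it never equals \<open>N\<close>. The weak bound is
  what edge and vertex conditions deliver directly.\<close>

lemma in_faces_iff: "(x, y) \<in> faces N \<longleftrightarrow> \<bar>x\<bar> + \<bar>y\<bar> \<le> int N \<and> odd (x + y + int N)"
proof -
  have "\<bar>x\<bar> + \<bar>y\<bar> \<noteq> int N" if "odd (x + y + int N)"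
  proof
    assume "\<bar>x\<bar> + \<bar>y\<bar> = int N"
    then have "x + y + int N = (x + \<bar>x\<bar>) + (y + \<bar>y\<bar>)" by simp
    moreover have "even (z + \<bar>z\<bar>)" for z :: int by (cases "z \<ge> 0") simp_all
    ultimately show False using that by (metis dvd_add)
  qed
  then show ?thesis
    unfolding faces_def mem_Collect_eq prod.case by (metis order_le_less)
qed

lemma finite_diamond: "finite (diamond N)"
  by (rule finite_subset[of _ "{- int N - 1..int N + 1} \<times> {- int N - 1..int N + 1}"])
    (auto simp: diamond_def)

lemma finite_faces: "finite (faces N)"
  by (rule finite_subset[of _ "{- int N..int N} \<times> {- int N..int N}"]) (auto simp: faces_def)

definition face_weight ::
  "(int \<Rightarrow> int \<Rightarrow> real) \<Rightarrow> (int \<Rightarrow> int \<Rightarrow> real) \<Rightarrow> int \<times> int \<Rightarrow> (int \<times> int) set \<Rightarrow> real" where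
  "face_weight H U = (\<lambda>(x, y). four_cycle (x - 1, y - 1) (x, y - 1) (x, y) (x - 1, y)
     (H (x - 1) (y - 1)) (U x (y - 1)) (H (x - 1) y) (U (x - 1) (y - 1)))"

lemma face_weight_horizontal:
  "face_weight H U (a, b) {(x, y), (x + 1, y)} = (if a = x + 1 \<and> (b = y \<or> b = y + 1) then H x y else 0)"
  by (auto simp: face_weight_def four_cycle_def doubleton_eq_iff)

lemma face_weight_vertical:
  "face_weight H U (a, b) {(x, y), (x, y + 1)} = (if b = y + 1 \<and> (a = x \<or> a = x + 1) then U x y else 0)"
  by (auto simp: face_weight_def four_cycle_def doubleton_eq_iff)

lemma face_weight_other:
  assumes "\<And>x y. e \<noteq> {(x, y), (x + 1, y)}" "\<And>x y. e \<noteq> {(x, y), (x, y + 1)}"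
  shows "face_weight H U c e = 0"
proof -
  obtain a b where c: "c = (a, b)" by fastforce
  show ?thesis
    using assms(1)[of "a - 1" "b - 1"] assms(1)[of "a - 1" b] assms(2)[of a "b - 1"] assms(2)[of "a - 1" "b - 1"]
    by (auto simp: c face_weight_def four_cycle_def insert_commute)
qed

text \<open>The two faces at an edge have opposite colours, and both satisfy the weak bound if the
  edge lies in the diamond. The one of the right colour is the cell of the edge.\<close>

lemma grid_eq_sum_faces:
  assumes "e \<subseteq> diamond N"
  shows "grid H U e = (\<Sum>c\<in>faces N. face_weight H U c e)"
proof -
  consider (h) x y where "e = {(x, y), (x + 1, y)}" | (v) x y where "e = {(x, y), (x, y + 1)}"
    | (o) "\<And>x y. e \<noteq> {(x, y), (x + 1, y)}" "\<And>x y. e \<noteq> {(x, y), (x, y + 1)}"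
    by blast
  then show ?thesis
  proof cases
    case h
    define c where "c = (if odd (x + 1 + y + int N) then (x + 1, y) else (x + 1, y + 1))"
    have "\<bar>2 * x + 1\<bar> + \<bar>2 * y + 1\<bar> \<le> 2 * int N" "\<bar>2 * x + 3\<bar> + \<bar>2 * y + 1\<bar> \<le> 2 * int N"
      using assms by (simp_all add: h diamond_def algebra_simps)
    then have "\<bar>x + 1\<bar> + \<bar>y\<bar> \<le> int N" "\<bar>x + 1\<bar> + \<bar>y + 1\<bar> \<le> int N"
      by linarith+
    then have "c \<in> faces N"
      unfolding c_def in_faces_iff if_split_mem1 by auto
    moreover have "face_weight H U d e = (if d = c then H x y else 0)" if "d \<in> faces N" for d
      using that unfolding h c_def
      by (cases d) (auto simp: face_weight_horizontal faces_def)
    ultimately show ?thesis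
      by (simp add: h[symmetric] finite_faces) (simp add: h grid_horizontal)
  next
    case v
    define c where "c = (if odd (x + 1 + y + int N) then (x, y + 1) else (x + 1, y + 1))"
    have "\<bar>2 * x + 1\<bar> + \<bar>2 * y + 1\<bar> \<le> 2 * int N" "\<bar>2 * x + 1\<bar> + \<bar>2 * y + 3\<bar> \<le> 2 * int N"
      using assms by (simp_all add: v diamond_def algebra_simps)
    then have "\<bar>x\<bar> + \<bar>y + 1\<bar> \<le> int N" "\<bar>x + 1\<bar> + \<bar>y + 1\<bar> \<le> int N"
      by linarith+
    then have "c \<in> faces N"
      unfolding c_def in_faces_iff if_split_mem1 by auto
    moreover have "face_weight H U d e = (if d = c then U x y else 0)" if "d \<in> faces N" for d
      using that unfolding v c_def
      by (cases d) (auto simp: face_weight_vertical faces_def)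
    ultimately show ?thesis
      by (simp add: v[symmetric] finite_faces) (simp add: v grid_vertical)
  next
    case o
    then show ?thesis by (simp add: grid_other face_weight_other)
  qed
qed

definition corners :: "int \<times> int \<Rightarrow> (int \<times> int) set" where
  "corners = (\<lambda>(x, y). {(x - 1, y - 1), (x, y - 1), (x, y), (x - 1, y)})"

lemma in_corners_iff: "(x, y) \<in> corners (a, b) \<longleftrightarrow> (a = x \<or> a = x + 1) \<and> (b = y \<or> b = y + 1)"
  by (auto simp: corners_def)

lemma corners_subset_diamond:
  assumes "c \<in> faces N"
  shows "corners c \<subseteq> diamond N"
proof -
  obtain x y where c: "c = (x, y)" by fastforce
  have "\<bar>x\<bar> + \<bar>y\<bar> + 1 \<le> int N" using assms by (auto simp: c faces_def)
  then have "\<bar>2 * x + 1\<bar> + \<bar>2 * y + 1\<bar> \<le> 2 * int N" "\<bar>2 * x - 1\<bar> + \<bar>2 * y + 1\<bar> \<le> 2 * int N"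
    "\<bar>2 * x + 1\<bar> + \<bar>2 * y - 1\<bar> \<le> 2 * int N" "\<bar>2 * x - 1\<bar> + \<bar>2 * y - 1\<bar> \<le> 2 * int N"
    by linarith+
  then show ?thesis by (simp add: c corners_def diamond_def)
qed

text \<open>The four faces around a vertex alternate in colour and all satisfy the weak bound, which
  leaves two diagonally opposite ones.\<close>

lemma card_faces_at_interior:
  assumes "v \<in> diamond (N - 1)" "N > 0"
  shows "card {c \<in> faces N. v \<in> corners c} = 2"
proof -
  obtain x y where v: "v = (x, y)" by fastforce
  define p where "p \<longleftrightarrow> odd (x + y + int N)"
  have "\<bar>2 * x + 1\<bar> + \<bar>2 * y + 1\<bar> + 2 \<le> 2 * int N"
    using assms by (simp add: v diamond_def of_nat_diff)
  then have "\<bar>x\<bar> + \<bar>y\<bar> \<le> int N" "\<bar>x + 1\<bar> + \<bar>y\<bar> \<le> int N" "\<bar>x\<bar> + \<bar>y + 1\<bar> \<le> int N" "\<bar>x + 1\<bar> + \<bar>y + 1\<bar> \<le> int N"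
    by linarith+
  moreover have "odd (x + 1 + (y + 1) + int N) \<longleftrightarrow> p" "odd (x + 1 + y + int N) \<longleftrightarrow> \<not> p" "odd (x + (y + 1) + int N) \<longleftrightarrow> \<not> p"
    unfolding p_def by presburger+
  ultimately have "(x, y) \<in> faces N \<longleftrightarrow> p" "(x + 1, y + 1) \<in> faces N \<longleftrightarrow> p"
    "(x + 1, y) \<in> faces N \<longleftrightarrow> \<not> p" "(x, y + 1) \<in> faces N \<longleftrightarrow> \<not> p"
    unfolding in_faces_iff by (simp_all only: p_def[symmetric] simp_thms)
  then have "{c \<in> faces N. v \<in> corners c} = (if p then {(x, y), (x + 1, y + 1)} else {(x + 1, y), (x, y + 1)})"
    unfolding v by (auto simp: in_corners_iff)
  then show ?thesis by auto
qed

text \<open>At a boundary vertex the defining inequality is an equality, and of the four faces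
  around it only the one nearest to the origin is within the bound.\<close>

lemma card_faces_at_boundary:
  assumes "v \<in> diamond N - diamond (N - 1)" "N > 0"
  shows "card {c \<in> faces N. v \<in> corners c} = 1"
proof -
  obtain x y where v: "v = (x, y)" by fastforce
  have eq: "\<bar>2 * x + 1\<bar> + \<bar>2 * y + 1\<bar> = 2 * int N"
  proof -
    \<comment> \<open>Both summands are odd, so their sum is even and cannot be
      \<open>2 * N - 1\<close>.\<close>
    have abs_odd: "\<exists>k. \<bar>2 * z + 1\<bar> = 2 * k + 1" for z :: int
    proof (cases "z \<ge> 0")
      case False
      then have "\<bar>2 * z + 1\<bar> = 2 * (- z - 1) + 1" by (simp add: abs_if)
      then show ?thesis ..
    qed auto
    obtain k where k: "\<bar>2 * x + 1\<bar> = 2 * k + 1" using abs_odd by blast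
    obtain l where l: "\<bar>2 * y + 1\<bar> = 2 * l + 1" using abs_odd by blast
    have "\<bar>2 * x + 1\<bar> + \<bar>2 * y + 1\<bar> \<le> 2 * int N" "\<not> \<bar>2 * x + 1\<bar> + \<bar>2 * y + 1\<bar> \<le> 2 * int N - 2"
      using assms by (simp_all add: v diamond_def of_nat_diff)
    then show ?thesis
      unfolding k l by presburger
  qed
  have "\<exists>c. {c \<in> faces N. v \<in> corners c} = {c}"
  proof (cases "x \<ge> 0"; cases "y \<ge> 0")
    assume xy: "x \<ge> 0" "y \<ge> 0"
    then have N: "int N = x + y + 1" using eq by auto
    have "{c \<in> faces N. v \<in> corners c} = {(x, y)}"
      using xy by (auto simp: v corners_def faces_def N)
    then show ?thesis by blast
  next
    assume xy: "x \<ge> 0" "\<not> y \<ge> 0"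
    then have N: "int N = x - y" using eq by auto
    have "{c \<in> faces N. v \<in> corners c} = {(x, y + 1)}"
      using xy by (auto simp: v corners_def faces_def N)
    then show ?thesis by blast
  next
    assume xy: "\<not> x \<ge> 0" "y \<ge> 0"
    then have N: "int N = y - x" using eq by auto
    have "{c \<in> faces N. v \<in> corners c} = {(x + 1, y)}"
      using xy by (auto simp: v corners_def faces_def N)
    then show ?thesis by blast
  next
    assume xy: "\<not> x \<ge> 0" "\<not> y \<ge> 0"
    then have N: "int N = - x - y - 1" using eq by auto
    have "{c \<in> faces N. v \<in> corners c} = {(x + 1, y + 1)}"
      using xy by (auto simp: v corners_def faces_def N)
    then show ?thesis by blast
  qed
  then show ?thesis by (auto simp: card_1_singleton_iff)
qed

lemma diamond_mono: "M \<le> N \<Longrightarrow> diamond M \<subseteq> diamond N"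
  by (auto simp: diamond_def)

text \<open>Here every vertex moves: interior vertices change between their two faces, and boundary
  vertices are matched in their single face and deleted. Prescribing the new weights on the sides of
  \<open>faces N\<close> suffices, since these include all edges of the smaller diamond.\<close>

lemma diamond_reduction:
  fixes D :: "int \<Rightarrow> int \<Rightarrow> real"
  assumes N: "N > 0"
    and D: "\<And>x y. (x, y) \<in> faces N \<Longrightarrow> D x y = H (x - 1) (y - 1) * H (x - 1) y + U x (y - 1) * U (x - 1) (y - 1)"
    and D0: "\<And>x y. (x, y) \<in> faces N \<Longrightarrow> D x y \<noteq> 0"
    and new: "\<And>x y. (x, y) \<in> faces N \<Longrightarrow> H' (x - 1) (y - 1) = H (x - 1) y / D x y"
      "\<And>x y. (x, y) \<in> faces N \<Longrightarrow> H' (x - 1) y = H (x - 1) (y - 1) / D x y"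
      "\<And>x y. (x, y) \<in> faces N \<Longrightarrow> U' (x - 1) (y - 1) = U x (y - 1) / D x y"
      "\<And>x y. (x, y) \<in> faces N \<Longrightarrow> U' x (y - 1) = U (x - 1) (y - 1) / D x y"
  shows "pmsum (diamond N) (grid H U) = (\<Prod>(x, y)\<in>faces N. D x y) * pmsum (diamond (N - 1)) (grid H' U')"
proof -
  let ?C = "faces N"
  have loc: "c \<in> {c \<in> faces N. v \<in> corners c}"
    if "c \<in> faces N" "finite S" "pmsum S (face_weight H U c) \<noteq> 0" "v \<in> S" for c S v H U
  proof -
    have "v \<in> corners c"
    proof (rule ccontr)
      assume "v \<notin> corners c"
      then have "face_weight H U c e = 0" if "v \<in> e" for e
        using that by (cases c) (auto simp: face_weight_def four_cycle_def corners_def)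
      with pmsum_eq_0[OF that(2,4)] that(3) show False by blast
    qed
    with that show ?thesis by simp
  qed
  have "pmsum (diamond N) (grid H U) =
    (\<Sum>\<sigma>\<in>diamond N \<rightarrow>\<^sub>E ?C. \<Prod>c\<in>?C. pmsum {v\<in>diamond N. \<sigma> v = c} (face_weight H U c))"
    by (subst pmsum_sum[OF finite_diamond finite_faces, symmetric]) (rule pmsum_cong[OF grid_eq_sum_faces])
  also have "\<dots> = (\<Prod>c\<in>?C. case_prod D c) *
    (\<Sum>\<sigma>\<in>diamond (N - 1) \<rightarrow>\<^sub>E ?C. \<Prod>c\<in>?C. pmsum {v\<in>diamond (N - 1). \<sigma> v = c} (face_weight H' U' c))"
  proof (rule state_sum_flip[where K = UNIV and I = "\<lambda>v. {c \<in> faces N. v \<in> corners c}"])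
    show "diamond (N - 1) \<subseteq> diamond N" by (rule diamond_mono) simp
    show "card {c \<in> faces N. v \<in> corners c} = 2" if "v \<in> diamond (N - 1)" for v
      using card_faces_at_interior[OF that N] .
    show "v \<in> UNIV \<and> card {c \<in> faces N. v \<in> corners c} = 1" if "v \<in> diamond N - diamond (N - 1)" for v
      using card_faces_at_boundary[OF that N] by simp
    show "c \<in> {c \<in> faces N. v \<in> corners c}"
      if "c \<in> faces N" "S \<subseteq> diamond N" "pmsum S (face_weight H U c) \<noteq> 0" "v \<in> S" for c S v
      using loc[OF that(1) _ that(3,4)] finite_subset[OF that(2) finite_diamond] by blast
    show "c \<in> {c \<in> faces N. v \<in> corners c}"
      if "c \<in> faces N" "S \<subseteq> diamond (N - 1)" "pmsum S (face_weight H' U' c) \<noteq> 0" "v \<in> S" for c S v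
      using loc[OF that(1) _ that(3,4)] finite_subset[OF that(2) finite_diamond] by blast
    fix c S
    assume c: "c \<in> faces N" and S: "S \<subseteq> {v \<in> diamond N. c \<in> {c \<in> faces N. v \<in> corners c}}"
    obtain x y where xy: "c = (x, y)" by fastforce
    note c' = c[unfolded xy]
    have cor: "{v \<in> diamond N. c \<in> {c \<in> faces N. v \<in> corners c}} = {(x - 1, y - 1), (x, y - 1), (x, y), (x - 1, y)}"
      using corners_subset_diamond[OF c] c by (auto simp: corners_def xy)
    have "pmsum S (face_weight H U c) = D x y * pmsum ({(x - 1, y - 1), (x, y - 1), (x, y), (x - 1, y)} - S) (face_weight H' U' c)"
      using four_cycle_flip[of "(x - 1, y - 1)" "(x, y - 1)" "(x, y)" "(x - 1, y)" "H (x - 1) (y - 1)" "H (x - 1) y" "U x (y - 1)" "U (x - 1) (y - 1)" S]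
        S[unfolded cor] D[OF c'] D0[OF c'] new[OF c']
      by (simp add: xy face_weight_def)
    then show "pmsum S (face_weight H U c) = (case c of (x, y) \<Rightarrow> D x y) *
        pmsum (S - UNIV \<union> ({v \<in> diamond N. c \<in> {c \<in> faces N. v \<in> corners c}} \<inter> UNIV - S)) (face_weight H' U' c)"
      unfolding cor by (simp add: xy)
  qed (auto simp: finite_diamond finite_faces)
  also have "(\<Sum>\<sigma>\<in>diamond (N - 1) \<rightarrow>\<^sub>E ?C. \<Prod>c\<in>?C. pmsum {v\<in>diamond (N - 1). \<sigma> v = c} (face_weight H' U' c)) =
    pmsum (diamond (N - 1)) (grid H' U')"
    by (subst pmsum_sum[OF finite_diamond finite_faces, symmetric])
      (rule pmsum_cong, rule grid_eq_sum_faces[symmetric], use diamond_mono[of "N - 1" N] in auto)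
  finally show ?thesis by simp
qed

section \<open>A five-parameter family of periodic weights\<close>

lemma prod_lessThan_parity:
  fixes f :: "bool \<Rightarrow> real"
  shows "(\<Prod>a<N. f (even a)) = f True ^ ((N + 1) div 2) * f False ^ (N div 2)"
proof (induction N)
  case (Suc N)
  show ?case
  proof (cases "even N")
    case True
    then obtain k where "N = 2 * k" by blast
    then show ?thesis unfolding prod.lessThan_Suc Suc.IH by simp
  next
    case False
    then obtain k where "N = 2 * k + 1" by (rule oddE)
    then show ?thesis unfolding prod.lessThan_Suc Suc.IH by simp
  qed
qed simp

text \<open>A rotation by 45 degrees: \<open>x + y = 2 * a - N + 1\<close> and
  \<open>x - y = 2 * b - N + 1\<close> identify the faces with an \<open>N\<close> by
  \<open>N\<close> square.\<close>

lemma prod_faces: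
  fixes D :: "int \<Rightarrow> int \<Rightarrow> real"
  shows "(\<Prod>(x, y)\<in>faces N. D x y) = (\<Prod>a<N. \<Prod>b<N. D (int a + int b - int N + 1) (int a - int b))"
proof -
  have "(\<Prod>(x, y)\<in>faces N. D x y) = (\<Prod>(a, b)\<in>{..<N} \<times> {..<N}. D (int a + int b - int N + 1) (int a - int b))"
  proof (rule prod.reindex_bij_witness[symmetric, where j = "\<lambda>(a, b). (int a + int b - int N + 1, int a - int b)"
        and i = "\<lambda>(x, y). (nat ((x + y + int N - 1) div 2), nat ((x - y + int N - 1) div 2))"])
    fix c assume "c \<in> faces N"
    then obtain x y where c: "c = (x, y)" and l: "\<bar>x\<bar> + \<bar>y\<bar> < int N" and o: "odd (x + y + int N)"
      by (auto simp: faces_def)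
    then obtain k where k: "x + y + int N = 2 * k + 1" by (blast elim: oddE)
    then have e: "(x + y + int N - 1) div 2 = k" "(x - y + int N - 1) div 2 = k - y"
      by simp_all
    have "0 \<le> k" "0 \<le> k - y" "k < int N" "k - y < int N" using k l by linarith+
    with e c k show "(case case c of (x, y) \<Rightarrow> (nat ((x + y + int N - 1) div 2), nat ((x - y + int N - 1) div 2)) of
        (a, b) \<Rightarrow> (int a + int b - int N + 1, int a - int b)) = c"
      and "(case c of (x, y) \<Rightarrow> (nat ((x + y + int N - 1) div 2), nat ((x - y + int N - 1) div 2))) \<in> {..<N} \<times> {..<N}"
      by auto
  next
    fix d assume "d \<in> {..<N} \<times> {..<N}"
    then obtain a b where d: "d = (a, b)" "a < N" "b < N" by auto
    have s: "int a + int b - int N + 1 + (int a - int b) + int N - 1 = 2 * int a"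
      "int a + int b - int N + 1 - (int a - int b) + int N - 1 = 2 * int b"
      by simp_all
    show "(case case d of (a, b) \<Rightarrow> (int a + int b - int N + 1, int a - int b) of
        (x, y) \<Rightarrow> (nat ((x + y + int N - 1) div 2), nat ((x - y + int N - 1) div 2))) = d"
      unfolding d prod.case s by simp
    have "\<bar>int a + int b - int N + 1\<bar> + \<bar>int a - int b\<bar> < int N"
      using d by linarith
    moreover have "odd (int a + int b - int N + 1 + (int a - int b) + int N)" by presburger
    ultimately show "(case d of (a, b) \<Rightarrow> (int a + int b - int N + 1, int a - int b)) \<in> faces N"
      by (simp only: d prod.case faces_def mem_Collect_eq simp_thms)
  qed auto
  then show ?thesis by (simp add: prod.cartesian_product)
qed

text \<open>The exponents come from counting the even (\<open>e\<close>) and the odd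
  (\<open>z\<close>) numbers below \<open>N\<close>.\<close>

lemma prod_faces_parity:
  fixes D :: "int \<Rightarrow> int \<Rightarrow> real" and g :: "bool \<Rightarrow> bool \<Rightarrow> real"
  assumes "\<And>a b. a < N \<Longrightarrow> b < N \<Longrightarrow> D (int a + int b - int N + 1) (int a - int b) = g (even a) (even b)"
  defines "e \<equiv> (N + 1) div 2" and "z \<equiv> N div 2"
  shows "(\<Prod>(x, y)\<in>faces N. D x y) =
    g True True ^ (e * e) * g True False ^ (e * z) * g False True ^ (e * z) * g False False ^ (z * z)"
proof -
  have "(\<Prod>(x, y)\<in>faces N. D x y) = (\<Prod>a<N. \<Prod>b<N. g (even a) (even b))"
    unfolding prod_faces by (intro prod.cong refl) (use assms(1) in auto)
  also have "\<dots> = (\<Prod>a<N. g (even a) True ^ e * g (even a) False ^ z)"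
    unfolding prod_lessThan_parity e_def z_def by simp
  also have "\<dots> = (g True True ^ e * g True False ^ z) ^ e * (g False True ^ e * g False False ^ z) ^ z"
    unfolding e_def z_def
    by (rule prod_lessThan_parity[where f = "\<lambda>a. g a True ^ ((N + 1) div 2) * g a False ^ (N div 2)"])
  finally show ?thesis
    by (simp add: power_mult_distrib power_mult[symmetric] mult.commute mult.left_commute)
qed

text \<open>A face with two even coordinates carries, according to the parity \<open>t\<close>, either \<open>p, p, v, v\<close> or \<open>q, q, 0, 0\<close> on its horizontal and vertical edges; a face with two odd coordinates carries \<open>h, h, u, u\<close>.\<close>

definition horizontal_weight :: "int \<Rightarrow> real \<Rightarrow> real \<Rightarrow> real \<Rightarrow> int \<Rightarrow> int \<Rightarrow> real" where
  "horizontal_weight t h p q x y = (if even x then h else if even ((x + 1) div 2 + (y + 1) div 2 + t) then p else q)"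

definition vertical_weight :: "int \<Rightarrow> real \<Rightarrow> real \<Rightarrow> int \<Rightarrow> int \<Rightarrow> real" where
  "vertical_weight t u v x y = (if even y then u else if even ((x + 1) div 2 + (y + 1) div 2 + t) then v else 0)"

text \<open>The phase \<open>n + 1\<close> places \<open>p\<close> and \<open>v\<close> at the
  midpoints of the dungeon of order \<open>n\<close>. It is also consistent with lowering
  \<open>n\<close> by the two renewal steps.\<close>

definition diamond_sum :: "nat \<Rightarrow> real \<Rightarrow> real \<Rightarrow> real \<Rightarrow> real \<Rightarrow> real \<Rightarrow> real" where
  "diamond_sum n u v h p q = pmsum (diamond (2 * n)) (grid (horizontal_weight (int n + 1) h p q) (vertical_weight (int n + 1) u v))"

lemma diamond_sum_0 [simp]: "diamond_sum 0 u v h p q = 1"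
proof -
  have "\<bar>2 * a + 1\<bar> > 0" for a :: int by presburger
  then have "diamond 0 = {}" by (auto simp: diamond_def not_le intro: add_pos_pos)
  then show ?thesis by (simp add: diamond_sum_def)
qed

section \<open>Two renewal steps and the parameter map\<close>

lemma horizontal_weight_even: "horizontal_weight t h p q (2 * i) y = h"
  and horizontal_weight_odd: "horizontal_weight t h p q (2 * i - 1) (2 * j) = (if even (i + j + t) then p else q)"
    "horizontal_weight t h p q (2 * i - 1) (2 * j - 1) = (if even (i + j + t) then p else q)"
  by (simp_all add: horizontal_weight_def)

lemma vertical_weight_even: "vertical_weight t u v x (2 * j) = u"
  and vertical_weight_odd: "vertical_weight t u v (2 * i) (2 * j - 1) = (if even (i + j + t) then v else 0)"
    "vertical_weight t u v (2 * i - 1) (2 * j - 1) = (if even (i + j + t) then v else 0)"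
  by (simp_all add: vertical_weight_def)

text \<open>At even order the renewed faces have one even and one odd coordinate. Their opposite
  sides carry \<open>p, q\<close> and \<open>u, u\<close>, or \<open>h, h\<close> and
  \<open>v, 0\<close>, with determinants \<open>p * q + u\<^sup>2\<close> and
  \<open>h\<^sup>2\<close>. Exchanging opposite sides swaps \<open>p\<close> with \<open>q\<close>
  and \<open>v\<close> with 0, which is the shift of \<open>t\<close>.\<close>

lemma odd_step:
  assumes pos: "u > 0" "v > 0" "h > 0" "p > 0" "q > 0"
  defines "d \<equiv> p * q + u\<^sup>2"
  shows "pmsum (diamond (2 * Suc m)) (grid (horizontal_weight t h p q) (vertical_weight t u v)) =
    (d * h\<^sup>2) ^ (2 * (Suc m)\<^sup>2) *
    pmsum (diamond (2 * m + 1)) (grid (horizontal_weight (t + 1) (1 / h) (p / d) (q / d)) (vertical_weight (t + 1) (u / d) (v / h\<^sup>2)))"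
proof -
  define D where "D x y = (if even x then d else h\<^sup>2)" for x y :: int
  have d: "d > 0" using pos by (simp add: d_def add_pos_pos)
  let ?N = "2 * Suc m"
  let ?H = "horizontal_weight t h p q" and ?U = "vertical_weight t u v"
  let ?H' = "horizontal_weight (t + 1) (1 / h) (p / d) (q / d)" and ?U' = "vertical_weight (t + 1) (u / d) (v / h\<^sup>2)"
  have face: "D x y = ?H (x - 1) (y - 1) * ?H (x - 1) y + ?U x (y - 1) * ?U (x - 1) (y - 1) \<and>
    ?H' (x - 1) (y - 1) = ?H (x - 1) y / D x y \<and> ?H' (x - 1) y = ?H (x - 1) (y - 1) / D x y \<and>
    ?U' (x - 1) (y - 1) = ?U x (y - 1) / D x y \<and> ?U' x (y - 1) = ?U (x - 1) (y - 1) / D x y"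
    if "(x, y) \<in> faces ?N" for x y
  proof (cases "even x")
    case True
    with that have "odd y" by (auto simp: faces_def)
    with True obtain i j where "x = 2 * i" "y = 2 * j + 1" by (blast elim: evenE oddE)
    then have xy: "x = 2 * i" "y = 2 * (j + 1) - 1" "2 * (j + 1) - 1 - 1 = 2 * j" by simp_all
    define P where "P \<longleftrightarrow> even (i + j + t)"
    have P: "even (i + j + t) \<longleftrightarrow> P" "even (i + (j + 1) + t) \<longleftrightarrow> \<not> P"
      "even (i + j + (t + 1)) \<longleftrightarrow> \<not> P" "even (i + (j + 1) + (t + 1)) \<longleftrightarrow> P"
      unfolding P_def by presburger+
    show ?thesis
      unfolding xy horizontal_weight_odd vertical_weight_even P
      by (simp add: D_def d_def power2_eq_square)
  next
    case False
    with that have "even y" by (auto simp: faces_def)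
    with False obtain i j where "x = 2 * i + 1" "y = 2 * j" by (blast elim: evenE oddE)
    then have xy: "x = 2 * (i + 1) - 1" "y = 2 * j" "2 * (i + 1) - 1 - 1 = 2 * i" by simp_all
    define P where "P \<longleftrightarrow> even (i + j + t)"
    have P: "even (i + j + t) \<longleftrightarrow> P" "even (i + 1 + j + t) \<longleftrightarrow> \<not> P"
      "even (i + j + (t + 1)) \<longleftrightarrow> \<not> P" "even (i + 1 + j + (t + 1)) \<longleftrightarrow> P"
      unfolding P_def by presburger+
    show ?thesis
      using pos False unfolding xy horizontal_weight_even vertical_weight_odd P
      by (simp add: D_def power2_eq_square)
  qed
  have E: "2 * (Suc m)\<^sup>2 = Suc m * Suc m + Suc m * Suc m" by (simp add: power2_eq_square)
  have "pmsum (diamond ?N) (grid ?H ?U) = (\<Prod>(x, y)\<in>faces ?N. D x y) * pmsum (diamond (?N - 1)) (grid ?H' ?U')"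
  proof (rule diamond_reduction)
    show "D x y \<noteq> 0" for x y using pos d by (auto simp: D_def)
    show "?N > 0" by simp
  qed (use face in blast)+
  also have "(\<Prod>(x, y)\<in>faces ?N. D x y) = (d * h\<^sup>2) ^ (2 * (Suc m)\<^sup>2)"
    unfolding E power_add power_mult_distrib
    by (subst prod_faces_parity[where g = "\<lambda>a b. if a = b then h\<^sup>2 else d"])
      (simp_all add: D_def mult_ac del: mult_Suc mult_Suc_right)
  finally show ?thesis by simp
qed

text \<open>At odd order the coordinates of a renewed face have equal parity and its opposite sides
  have equal weights, so renewal only divides weights and \<open>t\<close> stays. The parity
  assumption on \<open>t\<close> decides which of the two kinds of even faces is the more numerous:
  those with weights \<open>q, q, 0, 0\<close>.\<close>

lemma even_step:
  assumes pos: "u > 0" "v > 0" "h > 0" "p > 0" "q > 0" and t: "even (t + int m + 1)"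
  defines "e \<equiv> p\<^sup>2 + v\<^sup>2" and "f \<equiv> h\<^sup>2 + u\<^sup>2"
  shows "pmsum (diamond (2 * m + 1)) (grid (horizontal_weight t h p q) (vertical_weight t u v)) =
    (q\<^sup>2) ^ (Suc m)\<^sup>2 * e ^ m\<^sup>2 * f ^ (2 * m * Suc m) *
    pmsum (diamond (2 * m)) (grid (horizontal_weight t (h / f) (p / e) (1 / q)) (vertical_weight t (u / f) (v / e)))"
proof -
  define D where "D x y = (if even x then if even (x div 2 + y div 2 + t) then e else q\<^sup>2 else f)" for x y :: int
  have ef: "e > 0" "f > 0" using pos by (simp_all add: e_def f_def add_pos_pos)
  let ?N = "2 * m + 1"
  let ?H = "horizontal_weight t h p q" and ?U = "vertical_weight t u v"
  let ?H' = "horizontal_weight t (h / f) (p / e) (1 / q)" and ?U' = "vertical_weight t (u / f) (v / e)"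
  have face: "D x y = ?H (x - 1) (y - 1) * ?H (x - 1) y + ?U x (y - 1) * ?U (x - 1) (y - 1) \<and>
    ?H' (x - 1) (y - 1) = ?H (x - 1) y / D x y \<and> ?H' (x - 1) y = ?H (x - 1) (y - 1) / D x y \<and>
    ?U' (x - 1) (y - 1) = ?U x (y - 1) / D x y \<and> ?U' x (y - 1) = ?U (x - 1) (y - 1) / D x y"
    if "(x, y) \<in> faces ?N" for x y
  proof (cases "even x")
    case True
    with that have "even y" by (auto simp: faces_def)
    with True obtain i j where "x = 2 * i" "y = 2 * j" by (blast elim: evenE oddE)
    then show ?thesis
      using pos ef by (auto simp: horizontal_weight_def vertical_weight_def D_def e_def power2_eq_square)
  next
    case False
    with that have "odd y" by (auto simp: faces_def)
    with False obtain i j where "x = 2 * i + 1" "y = 2 * j + 1" by (blast elim: evenE oddE)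
    then show ?thesis
      using pos ef by (auto simp: horizontal_weight_def vertical_weight_def D_def f_def power2_eq_square)
  qed
  have E: "2 * m * Suc m = Suc m * m + Suc m * m" by simp
  have "pmsum (diamond ?N) (grid ?H ?U) = (\<Prod>(x, y)\<in>faces ?N. D x y) * pmsum (diamond (?N - 1)) (grid ?H' ?U')"
  proof (rule diamond_reduction)
    show "D x y \<noteq> 0" for x y using pos ef by (auto simp: D_def)
    show "?N > 0" by simp
  qed (use face in blast)+
  also have "(\<Prod>(x, y)\<in>faces ?N. D x y) = (q\<^sup>2) ^ (Suc m)\<^sup>2 * e ^ m\<^sup>2 * f ^ (2 * m * Suc m)"
    unfolding E power_add power2_eq_square[of "Suc m"] power2_eq_square[of m]
  proof (subst prod_faces_parity[where g = "\<lambda>a b. if a = b then if a then q\<^sup>2 else e else f"])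
    fix a b
    show "D (int a + int b - int ?N + 1) (int a - int b) = (if even a = even b then if even a then q\<^sup>2 else e else f)"
    proof (cases "even (a + b)")
      case True
      then obtain k where k: "int a + int b = 2 * k" by (metis evenE of_nat_add even_of_nat)
      have x: "int a + int b - int ?N + 1 = 2 * (k - int m)" and y: "int a - int b = 2 * (int a - k)"
        using k by simp_all
      have "even (2 * (k - int m) div 2 + 2 * (int a - k) div 2 + t) \<longleftrightarrow> odd a"
        using t by auto
      then show ?thesis
        using True unfolding x y D_def by (simp only: even_mult_iff) simp
    next
      case False
      then have "odd (int a + int b - int ?N + 1)" by simp
      with False show ?thesis by (auto simp: D_def)
    qed
  qed (simp_all add: mult_ac del: mult_Suc mult_Suc_right)
  finally show ?thesis by simp
qed

lemma horizontal_weight_shift: "horizontal_weight (t + 2) = horizontal_weight t" and vertical_weight_shift: "vertical_weight (t + 2) = vertical_weight t"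
  by (auto simp: horizontal_weight_def vertical_weight_def fun_eq_iff)

text \<open>The two steps end with phase \<open>int m + 3\<close>, and the weights have period 2 in
  the phase, so this is the phase of order \<open>m\<close>.\<close>

lemma diamond_sum_Suc:
  assumes pos: "u > 0" "v > 0" "h > 0" "p > 0" "q > 0"
    and d: "d = p * q + u\<^sup>2" and e: "e = (p / d)\<^sup>2 + (v / h\<^sup>2)\<^sup>2" and f: "f = (1 / h)\<^sup>2 + (u / d)\<^sup>2"
  shows "diamond_sum (Suc m) u v h p q = (d * h\<^sup>2) ^ (2 * (Suc m)\<^sup>2) * ((q / d)\<^sup>2) ^ (Suc m)\<^sup>2 * e ^ m\<^sup>2 * f ^ (2 * m * Suc m) *
    diamond_sum m (u / d / f) (v / h\<^sup>2 / e) (1 / h / f) (p / d / e) (d / q)"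
proof -
  have d0: "d > 0" using pos by (simp add: d add_pos_pos)
  have t: "int (Suc m) + 1 + 1 = (int m + 1) + 2" by simp
  show ?thesis
    unfolding diamond_sum_def odd_step[OF pos] d[symmetric] t horizontal_weight_shift vertical_weight_shift
    by (subst even_step) (use pos d0 in \<open>auto simp: e[symmetric] f[symmetric]\<close>)
qed

text \<open>The exponent is the number of edges in a perfect matching of the diamond of order
  \<open>2 * n\<close>. The proof does not count edges but follows the recurrence: the parameter map
  has degree 1 and the factor of a step has degree \<open>8 * m + 6\<close>.\<close>

lemma diamond_sum_scale:
  assumes "l > 0" "u > 0" "v > 0" "h > 0" "p > 0" "q > 0"
  shows "diamond_sum n (l * u) (l * v) (l * h) (l * p) (l * q) = l ^ (4 * n\<^sup>2 + 2 * n) * diamond_sum n u v h p q"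
  using assms
proof (induction n arbitrary: u v h p q)
  case (Suc m)
  define d where "d = p * q + u\<^sup>2"
  define e where "e = (p / d)\<^sup>2 + (v / h\<^sup>2)\<^sup>2"
  define f where "f = (1 / h)\<^sup>2 + (u / d)\<^sup>2"
  note l = \<open>l > 0\<close>
  have d0: "d > 0" using Suc.prems by (simp add: d_def add_pos_pos)
  have e0: "e > 0" using Suc.prems d0 by (simp add: e_def add_pos_pos)
  have f0: "f > 0" using Suc.prems d0 by (simp add: f_def add_pos_pos)
  have d': "l\<^sup>2 * d = l * p * (l * q) + (l * u)\<^sup>2" by (simp add: d_def power2_eq_square algebra_simps)
  have e': "e / l\<^sup>2 = (l * p / (l\<^sup>2 * d))\<^sup>2 + (l * v / (l * h)\<^sup>2)\<^sup>2"
    using l by (simp add: e_def power2_eq_square field_simps)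
  have f': "f / l\<^sup>2 = (1 / (l * h))\<^sup>2 + (l * u / (l\<^sup>2 * d))\<^sup>2"
    using l by (simp add: f_def power2_eq_square field_simps)
  have "diamond_sum (Suc m) (l * u) (l * v) (l * h) (l * p) (l * q) =
    (l\<^sup>2 * d * (l * h)\<^sup>2) ^ (2 * (Suc m)\<^sup>2) * ((l * q / (l\<^sup>2 * d))\<^sup>2) ^ (Suc m)\<^sup>2 * (e / l\<^sup>2) ^ m\<^sup>2 * (f / l\<^sup>2) ^ (2 * m * Suc m) *
    diamond_sum m (l * u / (l\<^sup>2 * d) / (f / l\<^sup>2)) (l * v / (l * h)\<^sup>2 / (e / l\<^sup>2)) (1 / (l * h) / (f / l\<^sup>2)) (l * p / (l\<^sup>2 * d) / (e / l\<^sup>2)) (l\<^sup>2 * d / (l * q))"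
    by (rule diamond_sum_Suc) (use Suc.prems d' e' f' in auto)
  also have "diamond_sum m (l * u / (l\<^sup>2 * d) / (f / l\<^sup>2)) (l * v / (l * h)\<^sup>2 / (e / l\<^sup>2)) (1 / (l * h) / (f / l\<^sup>2)) (l * p / (l\<^sup>2 * d) / (e / l\<^sup>2)) (l\<^sup>2 * d / (l * q)) =
    diamond_sum m (l * (u / d / f)) (l * (v / h\<^sup>2 / e)) (l * (1 / h / f)) (l * (p / d / e)) (l * (d / q))"
    using l by (simp add: power2_eq_square mult.commute)
  also have "\<dots> = l ^ (4 * m\<^sup>2 + 2 * m) * diamond_sum m (u / d / f) (v / h\<^sup>2 / e) (1 / h / f) (p / d / e) (d / q)"
    by (rule Suc.IH) (use Suc.prems d0 e0 f0 in auto)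
  also have "(l\<^sup>2 * d * (l * h)\<^sup>2) ^ (2 * (Suc m)\<^sup>2) * ((l * q / (l\<^sup>2 * d))\<^sup>2) ^ (Suc m)\<^sup>2 * (e / l\<^sup>2) ^ m\<^sup>2 * (f / l\<^sup>2) ^ (2 * m * Suc m) =
    l ^ (8 * m + 6) * ((d * h\<^sup>2) ^ (2 * (Suc m)\<^sup>2) * ((q / d)\<^sup>2) ^ (Suc m)\<^sup>2 * e ^ m\<^sup>2 * f ^ (2 * m * Suc m))"
  proof -
    have "l\<^sup>2 * d * (l * h)\<^sup>2 = l ^ 4 * (d * h\<^sup>2)" by (simp add: power2_eq_square power4_eq_xxxx)
    moreover have "(l * q / (l\<^sup>2 * d))\<^sup>2 = (1 / l\<^sup>2) * (q / d)\<^sup>2"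
      using l by (simp add: power2_eq_square)
    \<comment> \<open>With \<open>k = m + 1\<close> the exponent of \<open>l\<close> is \<open>8 *
      k\<^sup>2 - 2 * k\<^sup>2 - 2 * m\<^sup>2 - 4 * m * k = 8 * m + 6\<close>.\<close>
    moreover have "(l ^ 4) ^ (2 * (Suc m)\<^sup>2) * (1 / l\<^sup>2) ^ (Suc m)\<^sup>2 * (1 / l\<^sup>2) ^ m\<^sup>2 * (1 / l\<^sup>2) ^ (2 * m * Suc m) = l ^ (8 * m + 6)"
    proof -
      have "(l ^ 4) ^ (2 * (Suc m)\<^sup>2) = l ^ (8 * m + 6) * (l\<^sup>2) ^ ((Suc m)\<^sup>2 + m\<^sup>2 + 2 * m * Suc m)"
        unfolding power_mult[symmetric] power_add[symmetric]
        by (rule arg_cong[where f = "\<lambda>k. l ^ k"]) (simp add: power2_eq_square algebra_simps)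
      then show ?thesis
        using l by (simp add: power_add power_one_over)
    qed
    moreover have "(l ^ 4 * x) ^ i * (r * y) ^ j * (r * e) ^ k * (r * f) ^ n =
      (l ^ 4) ^ i * r ^ j * r ^ k * r ^ n * (x ^ i * y ^ j * e ^ k * f ^ n)" for x y r i j k n
      by (simp add: power_mult_distrib mult_ac)
    moreover have "e / l\<^sup>2 = (1 / l\<^sup>2) * e" "f / l\<^sup>2 = (1 / l\<^sup>2) * f" by simp_all
    ultimately show ?thesis by (simp only:)
  qed
  finally have "diamond_sum (Suc m) (l * u) (l * v) (l * h) (l * p) (l * q) =
    l ^ (8 * m + 6 + (4 * m\<^sup>2 + 2 * m)) * ((d * h\<^sup>2) ^ (2 * (Suc m)\<^sup>2) * ((q / d)\<^sup>2) ^ (Suc m)\<^sup>2 * e ^ m\<^sup>2 * f ^ (2 * m * Suc m) *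
      diamond_sum m (u / d / f) (v / h\<^sup>2 / e) (1 / h / f) (p / d / e) (d / q))"
    by (simp only: power_add mult_ac)
  also have "(d * h\<^sup>2) ^ (2 * (Suc m)\<^sup>2) * ((q / d)\<^sup>2) ^ (Suc m)\<^sup>2 * e ^ m\<^sup>2 * f ^ (2 * m * Suc m) *
      diamond_sum m (u / d / f) (v / h\<^sup>2 / e) (1 / h / f) (p / d / e) (d / q) = diamond_sum (Suc m) u v h p q"
    by (rule diamond_sum_Suc[symmetric]) (use Suc.prems d_def e_def f_def in auto)
  also have "8 * m + 6 + (4 * m\<^sup>2 + 2 * m) = 4 * (Suc m)\<^sup>2 + 2 * Suc m"
    by (simp add: power2_eq_square algebra_simps)
  finally show ?case .
qed simp

text \<open>Sorting the factor by its quadratic, linear and constant exponent in \<open>m\<close>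
  makes it possible to compose steps. Under scaling, \<open>a\<close> is invariant, while
  \<open>b\<close> and \<open>c\<close> have degrees 8 and 6.\<close>

lemma diamond_sum_Suc_collect:
  assumes pos: "u > 0" "v > 0" "h > 0" "p > 0" "q > 0"
    and d: "d = p * q + u\<^sup>2" and e: "e = (p / d)\<^sup>2 + (v / h\<^sup>2)\<^sup>2" and f: "f = (1 / h)\<^sup>2 + (u / d)\<^sup>2"
    and c: "c = (d * h\<^sup>2)\<^sup>2 * (q / d)\<^sup>2" and b: "b = c\<^sup>2 * f\<^sup>2" and a: "a = c * e * f\<^sup>2"
    and new: "u' = u / d / f" "v' = v / h\<^sup>2 / e" "h' = 1 / h / f" "p' = p / d / e" "q' = d / q"
  shows "diamond_sum (Suc m) u v h p q = a ^ m\<^sup>2 * b ^ m * c * diamond_sum m u' v' h' p' q'"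
proof -
  have sq: "(Suc m)\<^sup>2 = m\<^sup>2 + 2 * m + 1" "2 * m * Suc m = 2 * (m\<^sup>2 + m)"
    by (simp_all add: power2_eq_square)
  have "(d * h\<^sup>2) ^ (2 * (Suc m)\<^sup>2) * ((q / d)\<^sup>2) ^ (Suc m)\<^sup>2 = c ^ (Suc m)\<^sup>2"
    by (simp only: c power_mult power_mult_distrib)
  also have "\<dots> = c ^ m\<^sup>2 * (c\<^sup>2) ^ m * c"
    by (simp only: sq power_add power_mult power_one_right)
  finally have "(d * h\<^sup>2) ^ (2 * (Suc m)\<^sup>2) * ((q / d)\<^sup>2) ^ (Suc m)\<^sup>2 * e ^ m\<^sup>2 * f ^ (2 * m * Suc m) =
    c ^ m\<^sup>2 * (c\<^sup>2) ^ m * c * e ^ m\<^sup>2 * ((f\<^sup>2) ^ m\<^sup>2 * (f\<^sup>2) ^ m)"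
    by (simp only: sq(2) power_add power_mult)
  also have "\<dots> = a ^ m\<^sup>2 * b ^ m * c"
    unfolding a b power_mult_distrib by (simp only: mult_ac)
  finally show ?thesis
    unfolding new diamond_sum_Suc[OF pos d e f] by (simp only:)
qed

text \<open>In a chain of steps that ends at order \<open>m\<close>, an earlier step acts at order
  \<open>m + j\<close>; its factor is rewritten in terms of \<open>m\<close>.\<close>

lemma quadratic_power_shift:
  "a ^ (m + j)\<^sup>2 * b ^ (m + j) * c = a ^ m\<^sup>2 * (a ^ (2 * j) * b) ^ m * (a ^ j\<^sup>2 * b ^ j * c)" for a b c :: real
proof -
  have "(m + j)\<^sup>2 = m\<^sup>2 + 2 * j * m + j\<^sup>2" by (simp add: power2_eq_square algebra_simps)
  then show ?thesis by (simp add: power_add power_mult_distrib power_mult[symmetric] mult_ac)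
qed

text \<open>This and the next five lemmas follow the orbit of the initial parameters. The numbers
  supplied for \<open>d\<close>, \<open>e\<close>, \<open>f\<close> are the face determinants of the
  step.\<close>

lemma diamond_sum_step0:
  "diamond_sum (Suc m) 1 (1 / 2) 1 (1 / 2) 1 =
    (2197 / 2916) ^ m\<^sup>2 * (169 / 81) ^ m * 1 * diamond_sum m (6 / 13) (18 / 13) (9 / 13) (12 / 13) (3 / 2)"
  by (rule diamond_sum_Suc_collect[where d = "(3 / 2)" and e = "(13 / 36)" and f = "(13 / 9)"]) (simp_all add: power2_eq_square)

lemma diamond_sum_step1:
  "diamond_sum (Suc m) (6 / 13) (18 / 13) (9 / 13) (12 / 13) (3 / 2) =
    (2970344 / 140625) ^ m\<^sup>2 * (531441 / 422500) ^ m * (59049 / 114244) * diamond_sum m (45 / 338) (225 / 676) (225 / 338) (45 / 676) (180 / 169)"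
  by (rule diamond_sum_Suc_collect[where d = "(270 / 169)" and e = "(17576 / 2025)" and f = "(4394 / 2025)"]) (simp_all add: power2_eq_square)

lemma diamond_sum_step2:
  "diamond_sum (Suc m) (45 / 338) (225 / 676) (225 / 338) (45 / 676) (180 / 169) =
    (128 / 25) ^ m\<^sup>2 * (672605015625000000 / 665416609183179841) ^ m * (5189853515625 / 23298085122481) * diamond_sum m (225 / 676) (225 / 338) (225 / 676) (225 / 338) (225 / 2704)"
  by (rule diamond_sum_Suc_collect[where d = "(10125 / 114244)" and e = "(57122 / 50625)" and f = "(228488 / 50625)"]) (simp_all add: power2_eq_square)

text \<open>The orbit is now at \<open>(15 / 26)\<^sup>2\<close> times 1, 2, 1, 2, 1/4. From here on
  the bases of the quadratic exponents repeat, but a multiple of the initial parameters is reached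
  only after three further steps.\<close>

lemma diamond_sum_step3:
  "diamond_sum (Suc m) (225 / 676) (225 / 338) (225 / 676) (225 / 338) (225 / 2704) =
    (2197 / 2916) ^ m\<^sup>2 * (81091461181640625 / 66058214096176282599424) ^ m * (129746337890625 / 1526863306586914816) * diamond_sum m (675 / 4394) (2025 / 17576) (2025 / 8788) (675 / 8788) (675 / 338)"
  by (rule diamond_sum_Suc_collect[where d = "(151875 / 913952)" and e = "(23762752 / 455625)" and f = "(5940688 / 455625)"]) (simp_all add: power2_eq_square)

lemma diamond_sum_step4:
  "diamond_sum (Suc m) (675 / 4394) (2025 / 17576) (2025 / 8788) (675 / 8788) (675 / 338) =
    (2970344 / 140625) ^ m\<^sup>2 * (5585154407949462890625 / 115154336718804370564096) ^ m * (7661391506103515625 / 681386607803576157184) * diamond_sum m (10125 / 228488) (50625 / 114244) (50625 / 228488) (10125 / 114244) (10125 / 114244)"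
  by (rule diamond_sum_Suc_collect[where d = "(6834375 / 38614472)" and e = "(501988136 / 102515625)" and f = "(2007952544 / 102515625)"]) (simp_all add: power2_eq_square)

lemma diamond_sum_step5:
  "diamond_sum (Suc m) (10125 / 228488) (50625 / 114244) (50625 / 228488) (10125 / 114244) (10125 / 114244) =
    (128 / 25) ^ m\<^sup>2 * (69030381323838271200656890869140625 / 116071927323516128016285877442651168702464) ^ m * (673364487841129302978515625 / 35572991287254745924999273578496) * diamond_sum m (50625 / 456976) (50625 / 913952) (50625 / 456976) (50625 / 913952) (50625 / 456976)"
  by (rule diamond_sum_Suc_collect[where d = "(512578125 / 52206766144)" and e = "(417654129152 / 2562890625)" and f = "(104413532288 / 2562890625)"]) (simp_all add: power2_eq_square)

text \<open>The power of two collects the determinants \<open>1 * 1 + 1 * 1\<close> of the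
  \<open>n\<^sup>2\<close> midpoint cells.\<close>

definition tilings_formula :: "nat \<Rightarrow> real" where
  "tilings_formula n = 2 ^ n\<^sup>2 * diamond_sum n 1 (1 / 2) 1 (1 / 2) 1"

lemma tilings_formula_small:
  "tilings_formula 0 = 1" "tilings_formula 1 = 2" "tilings_formula 2 = 13" "tilings_formula 3 = 13 ^ 3"
  "tilings_formula 4 = 2 * 13 ^ 5" "tilings_formula 5 = 13 ^ 8"
  unfolding tilings_formula_def
  by (simp_all add: eval_nat_numeral(2,3) diamond_sum_step0 diamond_sum_step1 diamond_sum_step2 diamond_sum_step3 diamond_sum_step4)

text \<open>The scaling factor \<open>50625 / 456976\<close> is \<open>(15/26)^4\<close>.\<close>

lemma tilings_formula_add_6: "tilings_formula (m + 6) = 13 ^ (4 * m + 12) * tilings_formula m"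
proof -
  let ?l = "50625 / 456976 :: real"
  have scale: "diamond_sum m (50625 / 456976) (50625 / 913952) (50625 / 456976) (50625 / 913952) (50625 / 456976) = ?l ^ (4 * m\<^sup>2 + 2 * m) * diamond_sum m 1 (1 / 2) 1 (1 / 2) 1"
    using diamond_sum_scale[of ?l 1 "1 / 2" 1 "1 / 2" 1 m] by simp
  \<comment> \<open>Names keep the rational constants opaque to the simplifier until the powers with
    exponent \<open>m\<close> have been collected.\<close>
  define a0 b0 c0 :: real where "a0 = (2197 / 2916)" and "b0 = (169 / 81)" and "c0 = 1"
  define a1 b1 c1 :: real where "a1 = (2970344 / 140625)" and "b1 = (531441 / 422500)" and "c1 = (59049 / 114244)"
  define a2 b2 c2 :: real where "a2 = (128 / 25)" and "b2 = (672605015625000000 / 665416609183179841)" and "c2 = (5189853515625 / 23298085122481)"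
  define a3 b3 c3 :: real where "a3 = (2197 / 2916)" and "b3 = (81091461181640625 / 66058214096176282599424)" and "c3 = (129746337890625 / 1526863306586914816)"
  define a4 b4 c4 :: real where "a4 = (2970344 / 140625)" and "b4 = (5585154407949462890625 / 115154336718804370564096)" and "c4 = (7661391506103515625 / 681386607803576157184)"
  define a5 b5 c5 :: real where "a5 = (128 / 25)" and "b5 = (69030381323838271200656890869140625 / 116071927323516128016285877442651168702464)" and "c5 = (673364487841129302978515625 / 35572991287254745924999273578496)"
  \<comment> \<open>Step \<open>i\<close> acts at order \<open>m + (5 - i)\<close>, so its linear
    and constant parts absorb a share of its quadratic part.\<close>
  define B0 C0 where "B0 = a0 ^ (2 * 5) * b0" and "C0 = a0 ^ 5\<^sup>2 * b0 ^ 5 * c0"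
  define B1 C1 where "B1 = a1 ^ (2 * 4) * b1" and "C1 = a1 ^ 4\<^sup>2 * b1 ^ 4 * c1"
  define B2 C2 where "B2 = a2 ^ (2 * 3) * b2" and "C2 = a2 ^ 3\<^sup>2 * b2 ^ 3 * c2"
  define B3 C3 where "B3 = a3 ^ (2 * 2) * b3" and "C3 = a3 ^ 2\<^sup>2 * b3 ^ 2 * c3"
  define B4 C4 where "B4 = a4 ^ (2 * 1) * b4" and "C4 = a4 ^ 1\<^sup>2 * b4 ^ 1 * c4"
  define B5 C5 where "B5 = a5 ^ (2 * 0) * b5" and "C5 = a5 ^ 0\<^sup>2 * b5 ^ 0 * c5"
  have suc: "Suc (m + 5) = m + 6" "Suc (m + 4) = m + 5" "Suc (m + 3) = m + 4" "Suc (m + 2) = m + 3"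
    "Suc (m + 1) = m + 2" "Suc (m + 0) = m + 1" by simp_all
  have "diamond_sum (m + 6) 1 (1 / 2) 1 (1 / 2) 1 = a0 ^ (m + 5)\<^sup>2 * b0 ^ (m + 5) * c0 * diamond_sum (m + 5) (6 / 13) (18 / 13) (9 / 13) (12 / 13) (3 / 2)"
    unfolding a0_def b0_def c0_def using diamond_sum_step0[of "m + 5"] by (simp only: suc)
  then have s0: "diamond_sum (m + 6) 1 (1 / 2) 1 (1 / 2) 1 = a0 ^ m\<^sup>2 * B0 ^ m * C0 * diamond_sum (m + 5) (6 / 13) (18 / 13) (9 / 13) (12 / 13) (3 / 2)"
    unfolding quadratic_power_shift B0_def C0_def .
  have "diamond_sum (m + 5) (6 / 13) (18 / 13) (9 / 13) (12 / 13) (3 / 2) = a1 ^ (m + 4)\<^sup>2 * b1 ^ (m + 4) * c1 * diamond_sum (m + 4) (45 / 338) (225 / 676) (225 / 338) (45 / 676) (180 / 169)"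
    unfolding a1_def b1_def c1_def using diamond_sum_step1[of "m + 4"] by (simp only: suc)
  then have s1: "diamond_sum (m + 5) (6 / 13) (18 / 13) (9 / 13) (12 / 13) (3 / 2) = a1 ^ m\<^sup>2 * B1 ^ m * C1 * diamond_sum (m + 4) (45 / 338) (225 / 676) (225 / 338) (45 / 676) (180 / 169)"
    unfolding quadratic_power_shift B1_def C1_def .
  have "diamond_sum (m + 4) (45 / 338) (225 / 676) (225 / 338) (45 / 676) (180 / 169) = a2 ^ (m + 3)\<^sup>2 * b2 ^ (m + 3) * c2 * diamond_sum (m + 3) (225 / 676) (225 / 338) (225 / 676) (225 / 338) (225 / 2704)"
    unfolding a2_def b2_def c2_def using diamond_sum_step2[of "m + 3"] by (simp only: suc)
  then have s2: "diamond_sum (m + 4) (45 / 338) (225 / 676) (225 / 338) (45 / 676) (180 / 169) = a2 ^ m\<^sup>2 * B2 ^ m * C2 * diamond_sum (m + 3) (225 / 676) (225 / 338) (225 / 676) (225 / 338) (225 / 2704)"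
    unfolding quadratic_power_shift B2_def C2_def .
  have "diamond_sum (m + 3) (225 / 676) (225 / 338) (225 / 676) (225 / 338) (225 / 2704) = a3 ^ (m + 2)\<^sup>2 * b3 ^ (m + 2) * c3 * diamond_sum (m + 2) (675 / 4394) (2025 / 17576) (2025 / 8788) (675 / 8788) (675 / 338)"
    unfolding a3_def b3_def c3_def using diamond_sum_step3[of "m + 2"] by (simp only: suc)
  then have s3: "diamond_sum (m + 3) (225 / 676) (225 / 338) (225 / 676) (225 / 338) (225 / 2704) = a3 ^ m\<^sup>2 * B3 ^ m * C3 * diamond_sum (m + 2) (675 / 4394) (2025 / 17576) (2025 / 8788) (675 / 8788) (675 / 338)"
    unfolding quadratic_power_shift B3_def C3_def .
  have "diamond_sum (m + 2) (675 / 4394) (2025 / 17576) (2025 / 8788) (675 / 8788) (675 / 338) = a4 ^ (m + 1)\<^sup>2 * b4 ^ (m + 1) * c4 * diamond_sum (m + 1) (10125 / 228488) (50625 / 114244) (50625 / 228488) (10125 / 114244) (10125 / 114244)"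
    unfolding a4_def b4_def c4_def using diamond_sum_step4[of "m + 1"] by (simp only: suc)
  then have s4: "diamond_sum (m + 2) (675 / 4394) (2025 / 17576) (2025 / 8788) (675 / 8788) (675 / 338) = a4 ^ m\<^sup>2 * B4 ^ m * C4 * diamond_sum (m + 1) (10125 / 228488) (50625 / 114244) (50625 / 228488) (10125 / 114244) (10125 / 114244)"
    unfolding quadratic_power_shift B4_def C4_def .
  have "diamond_sum (m + 1) (10125 / 228488) (50625 / 114244) (50625 / 228488) (10125 / 114244) (10125 / 114244) = a5 ^ (m + 0)\<^sup>2 * b5 ^ (m + 0) * c5 * diamond_sum (m + 0) (50625 / 456976) (50625 / 913952) (50625 / 456976) (50625 / 913952) (50625 / 456976)"
    unfolding a5_def b5_def c5_def using diamond_sum_step5[of "m + 0"] by (simp only: suc)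
  then have s5: "diamond_sum (m + 1) (10125 / 228488) (50625 / 114244) (50625 / 228488) (10125 / 114244) (10125 / 114244) = a5 ^ m\<^sup>2 * B5 ^ m * C5 * diamond_sum (m + 0) (50625 / 456976) (50625 / 913952) (50625 / 456976) (50625 / 913952) (50625 / 456976)"
    unfolding quadratic_power_shift B5_def C5_def .
  \<comment> \<open>The six bases multiply to \<open>(26 / 15) ^ 16\<close>, exactly the inverse of
    \<open>?l ^ 4\<close>. Hence no quadratic exponent survives, and the next two equations give the
    linear and the constant part of the exponent of 13.\<close>
  have A: "a0 * a1 * a2 * a3 * a4 * a5 * ?l ^ 4 = 1"
    by (simp add: a0_def a1_def a2_def a3_def a4_def a5_def power_divide)
  have B: "2 ^ 12 * (B0 * B1 * B2 * B3 * B4 * B5) * ?l\<^sup>2 = 13 ^ 4"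
    by (simp add: B0_def B1_def B2_def B3_def B4_def B5_def a0_def a1_def a2_def a3_def a4_def a5_def b0_def b1_def b2_def b3_def b4_def b5_def power_divide)
  have C: "2 ^ 36 * (C0 * C1 * C2 * C3 * C4 * C5) = 13 ^ 12"
    by (simp add: C0_def C1_def C2_def C3_def C4_def C5_def a0_def a1_def a2_def a3_def a4_def a5_def b0_def b1_def b2_def b3_def b4_def b5_def c0_def c1_def c2_def c3_def c4_def c5_def power_divide)
  have two: "(2::real) ^ (m + 6)\<^sup>2 = 2 ^ m\<^sup>2 * (2 ^ 12) ^ m * 2 ^ 36"
    using quadratic_power_shift[of 2 m 6 1 1] by simp
  have l: "?l ^ (4 * m\<^sup>2 + 2 * m) = (?l ^ 4) ^ m\<^sup>2 * (?l\<^sup>2) ^ m"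
    by (simp only: power_add power_mult)
  have "tilings_formula (m + 6) = (a0 * a1 * a2 * a3 * a4 * a5 * ?l ^ 4) ^ m\<^sup>2 * (2 ^ 12 * (B0 * B1 * B2 * B3 * B4 * B5) * ?l\<^sup>2) ^ m * (2 ^ 36 * (C0 * C1 * C2 * C3 * C4 * C5)) * tilings_formula m"
    unfolding tilings_formula_def s0 s1 s2 s3 s4 s5 add_0_right scale two l power_mult_distrib by (simp only: mult_ac)
  also have "\<dots> = 13 ^ (4 * m + 12) * tilings_formula m"
    unfolding A B C by (simp add: power_add power_mult)
  finally show ?thesis .
qed

section \<open>The adjacency graph of a dungeon\<close>

text \<open>The rectangle \<open>(i, j)\<close> is the block of the positions \<open>(x, y)\<close> with \<open>x div 2 = i\<close> and \<open>y div 2 = j\<close>, one at each of its corners \<open>((x + 1) div 2, (y + 1) div 2)\<close>. The vertex \<open>(x, y, False)\<close> is the region touching the vertical side of the rectangle at that corner; \<open>(x, y, True)\<close> is adjacent to it across the diagonal of the rectangle, and exists only if the corner is a point of the triangular lattice.\<close>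

type_synonym vert = "int \<times> int \<times> bool"

definition is_edge :: "('a \<Rightarrow> 'a \<Rightarrow> bool) \<Rightarrow> 'a set \<Rightarrow> bool" where
  "is_edge R e \<longleftrightarrow> (\<exists>a b. e = {a, b} \<and> R a b)"

lemma is_edge_pair [simp]: "is_edge R {u, v} \<longleftrightarrow> R u v \<or> R v u"
  by (auto simp: is_edge_def doubleton_eq_iff)

text \<open>Positions on a line are paired in two ways: \<open>flip\<close> pairs those in the same
  rectangle, \<open>across\<close> those at the same corner. Together they generate all steps by
  one.\<close>

definition flip :: "int \<Rightarrow> int" where "flip x = (if even x then x + 1 else x - 1)"
definition across :: "int \<Rightarrow> int" where "across x = (if odd x then x + 1 else x - 1)"

lemma flip_simps [simp]: "flip x \<noteq> x" "x \<noteq> flip x" "flip (flip x) = x" "flip x div 2 = x div 2"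
    "even (flip x) \<longleftrightarrow> odd x" "flip (2 * i) = 2 * i + 1" "flip (2 * i + 1) = 2 * i"
  and across_simps [simp]: "across x \<noteq> x" "x \<noteq> across x" "across (across x) = x"
    "(across x + 1) div 2 = (x + 1) div 2" "even (across x) \<longleftrightarrow> odd x"
    "across (2 * i) = 2 * i - 1" "across (2 * i - 1) = 2 * i"
  by (auto simp: flip_def across_def elim!: oddE)

text \<open>The corner of the position \<open>(x, y)\<close> is the midpoint of a horizontal edge.\<close>

definition is_mid :: "nat \<Rightarrow> int \<Rightarrow> int \<Rightarrow> bool" where
  "is_mid n x y \<longleftrightarrow> odd ((x + 1) div 2 + (y + 1) div 2 + int n)"

text \<open>The relation is oriented from the \<open>True\<close> region to its three neighbours,
  which sit at its own corner, at the corner beside it and at the opposite corner of the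
  rectangle.\<close>

fun hex_adj :: "vert \<Rightarrow> vert \<Rightarrow> bool" where
  "hex_adj (x, y, b) (x', y', b') \<longleftrightarrow> b \<and> \<not> b' \<and> (x' = x \<or> x' = flip x) \<and> (y' = y \<or> x' = flip x \<and> y' = flip y)"

fun mid_adj :: "nat \<Rightarrow> vert \<Rightarrow> vert \<Rightarrow> bool" where
  "mid_adj n (x, y, b) (x', y', b') \<longleftrightarrow> \<not> b \<and> \<not> b' \<and> is_mid n x y \<and>
     (x' = across x \<and> y' = y \<or> x' = x \<and> y' = across y)"

text \<open>At a lattice point these regions meet along a vertical altitude only: the regions along
  the horizontal line there are attached to midpoints. The missing vertical bond becomes the weight
  0 of the grid.\<close>

fun bond_adj :: "nat \<Rightarrow> vert \<Rightarrow> vert \<Rightarrow> bool" where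
  "bond_adj n (x, y, b) (x', y', b') \<longleftrightarrow> \<not> b \<and> \<not> b' \<and> \<not> is_mid n x y \<and> x' = across x \<and> y' = y"

text \<open>This is no adjacency of regions; it describes the edges that replace
  \<open>hex_adj\<close> after renewal.\<close>

fun square_adj :: "vert \<Rightarrow> vert \<Rightarrow> bool" where
  "square_adj (x, y, b) (x', y', b') \<longleftrightarrow> (if b then b' \<and> x' = flip x \<and> y' = flip y
     else \<not> b' \<and> (x' = flip x \<and> y' = y \<or> x' = x \<and> y' = flip y))"

definition dungeon_verts :: "nat \<Rightarrow> vert set" where
  "dungeon_verts n = {(x, y, b). \<bar>2 * (x div 2) + 1\<bar> + \<bar>2 * (y div 2) + 1\<bar> \<le> 2 * int n \<and> (b \<longrightarrow> \<not> is_mid n x y)}"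

definition dungeon_weight :: "nat \<Rightarrow> vert set \<Rightarrow> real" where
  "dungeon_weight n e = of_bool (is_edge (\<lambda>a b. hex_adj a b \<or> mid_adj n a b \<or> bond_adj n a b) e)"

fun block_of :: "vert \<Rightarrow> int \<times> int" where "block_of (x, y, b) = (2 * (x div 2) + 1, 2 * (y div 2) + 1)"
fun corner_of :: "vert \<Rightarrow> int \<times> int" where "corner_of (x, y, b) = (2 * ((x + 1) div 2), 2 * ((y + 1) div 2))"

definition blocks :: "nat \<Rightarrow> (int \<times> int) set" where
  "blocks n = {(x, y). odd x \<and> odd y \<and> \<bar>x\<bar> + \<bar>y\<bar> \<le> 2 * int n}"

definition mids :: "nat \<Rightarrow> (int \<times> int) set" where
  "mids n = (\<lambda>(i, j). (2 * i, 2 * j)) ` faces n"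

text \<open>Before the move a rectangle is the 4-cycle \<open>r, a, s, b\<close> with pendants
  \<open>p\<close> at \<open>r\<close> and \<open>q\<close> at \<open>s\<close>; afterwards it is
  the 4-cycle \<open>p, a, q, b\<close> and the edge \<open>{r, s}\<close>. Since \<open>r\<close>
  and \<open>s\<close> lie in no other cell they always belong to \<open>X\<close>, and the sixteen
  remaining subsets are compared one by one. No factor arises.\<close>

lemma block_flip:
  assumes dist: "distinct [p, q, a, b, r, s]" and X: "X \<subseteq> {p, q, a, b, r, s}" "r \<in> X" "s \<in> X"
    and w: "\<And>e. w e = of_bool (e \<in> {{r, a}, {r, b}, {r, p}, {s, b}, {s, a}, {s, q}})"
    and w': "\<And>e. w' e = of_bool (e \<in> {{p, a}, {a, q}, {q, b}, {b, p}, {r, s}})"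
  shows "pmsum X w = pmsum (X - {p, q} \<union> ({p, q} - X)) w'"
proof -
  have ne: "p \<noteq> q" "q \<noteq> p" "p \<noteq> a" "a \<noteq> p" "p \<noteq> b" "b \<noteq> p" "p \<noteq> r" "r \<noteq> p" "p \<noteq> s" "s \<noteq> p"
    "q \<noteq> a" "a \<noteq> q" "q \<noteq> b" "b \<noteq> q" "q \<noteq> r" "r \<noteq> q" "q \<noteq> s" "s \<noteq> q"
    "a \<noteq> b" "b \<noteq> a" "a \<noteq> r" "r \<noteq> a" "a \<noteq> s" "s \<noteq> a" "b \<noteq> r" "r \<noteq> b" "b \<noteq> s" "s \<noteq> b" "r \<noteq> s" "s \<noteq> r"
    using dist by auto
  have graph: "card e = 2" if "w e \<noteq> 0" for e
    using that unfolding w of_bool_eq_0_iff not_not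
    by (elim insertE emptyE) (simp_all add: ne)
  have graph': "card e = 2" if "w' e \<noteq> 0" for e
    using that unfolding w' of_bool_eq_0_iff not_not
    by (elim insertE emptyE) (simp_all add: ne)
  define Y where "Y = X - {r, s}"
  have XY: "X = insert r (insert s Y)" using X by (auto simp: Y_def)
  note small = pmsum_graph_small[of w, OF graph] pmsum_graph_small[of w', OF graph']
  have wt:
    "w {p, q} = 0" "w {p, a} = 0" "w {p, b} = 0" "w {p, r} = 1" "w {p, s} = 0" "w {q, p} = 0"
    "w {q, a} = 0" "w {q, b} = 0" "w {q, r} = 0" "w {q, s} = 1" "w {a, p} = 0" "w {a, q} = 0"
    "w {a, b} = 0" "w {a, r} = 1" "w {a, s} = 1" "w {b, p} = 0" "w {b, q} = 0" "w {b, a} = 0"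
    "w {b, r} = 1" "w {b, s} = 1" "w {r, p} = 1" "w {r, q} = 0" "w {r, a} = 1" "w {r, b} = 1"
    "w {r, s} = 0" "w {s, p} = 0" "w {s, q} = 1" "w {s, a} = 1" "w {s, b} = 1" "w {s, r} = 0"
    unfolding w using ne by (simp_all add: doubleton_eq_iff)
  have wt':
    "w' {p, q} = 0" "w' {p, a} = 1" "w' {p, b} = 1" "w' {p, r} = 0" "w' {p, s} = 0" "w' {q, p} = 0"
    "w' {q, a} = 1" "w' {q, b} = 1" "w' {q, r} = 0" "w' {q, s} = 0" "w' {a, p} = 1" "w' {a, q} = 1"
    "w' {a, b} = 0" "w' {a, r} = 0" "w' {a, s} = 0" "w' {b, p} = 1" "w' {b, q} = 1" "w' {b, a} = 0"
    "w' {b, r} = 0" "w' {b, s} = 0" "w' {r, p} = 0" "w' {r, q} = 0" "w' {r, a} = 0" "w' {r, b} = 0"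
    "w' {r, s} = 1" "w' {s, p} = 0" "w' {s, q} = 0" "w' {s, a} = 0" "w' {s, b} = 0" "w' {s, r} = 1"
    unfolding w' using ne by (simp_all add: doubleton_eq_iff)
  have "Y \<in> Pow {p, q, a, b}" using X by (auto simp: Y_def)
  then show ?thesis
    unfolding XY Pow_insert Pow_empty image_insert image_empty Un_insert_left Un_empty_left image_Un
    by (elim UnE insertE emptyE) (simp_all add: ne insert_Diff_if small wt wt')
qed


text \<open>An edge may satisfy \<open>R\<close> in both orientations, so the cell assigned to it
  must not depend on which endpoint comes first.\<close>

lemma sum_is_edge:
  assumes "finite A" and "\<And>a b. e = {a, b} \<Longrightarrow> R a b \<Longrightarrow> f a \<in> A"
    and "\<And>a b. R a b \<Longrightarrow> R b a \<Longrightarrow> f a = f b"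
  shows "(\<Sum>c\<in>A. of_bool (is_edge (\<lambda>a b. R a b \<and> f a = c) e)) = (of_bool (is_edge R e) :: real)"
proof (cases "is_edge R e")
  case True
  then obtain a b where e: "e = {a, b}" and ab: "R a b" by (auto simp: is_edge_def)
  then have "is_edge (\<lambda>a b. R a b \<and> f a = c) e \<longleftrightarrow> c = f a" for c
    using assms(3)[of a b] by auto
  then have "(\<Sum>c\<in>A. of_bool (is_edge (\<lambda>a b. R a b \<and> f a = c) e)) = (\<Sum>c\<in>A. if c = f a then 1 else 0 :: real)"
    by (intro sum.cong) auto
  also have "\<dots> = 1"
    using assms(1) assms(2)[OF e ab] by simp
  finally show ?thesis using True by simp
next
  case False
  then have "\<not> is_edge (\<lambda>a b. R a b \<and> f a = c) e" for c
    by (auto simp: is_edge_def)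
  with False show ?thesis by simp
qed

text \<open>Rectangles have two odd and midpoints two even coordinates; \<open>(0, 1)\<close> stands for a further cell that collects the remaining edges, at which nothing is renewed.\<close>

definition cells :: "nat \<Rightarrow> (int \<times> int) set" where
  "cells n = insert (0, 1) (blocks n \<union> mids n)"

definition cell_weight :: "nat \<Rightarrow> int \<times> int \<Rightarrow> vert set \<Rightarrow> real" where
  "cell_weight n c e = (if c = (0, 1) then of_bool (is_edge (bond_adj n) e)
     else if odd (fst c) then of_bool (is_edge (\<lambda>a b. hex_adj a b \<and> block_of a = c) e)
     else of_bool (is_edge (\<lambda>a b. mid_adj n a b \<and> corner_of a = c) e))"

text \<open>The division by 2 is renewal of a 4-cycle with unit weights, whose determinant is
  2.\<close>

definition cell_weight' :: "nat \<Rightarrow> int \<times> int \<Rightarrow> vert set \<Rightarrow> real" where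
  "cell_weight' n c e = (if c = (0, 1) then of_bool (is_edge (bond_adj n) e)
     else if odd (fst c) then of_bool (is_edge (\<lambda>a b. square_adj a b \<and> block_of a = c) e)
     else of_bool (is_edge (\<lambda>a b. mid_adj n a b \<and> corner_of a = c) e) / 2)"

definition dungeon_weight' :: "nat \<Rightarrow> vert set \<Rightarrow> real" where
  "dungeon_weight' n e = of_bool (is_edge square_adj e) + of_bool (is_edge (mid_adj n) e) / 2 +
     of_bool (is_edge (bond_adj n) e)"

text \<open>A midpoint outside \<open>faces n\<close> is not a cell. Its regions in the dungeon lie
  in their rectangle only, so they are deleted by the move.\<close>

definition dungeon_verts' :: "nat \<Rightarrow> vert set" where
  "dungeon_verts' n = {(x, y, b) \<in> dungeon_verts n.
     \<not> b \<longrightarrow> is_mid n x y \<longrightarrow> ((x + 1) div 2, (y + 1) div 2) \<in> faces n}"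

section \<open>Distribution of the edges over the cells\<close>

lemma finite_blocks: "finite (blocks n)"
  by (rule finite_subset[of _ "{- 2 * int n..2 * int n} \<times> {- 2 * int n..2 * int n}"]) (auto simp: blocks_def)

lemma finite_mids: "finite (mids n)"
  by (simp add: mids_def finite_faces)

lemma finite_cells: "finite (cells n)"
  by (simp add: cells_def finite_blocks finite_mids)

lemma parity_blocks: "c \<in> blocks n \<Longrightarrow> odd (fst c) \<and> odd (snd c)"
  and parity_mids: "c \<in> mids n \<Longrightarrow> even (fst c) \<and> even (snd c)"
  by (auto simp: blocks_def mids_def)

lemma sum_cells:
  "(\<Sum>c\<in>cells n. f c) = f (0, 1) + (\<Sum>c\<in>blocks n. f c) + (\<Sum>c\<in>mids n. f c)" for f :: "_ \<Rightarrow> real"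
proof -
  have "(0, 1) \<notin> blocks n \<union> mids n" "blocks n \<inter> mids n = {}"
    using parity_blocks parity_mids by fastforce+
  then show ?thesis
    by (simp add: cells_def finite_blocks finite_mids sum.union_disjoint)
qed

lemma mid_in_mids_iff: "(2 * i, 2 * j) \<in> mids n \<longleftrightarrow> (i, j) \<in> faces n"
  by (auto simp: mids_def)

lemma block_of_in_blocks: "v \<in> dungeon_verts n \<Longrightarrow> block_of v \<in> blocks n"
  by (cases v) (auto simp: dungeon_verts_def blocks_def)

lemma is_mid_across: "is_mid n (across x) y = is_mid n x y" "is_mid n x (across y) = is_mid n x y"
  by (simp_all add: is_mid_def)

text \<open>The two positions lie in rectangles on both sides of the corner. The outer of the two
  bounds the corner coordinate in that direction, and parity turns the resulting weak bound into the
  strict one.\<close>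

lemma corner_in_faces:
  assumes "(x, y, b) \<in> dungeon_verts n" "(x', y', b') \<in> dungeon_verts n" "mid_adj n (x, y, b) (x', y', b')"
  shows "((x + 1) div 2, (y + 1) div 2) \<in> faces n"
proof -
  define i j where "i = (x + 1) div 2" and "j = (y + 1) div 2"
  have x: "x = 2 * i \<or> x = 2 * i - 1" and y: "y = 2 * j \<or> y = 2 * j - 1"
    unfolding i_def j_def by presburger+
  have m: "odd (i + j + int n)" using assms(3) by (simp add: is_mid_def i_def j_def)
  have a: "(2 * k - 1) div 2 = k - 1" for k :: int by presburger
  have dx: "x div 2 = i \<and> across x div 2 = i - 1 \<or> x div 2 = i - 1 \<and> across x div 2 = i"
    using x a[of i] by (elim disjE) simp_all
  have dy: "y div 2 = j \<and> across y div 2 = j - 1 \<or> y div 2 = j - 1 \<and> across y div 2 = j"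
    using y a[of j] by (elim disjE) simp_all
  have adj: "x' = across x \<and> y' = y \<or> x' = x \<and> y' = across y"
    using assms(3) by simp
  have h: "\<bar>2 * (x div 2) + 1\<bar> + \<bar>2 * (y div 2) + 1\<bar> \<le> 2 * int n"
    "\<bar>2 * (x' div 2) + 1\<bar> + \<bar>2 * (y' div 2) + 1\<bar> \<le> 2 * int n"
    using assms(1,2) by (simp_all add: dungeon_verts_def)
  have key: "\<bar>k\<bar> + \<bar>l\<bar> \<le> N"
    if "\<bar>2 * k + 1\<bar> + \<bar>2 * s + 1\<bar> \<le> 2 * N" "\<bar>2 * (k - 1) + 1\<bar> + \<bar>2 * s + 1\<bar> \<le> 2 * N" "s = l \<or> s = l - 1"
    for k l s N :: int
  proof -
    have s: "2 * \<bar>l\<bar> \<le> \<bar>2 * s + 1\<bar> + 1"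
      using that(3) by (auto simp: abs_if)
    have "2 * \<bar>k\<bar> + 1 = \<bar>2 * k + 1\<bar> \<or> 2 * \<bar>k\<bar> + 1 = \<bar>2 * (k - 1) + 1\<bar>"
      by (auto simp: abs_if)
    with that(1,2) s show ?thesis by (elim disjE) linarith+
  qed
  have "\<bar>i\<bar> + \<bar>j\<bar> \<le> int n"
    using adj
  proof (elim disjE conjE)
    assume e: "x' = across x" "y' = y"
    show ?thesis
      using dx
    proof (elim disjE conjE)
      assume d: "x div 2 = i" "across x div 2 = i - 1"
      show ?thesis using h[unfolded e d] dy by (intro key[of i "y div 2"]) blast+
    next
      assume d: "x div 2 = i - 1" "across x div 2 = i"
      show ?thesis using h[unfolded e d] dy by (intro key[of i "y div 2"]) blast+
    qed
  next
    assume e: "x' = x" "y' = across y"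
    have h': "\<bar>2 * (y div 2) + 1\<bar> + \<bar>2 * (x div 2) + 1\<bar> \<le> 2 * int n"
      "\<bar>2 * (across y div 2) + 1\<bar> + \<bar>2 * (x div 2) + 1\<bar> \<le> 2 * int n"
      using h[unfolded e] by (simp_all only: add.commute)
    have "\<bar>j\<bar> + \<bar>i\<bar> \<le> int n"
      using dy
    proof (elim disjE conjE)
      assume d: "y div 2 = j" "across y div 2 = j - 1"
      show ?thesis using h'[unfolded d] dx by (intro key[of j "x div 2"]) blast+
    next
      assume d: "y div 2 = j - 1" "across y div 2 = j"
      show ?thesis using h'[unfolded d] dx by (intro key[of j "x div 2"]) blast+
    qed
    then show ?thesis by simp
  qed
  with m show ?thesis
    unfolding i_def[symmetric] j_def[symmetric] in_faces_iff by simp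
qed

lemma block_of_hex_adj: "hex_adj a b \<Longrightarrow> block_of a = block_of b"
  by (cases a; cases b) auto

lemma block_of_square_adj: "square_adj a b \<Longrightarrow> block_of a = block_of b"
  by (cases a; cases b; cases "snd (snd a)") auto

lemma corner_of_mid_adj: "mid_adj n a b \<Longrightarrow> corner_of a = corner_of b"
  by (cases a; cases b) auto

lemma adj_exclusive:
  "hex_adj a b \<Longrightarrow> \<not> mid_adj n a b \<and> \<not> mid_adj n b a \<and> \<not> bond_adj n a b \<and> \<not> bond_adj n b a"
  "mid_adj n a b \<Longrightarrow> \<not> bond_adj n a b \<and> \<not> bond_adj n b a"
  by (cases a; cases b; auto simp: is_mid_across)+

text \<open>The three kinds of adjacency exclude each other, so the indicator of their union is the
  sum of their indicators, and each kind is split further by rectangle or midpoint.\<close>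

lemma dungeon_weight_eq_sum:
  assumes "e \<subseteq> dungeon_verts n"
  shows "dungeon_weight n e = (\<Sum>c\<in>cells n. cell_weight n c e)"
    and "dungeon_weight' n e = (\<Sum>c\<in>cells n. cell_weight' n c e)"
proof -
  have mid: "(\<Sum>c\<in>mids n. of_bool (is_edge (\<lambda>a b. mid_adj n a b \<and> corner_of a = c) e)) = (of_bool (is_edge (mid_adj n) e) :: real)"
  proof (rule sum_is_edge[OF finite_mids])
    fix a b assume e: "e = {a, b}" and ab: "mid_adj n a b"
    obtain x y s x' y' s' where v: "a = (x, y, s)" "b = (x', y', s')" by (metis prod.exhaust)
    show "corner_of a \<in> mids n"
      using corner_in_faces[of x y s n x' y' s'] assms e ab by (simp add: v mid_in_mids_iff)
  next
    show "corner_of a = corner_of b" if "mid_adj n a b" for a b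
      using that by (rule corner_of_mid_adj)
  qed
  have hex: "(\<Sum>c\<in>blocks n. of_bool (is_edge (\<lambda>a b. hex_adj a b \<and> block_of a = c) e)) = (of_bool (is_edge hex_adj e) :: real)"
    by (rule sum_is_edge[OF finite_blocks]) (use assms block_of_in_blocks block_of_hex_adj in blast)+
  have square: "(\<Sum>c\<in>blocks n. of_bool (is_edge (\<lambda>a b. square_adj a b \<and> block_of a = c) e)) = (of_bool (is_edge square_adj e) :: real)"
    by (rule sum_is_edge[OF finite_blocks]) (use assms block_of_in_blocks block_of_square_adj in blast)+
  have block: "cell_weight n c e = of_bool (is_edge (\<lambda>a b. hex_adj a b \<and> block_of a = c) e)"
    "cell_weight' n c e = of_bool (is_edge (\<lambda>a b. square_adj a b \<and> block_of a = c) e)" if "c \<in> blocks n" for c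
    using parity_blocks[OF that] by (auto simp: cell_weight_def cell_weight'_def)
  have midc: "cell_weight n c e = of_bool (is_edge (\<lambda>a b. mid_adj n a b \<and> corner_of a = c) e)"
    "cell_weight' n c e = of_bool (is_edge (\<lambda>a b. mid_adj n a b \<and> corner_of a = c) e) / 2" if "c \<in> mids n" for c
    using parity_mids[OF that] by (auto simp: cell_weight_def cell_weight'_def)
  have excl: "is_edge (\<lambda>a b. hex_adj a b \<or> mid_adj n a b \<or> bond_adj n a b) e \<longleftrightarrow>
      is_edge hex_adj e \<or> is_edge (mid_adj n) e \<or> is_edge (bond_adj n) e"
    unfolding is_edge_def by blast
  have "\<not> (is_edge hex_adj e \<and> is_edge (mid_adj n) e)" "\<not> (is_edge hex_adj e \<and> is_edge (bond_adj n) e)"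
    "\<not> (is_edge (mid_adj n) e \<and> is_edge (bond_adj n) e)"
    unfolding is_edge_def using adj_exclusive by (metis doubleton_eq_iff)+
  then show "dungeon_weight n e = (\<Sum>c\<in>cells n. cell_weight n c e)"
    unfolding sum_cells dungeon_weight_def excl
    by (simp add: block midc mid hex cong: sum.cong) (auto simp: cell_weight_def)
  show "dungeon_weight' n e = (\<Sum>c\<in>cells n. cell_weight' n c e)"
    unfolding sum_cells dungeon_weight'_def
    by (simp add: block midc mid square sum_divide_distrib[symmetric] cong: sum.cong) (simp add: cell_weight'_def)
qed

text \<open>The incidence function \<open>I\<close> for \<open>state_sum_flip\<close>. A
  \<open>True\<close> vertex has its rectangle only; a \<open>False\<close> vertex also has its
  midpoint, if that is a cell, or else, at a lattice point, the collecting cell.\<close>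

fun cells_at :: "nat \<Rightarrow> vert \<Rightarrow> (int \<times> int) set" where
  "cells_at n (x, y, b) = insert (2 * (x div 2) + 1, 2 * (y div 2) + 1)
     (if b then {} else if is_mid n x y then
        if ((x + 1) div 2, (y + 1) div 2) \<in> faces n then {(2 * ((x + 1) div 2), 2 * ((y + 1) div 2))} else {}
      else {(0, 1)})"

lemma flip_cases: "x' div 2 = x div 2 \<longleftrightarrow> x' = x \<or> x' = flip x"
  unfolding flip_def by presburger

lemma is_mid_flip: "is_mid n (flip x) y \<longleftrightarrow> \<not> is_mid n x y" "is_mid n x (flip y) \<longleftrightarrow> \<not> is_mid n x y"
proof -
  have "odd ((flip z + 1) div 2 + (z + 1) div 2)" for z
    unfolding flip_def by presburger
  note this[of x] this[of y]
  then show "is_mid n (flip x) y \<longleftrightarrow> \<not> is_mid n x y" "is_mid n x (flip y) \<longleftrightarrow> \<not> is_mid n x y"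
    unfolding is_mid_def by presburger+
qed

lemma finite_dungeon_verts: "finite (dungeon_verts n)"
proof (rule finite_subset)
  show "dungeon_verts n \<subseteq> {- 2 * int n - 2..2 * int n + 2} \<times> {- 2 * int n - 2..2 * int n + 2} \<times> UNIV"
  proof
    fix v assume "v \<in> dungeon_verts n"
    moreover obtain x y b where v: "v = (x, y, b)" using prod_cases3 by blast
    ultimately have *: "\<bar>2 * (x div 2) + 1\<bar> + \<bar>2 * (y div 2) + 1\<bar> \<le> 2 * int n"
      by (simp add: dungeon_verts_def)
    have "- 2 * int n - 2 \<le> z \<and> z \<le> 2 * int n + 2" if "\<bar>2 * (z div 2) + 1\<bar> \<le> 2 * int n" for z
      using that by linarith
    from this[of x] this[of y] * show "v \<in> {- 2 * int n - 2..2 * int n + 2} \<times> {- 2 * int n - 2..2 * int n + 2} \<times> UNIV"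
      by (simp add: v)
  qed
qed simp

lemma prod_mids: "(\<Prod>c\<in>cells n. if c \<in> mids n then 2 else 1) = (2::real) ^ n\<^sup>2"
proof -
  have "(\<Prod>c\<in>cells n. if c \<in> mids n then 2 else 1) = (\<Prod>c\<in>mids n. 2 :: real)"
    using finite_cells by (intro prod.mono_neutral_cong_right) (auto simp: cells_def)
  also have "\<dots> = (\<Prod>(x, y)\<in>faces n. 2 :: real)"
    unfolding mids_def by (subst prod.reindex) (auto simp: inj_on_def case_prod_unfold)
  also have "\<dots> = 2 ^ n\<^sup>2"
    unfolding prod_faces[where D = "\<lambda>_ _. 2"] by (simp add: power2_eq_square power_mult)
  finally show ?thesis .
qed

lemma mid_cell_flip:
  assumes ij: "(i, j) \<in> faces n"
  defines "Q \<equiv> {(2 * i - 1, 2 * j - 1, False), (2 * i, 2 * j - 1, False), (2 * i, 2 * j, False), (2 * i - 1, 2 * j, False)}"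
  assumes S: "S \<subseteq> Q"
  shows "pmsum S (cell_weight n (2 * i, 2 * j)) = 2 * pmsum (Q - S) (cell_weight' n (2 * i, 2 * j))"
proof -
  have c: "2 * j \<noteq> 1" by presburger
  have odd: "odd (i + j + int n)" using ij by (simp add: faces_def)
  have edges: "is_edge (\<lambda>a b. mid_adj n a b \<and> corner_of a = (2 * i, 2 * j)) e \<longleftrightarrow>
    e = {(2 * i - 1, 2 * j - 1, False), (2 * i, 2 * j - 1, False)} \<or> e = {(2 * i, 2 * j - 1, False), (2 * i, 2 * j, False)} \<or>
    e = {(2 * i, 2 * j, False), (2 * i - 1, 2 * j, False)} \<or> e = {(2 * i - 1, 2 * j, False), (2 * i - 1, 2 * j - 1, False)}"
    (is "?L \<longleftrightarrow> ?R") for e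
  proof
    assume ?L
    then obtain a b where e: "e = {a, b}" and ab: "mid_adj n a b" "corner_of a = (2 * i, 2 * j)"
      by (auto simp: is_edge_def)
    obtain x y s x' y' s' where v: "a = (x, y, s)" "b = (x', y', s')" by (metis prod.exhaust)
    have "x = 2 * i \<or> x = 2 * i - 1" "y = 2 * j \<or> y = 2 * j - 1"
      using ab(2) by (simp_all add: v, presburger+)
    moreover have "s = False" "s' = False" "x' = across x \<and> y' = y \<or> x' = x \<and> y' = across y"
      using ab(1) by (simp_all add: v)
    ultimately show ?R
      unfolding e v by (elim disjE conjE) (simp_all add: doubleton_eq_iff)
  next
    assume ?R
    then show ?L
      using odd by (elim disjE) (simp_all add: is_mid_def)
  qed
  have "cell_weight n (2 * i, 2 * j) = four_cycle (2 * i - 1, 2 * j - 1, False) (2 * i, 2 * j - 1, False) (2 * i, 2 * j, False) (2 * i - 1, 2 * j, False) 1 1 1 1"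
    "cell_weight' n (2 * i, 2 * j) = four_cycle (2 * i - 1, 2 * j - 1, False) (2 * i, 2 * j - 1, False) (2 * i, 2 * j, False) (2 * i - 1, 2 * j, False) (1 / 2) (1 / 2) (1 / 2) (1 / 2)"
    using c by (intro ext; simp add: cell_weight_def cell_weight'_def edges four_cycle_def of_bool_def)+
  then show ?thesis
    using four_cycle_flip[of "(2 * i - 1, 2 * j - 1, False)" "(2 * i, 2 * j - 1, False)" "(2 * i, 2 * j, False)" "(2 * i - 1, 2 * j, False)" 1 1 1 1 S] S
    by (simp add: Q_def)
qed

text \<open>The midpoints among the corners of a rectangle are opposite to each other;
  \<open>p\<close> and \<open>q\<close> are the regions there, \<open>a\<close> and \<open>b\<close>
  those at the lattice corners.\<close>

lemma block_cell_flip: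
  assumes mid: "is_mid n x y"
  defines "c \<equiv> (2 * (x div 2) + 1, 2 * (y div 2) + 1)"
  defines "p \<equiv> (x, y, False)" and "q \<equiv> (flip x, flip y, False)" and "a \<equiv> (flip x, y, False)" and "b \<equiv> (x, flip y, False)"
    and "r \<equiv> (flip x, y, True)" and "s \<equiv> (x, flip y, True)"
  assumes S: "S \<subseteq> {p, q, a, b, r, s}" "r \<in> S" "s \<in> S"
  shows "pmsum S (cell_weight n c) = pmsum (S - {p, q} \<union> ({p, q} - S)) (cell_weight' n c)"
proof -
  note defs = p_def q_def a_def b_def r_def s_def
  have "odd (fst c)" by (simp add: c_def)
  then have c: "c \<noteq> (0, 1)" "odd (fst c)" by auto
  have "cell_weight n c e = of_bool (e \<in> {{r, a}, {r, b}, {r, p}, {s, b}, {s, a}, {s, q}})"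
    and "cell_weight' n c e = of_bool (e \<in> {{p, a}, {a, q}, {q, b}, {b, p}, {r, s}})"
    if e: "e \<subseteq> {p, q, a, b, r, s}" for e
  proof -
    have "is_edge (\<lambda>a b. hex_adj a b \<and> block_of a = c) e \<longleftrightarrow> e \<in> {{r, a}, {r, b}, {r, p}, {s, b}, {s, a}, {s, q}}" (is "?L \<longleftrightarrow> ?R")
    proof
      assume ?L
      then obtain u v where uv: "e = {u, v}" "hex_adj u v" by (auto simp: is_edge_def)
      with e have "u \<in> {p, q, a, b, r, s}" "v \<in> {p, q, a, b, r, s}" by auto
      then show ?R
        using uv(2) unfolding uv(1) by (elim insertE emptyE) (simp_all add: defs doubleton_eq_iff)
    next
      assume ?R
      then show ?L by (elim insertE emptyE) (simp_all add: defs c_def)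
    qed
    then show "cell_weight n c e = of_bool (e \<in> {{r, a}, {r, b}, {r, p}, {s, b}, {s, a}, {s, q}})"
      using c unfolding cell_weight_def by (simp only: if_False if_True simp_thms)
    have "is_edge (\<lambda>a b. square_adj a b \<and> block_of a = c) e \<longleftrightarrow> e \<in> {{p, a}, {a, q}, {q, b}, {b, p}, {r, s}}" (is "?L \<longleftrightarrow> ?R")
    proof
      assume ?L
      then obtain u v where uv: "e = {u, v}" "square_adj u v" by (auto simp: is_edge_def)
      with e have "u \<in> {p, q, a, b, r, s}" "v \<in> {p, q, a, b, r, s}" by auto
      then show ?R
        using uv(2) unfolding uv(1) by (elim insertE emptyE) (simp_all add: defs doubleton_eq_iff)
    next
      assume ?R
      then show ?L by (elim insertE emptyE) (simp_all add: defs c_def)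
    qed
    then show "cell_weight' n c e = of_bool (e \<in> {{p, a}, {a, q}, {q, b}, {b, p}, {r, s}})"
      using c unfolding cell_weight'_def by (simp only: if_False if_True simp_thms)
  qed
  then have "pmsum S (cell_weight n c) = pmsum S (\<lambda>e. of_bool (e \<in> {{r, a}, {r, b}, {r, p}, {s, b}, {s, a}, {s, q}}))"
    and "pmsum (S - {p, q} \<union> ({p, q} - S)) (cell_weight' n c) =
      pmsum (S - {p, q} \<union> ({p, q} - S)) (\<lambda>e. of_bool (e \<in> {{p, a}, {a, q}, {q, b}, {b, p}, {r, s}}))"
    using S(1) by (intro pmsum_cong; blast)+
  moreover have "pmsum S (\<lambda>e. of_bool (e \<in> {{r, a}, {r, b}, {r, p}, {s, b}, {s, a}, {s, q}})) =
      pmsum (S - {p, q} \<union> ({p, q} - S)) (\<lambda>e. of_bool (e \<in> {{p, a}, {a, q}, {q, b}, {b, p}, {r, s}}))"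
  proof (rule block_flip[OF _ S])
    show "distinct [p, q, a, b, r, s]" by (simp add: defs)
  qed (rule refl)+
  ultimately show ?thesis by (simp only:)
qed


lemma card_cells_at:
  assumes "(x, y, b) \<in> dungeon_verts n"
  shows "card (cells_at n (x, y, b)) = (if \<not> b \<and> ((x, y, b) \<in> dungeon_verts' n) then 2 else 1)"
proof -
  have "odd (2 * (x div 2) + 1)" by simp
  then have "2 * (x div 2) + 1 \<noteq> 0" "2 * (x div 2) + 1 \<noteq> 2 * ((x + 1) div 2)" by (metis even_zero, metis dvd_triv_left)
  then show ?thesis
    using assms by (auto simp: dungeon_verts'_def)
qed

lemma cells_at_subset: "v \<in> dungeon_verts n \<Longrightarrow> cells_at n v \<subseteq> cells n"
proof -
  assume v: "v \<in> dungeon_verts n"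
  obtain x y b where xyb: "v = (x, y, b)" using prod_cases3 by blast
  have "block_of v \<in> blocks n" by (rule block_of_in_blocks[OF v])
  then show ?thesis by (auto simp: xyb cells_def mids_def)
qed

lemma cell_weight_local:
  assumes "finite S" "v \<in> S" "S \<subseteq> dungeon_verts n" "c \<in> cells n"
  shows "pmsum S (cell_weight n c) \<noteq> 0 \<Longrightarrow> c \<in> cells_at n v"
    and "pmsum S (cell_weight' n c) \<noteq> 0 \<Longrightarrow> c \<in> cells_at n v"
proof -
  obtain x y b where v: "v = (x, y, b)" using prod_cases3 by blast
  have vV: "b \<longrightarrow> \<not> is_mid n x y" using assms by (auto simp: v dungeon_verts_def)
  have blk: "c = block_of v \<Longrightarrow> c \<in> cells_at n v" by (simp add: v)
  have bond: "bond_adj n v u \<or> bond_adj n u v \<Longrightarrow> (0, 1) \<in> cells_at n v" for u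
    by (cases u) (auto simp: v is_mid_across)
  have mid: "mid_adj n v u \<or> mid_adj n u v \<Longrightarrow> corner_of v \<in> cells n \<Longrightarrow> corner_of v \<in> cells_at n v" for u
  proof -
    assume a: "mid_adj n v u \<or> mid_adj n u v" and k: "corner_of v \<in> cells n"
    have 1: "2 * ((y + 1) div 2) \<noteq> (1::int)" by presburger
    have "even (fst (corner_of v))" by (simp add: v)
    with k 1 have "corner_of v \<in> mids n" using parity_blocks[of "corner_of v"] by (auto simp: cells_def v)
    then have "((x + 1) div 2, (y + 1) div 2) \<in> faces n" by (simp add: v mid_in_mids_iff)
    then show "corner_of v \<in> cells_at n v" using a by (cases u) (auto simp: v is_mid_across)
  qed
  have pair: "\<exists>u. e = {v, u}" if "v \<in> e" "e = {a, b}" for e a b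
    using that by blast
  have *: "c \<in> cells_at n v" if e: "v \<in> e" "cell_weight n c e \<noteq> 0 \<or> cell_weight' n c e \<noteq> 0" for e
  proof -
    consider "c = (0, 1)" "is_edge (bond_adj n) e"
      | "is_edge (\<lambda>a b. hex_adj a b \<and> block_of a = c) e"
      | "is_edge (\<lambda>a b. square_adj a b \<and> block_of a = c) e"
      | "is_edge (\<lambda>a b. mid_adj n a b \<and> corner_of a = c) e"
      using e(2) unfolding cell_weight_def cell_weight'_def by (auto split: if_splits)
    then show ?thesis
    proof cases
      case 1
      then obtain u where "e = {v, u}" using pair[OF e(1)] unfolding is_edge_def by blast
      with 1 bond[of u] show ?thesis by simp
    next
      case 2
      then obtain u where u: "e = {v, u}" using pair[OF e(1)] unfolding is_edge_def by blast
      with 2 have "hex_adj v u \<and> block_of v = c \<or> hex_adj u v \<and> block_of u = c" by simp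
      then show ?thesis using block_of_hex_adj[of u v] blk by auto
    next
      case 3
      then obtain u where u: "e = {v, u}" using pair[OF e(1)] unfolding is_edge_def by blast
      with 3 have "square_adj v u \<and> block_of v = c \<or> square_adj u v \<and> block_of u = c" by simp
      then show ?thesis using block_of_square_adj[of u v] blk by auto
    next
      case 4
      then obtain u where u: "e = {v, u}" using pair[OF e(1)] unfolding is_edge_def by blast
      with 4 have "mid_adj n v u \<and> corner_of v = c \<or> mid_adj n u v \<and> corner_of u = c" by simp
      then show ?thesis using corner_of_mid_adj[of n u v] mid[of u] assms(4) by auto
    qed
  qed
  show "c \<in> cells_at n v" if "pmsum S (cell_weight n c) \<noteq> 0"
    using pmsum_eq_0[OF assms(1,2), of "cell_weight n c"] that * by blast
  show "c \<in> cells_at n v" if "pmsum S (cell_weight' n c) \<noteq> 0"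
    using pmsum_eq_0[OF assms(1,2), of "cell_weight' n c"] that * by blast
qed

lemma dungeon_verts_of_face:
  assumes "(i, j) \<in> faces n"
  shows "{(2 * i - 1, 2 * j - 1, False), (2 * i, 2 * j - 1, False), (2 * i, 2 * j, False), (2 * i - 1, 2 * j, False)} \<subseteq> dungeon_verts n"
proof -
  have a: "(2 * k - 1) div 2 = k - 1" for k :: int by presburger
  have k: "\<bar>2 * k + 1\<bar> \<le> 2 * \<bar>k\<bar> + 1" "\<bar>2 * (k - 1) + 1\<bar> \<le> 2 * \<bar>k\<bar> + 1" for k :: int
    by (auto simp: abs_if)
  have "\<bar>i\<bar> + \<bar>j\<bar> + 1 \<le> int n" using assms by (simp add: faces_def)
  then have "\<bar>2 * i + 1\<bar> + \<bar>2 * j + 1\<bar> \<le> 2 * int n" "\<bar>2 * (i - 1) + 1\<bar> + \<bar>2 * j + 1\<bar> \<le> 2 * int n"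
    "\<bar>2 * i + 1\<bar> + \<bar>2 * (j - 1) + 1\<bar> \<le> 2 * int n" "\<bar>2 * (i - 1) + 1\<bar> + \<bar>2 * (j - 1) + 1\<bar> \<le> 2 * int n"
    using k[of i] k[of j] by linarith+
  moreover have b: "(2 * k) div 2 = k" for k :: int by simp
  ultimately show ?thesis
    unfolding insert_subset dungeon_verts_def mem_Collect_eq prod.case a b by blast
qed


text \<open>The moving vertices are the regions at midpoints. Midpoint cells undergo urban renewal
  with factor 2, rectangles undergo \<open>block_flip\<close> without a factor, and the collecting
  cell contains no moving vertex.\<close>

lemma dungeon_flip:
  "pmsum (dungeon_verts n) (dungeon_weight n) = 2 ^ n\<^sup>2 * pmsum (dungeon_verts' n) (dungeon_weight' n)"
proof -
  let ?V = "dungeon_verts n" and ?V' = "dungeon_verts' n"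
  define K where "K = {(x, y, b). \<not> b \<and> is_mid n x y}"
  have sub: "?V' \<subseteq> ?V" by (auto simp: dungeon_verts'_def)
  have K: "(x, y, b) \<in> K \<longleftrightarrow> \<not> b \<and> is_mid n x y" for x y b by (simp add: K_def)
  have "pmsum ?V (dungeon_weight n) = (\<Sum>\<sigma>\<in>?V \<rightarrow>\<^sub>E cells n. \<Prod>c\<in>cells n. pmsum {v\<in>?V. \<sigma> v = c} (cell_weight n c))"
    by (subst pmsum_sum[OF finite_dungeon_verts finite_cells, symmetric]) (rule pmsum_cong[OF dungeon_weight_eq_sum(1)])
  also have "\<dots> = (\<Prod>c\<in>cells n. if c \<in> mids n then 2 else 1) *
    (\<Sum>\<sigma>\<in>?V' \<rightarrow>\<^sub>E cells n. \<Prod>c\<in>cells n. pmsum {v\<in>?V'. \<sigma> v = c} (cell_weight' n c))"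
  proof (rule state_sum_flip[where K = K and I = "cells_at n"])
    show "finite ?V" "finite (cells n)" by (rule finite_dungeon_verts, rule finite_cells)
    show "?V' \<subseteq> ?V" by (rule sub)
    show "cells_at n v \<subseteq> cells n" if "v \<in> ?V" for v by (rule cells_at_subset[OF that])
    show "card (cells_at n v) = 2" if "v \<in> ?V'" "v \<in> K" for v
    proof -
      obtain x y b where v: "v = (x, y, b)" using prod_cases3 by blast
      show ?thesis using that sub card_cells_at[of x y b n] by (auto simp: v K simp del: cells_at.simps)
    qed
    show "v \<in> K \<and> card (cells_at n v) = 1" if "v \<in> ?V - ?V'" for v
    proof -
      obtain x y b where v: "v = (x, y, b)" using prod_cases3 by blast
      show ?thesis using that card_cells_at[of x y b n] by (auto simp: v K dungeon_verts'_def simp del: cells_at.simps)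
    qed
    show "c \<in> cells_at n v" if "c \<in> cells n" "S \<subseteq> ?V" "pmsum S (cell_weight n c) \<noteq> 0" "v \<in> S" for c S v
      using cell_weight_local(1)[OF finite_subset[OF that(2) finite_dungeon_verts] that(4,2,1,3)] .
    show "c \<in> cells_at n v" if "c \<in> cells n" "S \<subseteq> ?V'" "pmsum S (cell_weight' n c) \<noteq> 0" "v \<in> S" for c S v
      using cell_weight_local(2)[OF _ that(4) _ that(1,3)] that(2) sub finite_subset[OF _ finite_dungeon_verts] by blast
    fix c S
    assume c: "c \<in> cells n" and S: "S \<subseteq> {v \<in> ?V. c \<in> cells_at n v}" "{v \<in> ?V. cells_at n v = {c}} \<subseteq> S"
    consider "c = (0, 1)" | "c \<in> mids n" | "c \<in> blocks n" using c by (auto simp: cells_def)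
    then show "pmsum S (cell_weight n c) = (if c \<in> mids n then 2 else 1) *
       pmsum (S - K \<union> ({v \<in> ?V. c \<in> cells_at n v} \<inter> K - S)) (cell_weight' n c)"
    proof cases
      case 1
      have "{v \<in> ?V. c \<in> cells_at n v} \<inter> K = {}"
      proof -
        have "2 * k + 1 \<noteq> 0" "2 * k \<noteq> 1" for k :: int by presburger+
        then show ?thesis by (auto simp: 1 K_def split: if_splits)
      qed
      moreover have "c \<notin> mids n" using parity_mids[of c n] by (auto simp: 1)
      moreover have "cell_weight n c = cell_weight' n c" by (simp add: fun_eq_iff 1 cell_weight_def cell_weight'_def)
      moreover have "S - K = S" using S(1) calculation(1) by blast
      ultimately show ?thesis by simp
    next
      case 2
      then obtain i j where ij: "c = (2 * i, 2 * j)" "(i, j) \<in> faces n" by (auto simp: mids_def)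
      let ?Q = "{(2 * i - 1, 2 * j - 1, False), (2 * i, 2 * j - 1, False), (2 * i, 2 * j, False), (2 * i - 1, 2 * j, False)}"
      have "odd (i + j + int n)" using ij(2) by (simp add: faces_def)
      then have "is_mid n (2 * i - 1) (2 * j - 1)" "is_mid n (2 * i) (2 * j - 1)" "is_mid n (2 * i) (2 * j)" "is_mid n (2 * i - 1) (2 * j)"
        by (simp_all add: is_mid_def)
      then have QK: "?Q \<subseteq> K" "\<And>v. v \<in> ?Q \<Longrightarrow> c \<in> cells_at n v"
        using ij(2) by (auto simp: K ij(1))
      have "v \<in> ?Q" if v: "v \<in> ?V" "c \<in> cells_at n v" for v
      proof -
        obtain x y b where xy: "v = (x, y, b)" using prod_cases3 by blast
        have "2 * k + 1 \<noteq> 2 * i" "2 * j \<noteq> 1" for k by presburger+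
        then have "(x + 1) div 2 = i" "(y + 1) div 2 = j" "\<not> b"
          using v(2) by (auto simp: xy ij(1) split: if_splits)
        moreover from this have "x = 2 * i \<or> x = 2 * i - 1" "y = 2 * j \<or> y = 2 * j - 1" by presburger+
        ultimately show ?thesis by (auto simp: xy)
      qed
      then have "{v \<in> ?V. c \<in> cells_at n v} = ?Q"
        using QK(2) dungeon_verts_of_face[OF ij(2)] by blast
      moreover from this have "S \<subseteq> ?Q" using S(1) by (simp only:)
      moreover from this QK(1) have "S - K \<union> (?Q \<inter> K - S) = ?Q - S" by blast
      ultimately show ?thesis
        using mid_cell_flip[OF ij(2), of S] 2 by (simp only: ij(1) if_True)
    next
      case 3
      then have nm: "c \<notin> mids n" using parity_blocks[of c n] parity_mids[of c n] by blast
      have odd: "odd (fst c)" "odd (snd c)" using parity_blocks[OF 3] by auto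
      then obtain i j where ij: "c = (2 * i + 1, 2 * j + 1)" by (metis oddE prod.collapse)
      \<comment> \<open>Exactly one of the two lower corners of a rectangle is a midpoint, and
        \<open>x\<close> selects it.\<close>
      define x where "x = (if is_mid n (2 * i) (2 * j) then 2 * i else 2 * i + 1)"
      define y where "y = 2 * j"
      have xy: "x div 2 = i" "y div 2 = j" by (auto simp: x_def y_def)
      have mid: "is_mid n x y" using is_mid_flip(1)[of n "2 * i" "2 * j"] by (auto simp: x_def y_def)
      define p q a b r s where defs: "p = (x, y, False)" "q = (flip x, flip y, False)" "a = (flip x, y, False)" "b = (x, flip y, False)"
        "r = (flip x, y, True)" "s = (x, flip y, True)"
      have inV: "\<bar>2 * i + 1\<bar> + \<bar>2 * j + 1\<bar> \<le> 2 * int n" using 3 by (simp add: ij blocks_def)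
      have N: "{v \<in> ?V. c \<in> cells_at n v} = {p, q, a, b, r, s}"
      proof (rule set_eqI)
        fix v :: vert
        obtain x' y' t where v: "v = (x', y', t)" using prod_cases3 by blast
        have "2 * k + 1 \<noteq> 2 * l" for k l :: int by presburger
        then have "2 * i + 1 \<noteq> 2 * l" "2 * i + 1 \<noteq> 0" for l by (metis mult_zero_right)+
        then have "c \<in> cells_at n v \<longleftrightarrow> x' div 2 = x div 2 \<and> y' div 2 = y div 2"
          by (auto simp: v ij xy)
        also have "\<dots> \<longleftrightarrow> (x' = x \<or> x' = flip x) \<and> (y' = y \<or> y' = flip y)"
          by (simp only: flip_cases)
        finally have *: "c \<in> cells_at n v \<longleftrightarrow> (x' = x \<or> x' = flip x) \<and> (y' = y \<or> y' = flip y)" .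
        show "v \<in> {v \<in> ?V. c \<in> cells_at n v} \<longleftrightarrow> v \<in> {p, q, a, b, r, s}"
          unfolding mem_Collect_eq * using inV mid by (cases t) (auto simp: v defs dungeon_verts_def xy is_mid_flip)
      qed
      have rs: "r \<in> S" "s \<in> S"
      proof -
        have "cells_at n r = {c}" "cells_at n s = {c}" by (simp_all add: defs ij xy)
        moreover have "r \<in> ?V" "s \<in> ?V" using N by blast+
        ultimately show "r \<in> S" "s \<in> S" using S(2) by blast+
      qed
      have "p \<in> K" "q \<in> K" "a \<notin> K" "b \<notin> K" "r \<notin> K" "s \<notin> K"
        using mid by (simp_all add: defs K is_mid_flip)
      then have "S - K \<union> ({p, q, a, b, r, s} \<inter> K - S) = S - {p, q} \<union> ({p, q} - S)"
        using S(1) unfolding N by blast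
      moreover have "pmsum S (cell_weight n c) = pmsum (S - {p, q} \<union> ({p, q} - S)) (cell_weight' n c)"
        using block_cell_flip[OF mid, of S] S(1)[unfolded N] rs unfolding defs xy ij by blast
      ultimately show ?thesis
        unfolding N using nm by simp
    qed
  qed
  also have "(\<Sum>\<sigma>\<in>?V' \<rightarrow>\<^sub>E cells n. \<Prod>c\<in>cells n. pmsum {v\<in>?V'. \<sigma> v = c} (cell_weight' n c)) = pmsum ?V' (dungeon_weight' n)"
    by (subst pmsum_sum[OF finite_subset[OF sub finite_dungeon_verts] finite_cells, symmetric])
      (rule pmsum_cong, rule dungeon_weight_eq_sum(2)[symmetric], use sub in blast)
  finally show ?thesis by (simp add: prod_mids)
qed

text \<open>Isolated edges of weight 1 are forced in every matching with nonzero weight. This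
  disposes of the edges \<open>{r, s}\<close> that \<open>block_flip\<close> leaves behind.\<close>

lemma pmsum_remove_pairs:
  assumes "finite B" "finite V" "V \<inter> B = {}"
    and "\<And>b. b \<in> B \<Longrightarrow> f b \<in> B \<and> f b \<noteq> b \<and> f (f b) = b"
    and "\<And>b u. b \<in> B \<Longrightarrow> u \<in> V \<union> B \<Longrightarrow> w {b, u} = (if u = f b then 1 else 0)"
    and graph: "\<And>e. w e \<noteq> 0 \<Longrightarrow> card e = 2"
  shows "pmsum (V \<union> B) w = pmsum V w"
  using assms(1-5)
proof (induction B rule: finite_psubset_induct)
  case (psubset B)
  show ?case
  proof (cases "B = {}")
    case False
    then obtain b where b: "b \<in> B" by blast
    note f = psubset.prems(3)[OF b]
    have "pmsum (V \<union> B) w = (\<Sum>u\<in>V \<union> B - {b}. w {b, u} * pmsum (V \<union> B - {b, u}) w)"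
      by (rule pmsum_rec_graph) (use psubset b graph in auto)
    also have "\<dots> = (\<Sum>u\<in>V \<union> B - {b}. if u = f b then pmsum (V \<union> B - {b, f b}) w else 0)"
      by (rule sum.cong) (use psubset.prems(4)[OF b] in auto)
    also have "\<dots> = pmsum (V \<union> B - {b, f b}) w"
      using psubset b f by simp
    also have "V \<union> B - {b, f b} = V \<union> (B - {b, f b})"
      using psubset.prems(2) b f by blast
    also have "pmsum \<dots> w = pmsum V w"
    proof (rule psubset.IH)
      show "B - {b, f b} \<subset> B" using b by blast
      show "f c \<in> B - {b, f b} \<and> f c \<noteq> c \<and> f (f c) = c" if "c \<in> B - {b, f b}" for c
        using psubset.prems(3)[of c] f that by (metis Diff_iff insert_iff singletonD empty_iff)
    qed (use psubset.prems in auto)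
    finally show ?thesis .
  qed simp
qed

section \<open>The renewed dungeon as a weighted Aztec diamond\<close>

definition white :: "int \<times> int \<Rightarrow> vert" where "white = (\<lambda>(x, y). (x, y, False))"

lemma white_simp [simp]: "white (x, y) = (x, y, False)"
  by (simp add: white_def)

lemma white_image_iff: "(x, y, b) \<in> white ` S \<longleftrightarrow> \<not> b \<and> (x, y) \<in> S"
  by (auto simp: white_def intro!: rev_image_eqI[of "(x, y)"])

lemma flip_eq: "flip x = x + 1 \<or> x = flip x + 1" and across_eq: "across x = x + 1 \<or> x = across x + 1"
  by (simp_all add: flip_def across_def)

lemma horizontal_weight_is_mid: "horizontal_weight (int n + 1) h p q x y = (if even x then h else if is_mid n x y then p else q)"
  and vertical_weight_is_mid: "vertical_weight (int n + 1) u v x y = (if even y then u else if is_mid n x y then v else 0)"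
proof -
  have "even ((x + 1) div 2 + (y + 1) div 2 + (int n + 1)) \<longleftrightarrow> is_mid n x y"
    unfolding is_mid_def by presburger
  then show "horizontal_weight (int n + 1) h p q x y = (if even x then h else if is_mid n x y then p else q)"
    "vertical_weight (int n + 1) u v x y = (if even y then u else if is_mid n x y then v else 0)"
    by (simp_all only: horizontal_weight_def vertical_weight_def)
qed

text \<open>Edges within a rectangle start at an even coordinate and edges between rectangles at an
  odd one, which matches the alternation of the periodic weights. Between rectangles, midpoint edges
  have weight 1/2, and at lattice points horizontal edges have weight 1 and vertical ones 0.\<close>

lemma dungeon_weight'_white:
  "dungeon_weight' n (white ` e) = grid (horizontal_weight (int n + 1) 1 (1 / 2) 1) (vertical_weight (int n + 1) 1 (1 / 2)) e"
proof -
  consider (h) x y where "e = {(x, y), (x + 1, y)}" | (v) x y where "e = {(x, y), (x, y + 1)}"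
    | (o) "\<And>x y. e \<noteq> {(x, y), (x + 1, y)}" "\<And>x y. e \<noteq> {(x, y), (x, y + 1)}"
    by blast
  then show ?thesis
  proof cases
    case h
    show ?thesis
    proof (cases "even x")
      case True
      then have "flip x = x + 1" "across x = x - 1" "flip (x + 1) = x" "across (x + 1) = x + 2"
        by (simp_all add: flip_def across_def)
      then show ?thesis using True by (simp add: h grid_horizontal horizontal_weight_is_mid dungeon_weight'_def)
    next
      case False
      then have s: "across x = x + 1" "flip x = x - 1" "across (x + 1) = x" "flip (x + 1) = x + 2"
        by (simp_all add: flip_def across_def)
      then have "is_mid n (x + 1) y = is_mid n x y" using is_mid_across(1)[of n x y] by simp
      with s False show ?thesis by (simp add: h grid_horizontal horizontal_weight_is_mid dungeon_weight'_def)
    qed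
  next
    case v
    show ?thesis
    proof (cases "even y")
      case True
      then have "flip y = y + 1" "across y = y - 1" "flip (y + 1) = y" "across (y + 1) = y + 2"
        by (simp_all add: flip_def across_def)
      then show ?thesis using True by (simp add: v grid_vertical vertical_weight_is_mid dungeon_weight'_def)
    next
      case False
      then have s: "across y = y + 1" "flip y = y - 1" "across (y + 1) = y" "flip (y + 1) = y + 2"
        by (simp_all add: flip_def across_def)
      then have "is_mid n x (y + 1) = is_mid n x y" using is_mid_across(2)[of n x y] by simp
      with s False show ?thesis by (simp add: v grid_vertical vertical_weight_is_mid dungeon_weight'_def)
    qed
  next
    case o
    have none: "\<not> is_edge R (white ` e)"
      if R: "\<And>x y s x' y' s'. R (x, y, s) (x', y', s') \<Longrightarrow> \<not> s \<Longrightarrow>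
        (x' = x + 1 \<or> x = x' + 1) \<and> y' = y \<or> x' = x \<and> (y' = y + 1 \<or> y = y' + 1)" for R
    proof
      assume "is_edge R (white ` e)"
      then obtain a b where ab: "white ` e = {a, b}" "R a b" by (auto simp: is_edge_def)
      then have "a \<in> white ` e" "b \<in> white ` e" by auto
      then obtain x y x' y' where xy: "a = (x, y, False)" "b = (x', y', False)" by auto
      have "inj white" by (auto simp: inj_def)
      moreover have "white ` e = white ` {(x, y), (x', y')}" by (simp add: ab xy)
      ultimately have e: "e = {(x, y), (x', y')}" by (simp only: inj_image_eq_iff)
      from R[of x y False x' y' False] ab xy
      have "(x' = x + 1 \<or> x = x' + 1) \<and> y' = y \<or> x' = x \<and> (y' = y + 1 \<or> y = y' + 1)" by simp
      then show False
        using e o(1)[of x y] o(1)[of x' y] o(2)[of x y] o(2)[of x y']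
        by (elim disjE conjE) (simp_all add: insert_commute)
    qed
    have adj: "(x' = x + 1 \<or> x = x' + 1) \<and> y' = y \<or> x' = x \<and> (y' = y + 1 \<or> y = y' + 1)"
      if "square_adj (x, y, s) (x', y', s') \<or> mid_adj n (x, y, s) (x', y', s') \<or> bond_adj n (x, y, s) (x', y', s')" "\<not> s"
      for x y s x' y' s'
      using that flip_eq[of x] flip_eq[of y] across_eq[of x] across_eq[of y] by auto
    have "\<not> is_edge square_adj (white ` e)" "\<not> is_edge (mid_adj n) (white ` e)" "\<not> is_edge (bond_adj n) (white ` e)"
      by (rule none, rule adj, blast+)+
    with o show ?thesis by (simp add: dungeon_weight'_def grid_other)
  qed
qed

text \<open>Of the two positions in a block, the alternatives describe the one farther from the
  centre and the one nearer to it.\<close>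

lemma block_coordinate:
  "\<exists>c. \<bar>2 * (x div 2) + 1\<bar> = 2 * c + 1 \<and>
     (\<bar>2 * x + 1\<bar> = 4 * c + 3 \<and> \<bar>(x + 1) div 2\<bar> = c + 1 \<or> \<bar>2 * x + 1\<bar> = 4 * c + 1 \<and> \<bar>(x + 1) div 2\<bar> = c)" for x :: int
proof (cases "x \<ge> 0")
  case True
  then have "x div 2 \<ge> 0" by simp
  with True show ?thesis by (intro exI[of _ "x div 2"]) (cases "even x"; auto elim!: evenE oddE)
next
  case False
  then have "x div 2 < 0" by simp
  with False show ?thesis by (intro exI[of _ "- (x div 2) - 1"]) (cases "even x"; auto elim!: evenE oddE)
qed

text \<open>Only the rectangles with \<open>c + d + 1 = n\<close> are affected. Their outermost
  corner is a midpoint outside \<open>faces n\<close> and is dropped, while the other three corners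
  stay; this smooths the steps of length two into those of the diamond of twice the order.\<close>

lemma white_in_dungeon_iff: "(x, y, False) \<in> dungeon_verts' n \<longleftrightarrow> (x, y) \<in> diamond (2 * n)"
proof -
  define i j where "i = (x + 1) div 2" and "j = (y + 1) div 2"
  obtain c where c: "\<bar>2 * (x div 2) + 1\<bar> = 2 * c + 1"
    "\<bar>2 * x + 1\<bar> = 4 * c + 3 \<and> \<bar>i\<bar> = c + 1 \<or> \<bar>2 * x + 1\<bar> = 4 * c + 1 \<and> \<bar>i\<bar> = c"
    unfolding i_def using block_coordinate[of x] by blast
  obtain d where d: "\<bar>2 * (y div 2) + 1\<bar> = 2 * d + 1"
    "\<bar>2 * y + 1\<bar> = 4 * d + 3 \<and> \<bar>j\<bar> = d + 1 \<or> \<bar>2 * y + 1\<bar> = 4 * d + 1 \<and> \<bar>j\<bar> = d"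
    unfolding j_def using block_coordinate[of y] by blast
  define N where "N = int n"
  have key: "2 * c + 1 + (2 * d + 1) \<le> 2 * N \<and> (odd (I + J + N) \<longrightarrow> I + J < N) \<longleftrightarrow> X + Y \<le> 4 * N"
    if "X = 4 * c + 3 \<and> I = c + 1 \<or> X = 4 * c + 1 \<and> I = c" "Y = 4 * d + 3 \<and> J = d + 1 \<or> Y = 4 * d + 1 \<and> J = d"
    for c d I J X Y N :: int
    using that by (elim disjE conjE; hypsubst; presburger)
  have par: "odd (i + j + N) \<longleftrightarrow> odd (\<bar>i\<bar> + \<bar>j\<bar> + N)" by simp
  have "(x, y, False) \<in> dungeon_verts' n \<longleftrightarrow>
    2 * c + 1 + (2 * d + 1) \<le> 2 * N \<and> (odd (\<bar>i\<bar> + \<bar>j\<bar> + N) \<longrightarrow> \<bar>i\<bar> + \<bar>j\<bar> < N)"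
    unfolding dungeon_verts'_def dungeon_verts_def is_mid_def faces_def mem_Collect_eq prod.case c(1) d(1)
      i_def[symmetric] j_def[symmetric] N_def[symmetric] par by blast
  also have "\<dots> \<longleftrightarrow> \<bar>2 * x + 1\<bar> + \<bar>2 * y + 1\<bar> \<le> 4 * N"
    using key[OF c(2) d(2)] .
  also have "\<dots> \<longleftrightarrow> (x, y) \<in> diamond (2 * n)"
    by (simp add: diamond_def N_def)
  finally show ?thesis .
qed

lemma pmsum_dungeon_verts': "pmsum (dungeon_verts' n) (dungeon_weight' n) = diamond_sum n 1 (1 / 2) 1 (1 / 2) 1"
proof -
  define B where "B = {(x, y, b) \<in> dungeon_verts' n. b}"
  have sub: "dungeon_verts' n \<subseteq> dungeon_verts n" by (auto simp: dungeon_verts'_def)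
  have inj: "inj_on white S" for S by (auto simp: inj_on_def)
  have eq: "dungeon_verts' n = white ` diamond (2 * n) \<union> B"
  proof (rule set_eqI)
    fix v :: vert
    obtain x y b where v: "v = (x, y, b)" using prod_cases3 by blast
    show "v \<in> dungeon_verts' n \<longleftrightarrow> v \<in> white ` diamond (2 * n) \<union> B"
      using white_in_dungeon_iff[of x y n] by (cases b) (auto simp: v B_def white_image_iff)
  qed
  have graph: "card e = 2" if "dungeon_weight' n e \<noteq> 0" for e
  proof -
    have "is_edge square_adj e \<or> is_edge (mid_adj n) e \<or> is_edge (bond_adj n) e"
      using that by (auto simp: dungeon_weight'_def)
    moreover have "a \<noteq> b" if "square_adj a b \<or> mid_adj n a b \<or> bond_adj n a b" for a b
      using that by (cases a; cases b; cases "snd (snd a)") auto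
    ultimately obtain a b where "e = {a, b}" "a \<noteq> b" unfolding is_edge_def by blast
    then show ?thesis by simp
  qed
  have "pmsum (white ` diamond (2 * n) \<union> B) (dungeon_weight' n) = pmsum (white ` diamond (2 * n)) (dungeon_weight' n)"
  proof (rule pmsum_remove_pairs[where f = "\<lambda>(x, y, b). (flip x, flip y, b)"])
    have "B \<subseteq> dungeon_verts n" using sub by (auto simp: B_def)
    then show "finite B" by (rule finite_subset) (rule finite_dungeon_verts)
    show "white ` diamond (2 * n) \<inter> B = {}" by (auto simp: B_def)
    show "(case b of (x, y, b) \<Rightarrow> (flip x, flip y, b)) \<in> B \<and> (case b of (x, y, b) \<Rightarrow> (flip x, flip y, b)) \<noteq> b \<and>
      (case (case b of (x, y, b) \<Rightarrow> (flip x, flip y, b)) of (x, y, b) \<Rightarrow> (flip x, flip y, b)) = b" if "b \<in> B" for b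
      using that by (auto simp: B_def dungeon_verts'_def dungeon_verts_def is_mid_flip)
    show "dungeon_weight' n {b, u} = (if u = (case b of (x, y, b) \<Rightarrow> (flip x, flip y, b)) then 1 else 0)" if "b \<in> B" for b u
    proof -
      obtain x y t x' y' t' where v: "b = (x, y, t)" "u = (x', y', t')" by (metis prod.exhaust)
      have t using that by (auto simp: B_def v)
      then show ?thesis by (auto simp: v dungeon_weight'_def)
    qed
  qed (use graph finite_diamond in auto)
  then show ?thesis
    by (simp add: eq pmsum_image[OF inj] dungeon_weight'_white diamond_sum_def)
qed

lemma pmsum_dungeon: "pmsum (dungeon_verts n) (dungeon_weight n) = 2 ^ n\<^sup>2 * diamond_sum n 1 (1 / 2) 1 (1 / 2) 1"
  by (simp add: dungeon_flip pmsum_dungeon_verts')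

section \<open>Elementary regions\<close>

text \<open>In these coordinates all vertices of the drawing are integral.\<close>

definition plane_pt :: "real \<Rightarrow> real \<Rightarrow> point" where
  "plane_pt s t = (s / 4, t * sqrt 3 / 12)"

lemma plane_pt_surj: "\<exists>s t. q = plane_pt s t"
  by (rule exI[of _ "4 * fst q"], rule exI[of _ "4 * sqrt 3 * snd q"]) (simp add: plane_pt_def prod_eq_iff field_simps)

lemma plane_pt_eq_iff [simp]: "plane_pt s t = plane_pt s' t' \<longleftrightarrow> s = s' \<and> t = t'"
  by (simp add: plane_pt_def)

lemma plane_pt_diff: "plane_pt s t - plane_pt s' t' = plane_pt (s - s') (t - t')"
  by (simp add: plane_pt_def diff_divide_distrib algebra_simps)

lemma plane_pt_scale: "c *\<^sub>R plane_pt s t = plane_pt (c * s) (c * t)" and plane_pt_add: "plane_pt s t + plane_pt s' t' = plane_pt (s + s') (t + t')"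
  by (simp_all add: plane_pt_def algebra_simps add_divide_distrib)

lemma inner_plane_pt: "plane_pt s t \<bullet> plane_pt s' t' = (3 * s * s' + t * t') / 48"
  by (simp add: plane_pt_def inner_prod_def field_simps)

lemma dist_plane_pt_eq_1: "dist (plane_pt s t) (plane_pt s' t') = 1 \<longleftrightarrow> 3 * (s - s')\<^sup>2 + (t - t')\<^sup>2 = 48"
  unfolding dist_norm norm_eq_1 plane_pt_diff inner_plane_pt by (auto simp: power2_eq_square field_simps)

lemma plane_pt_in_Lam_iff: "plane_pt s t \<in> Lam \<longleftrightarrow> (\<exists>a b :: int. s = 4 * of_int a + 2 * of_int b \<and> t = 6 * of_int b)"
  unfolding Lam_def mem_Collect_eq plane_pt_def by (simp add: field_simps)

lemma plane_pt_in_Lam: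
  assumes "even (i + j)"
  shows "plane_pt (2 * of_int i) (6 * of_int j) \<in> Lam"
proof -
  have "even (i - j)" using assms by simp
  then obtain a where "i - j = 2 * a" by blast
  then have "i = 2 * a + j" by simp
  then show ?thesis unfolding plane_pt_in_Lam_iff by (intro exI[of _ a] exI[of _ j]) simp
qed

text \<open>The mirrors of the affine reflection group of type G2: three directions of lattice lines
  and three directions of altitudes.\<close>

definition mirror :: "real \<Rightarrow> real \<Rightarrow> bool" where
  "mirror s t \<longleftrightarrow> s / 2 \<in> \<int> \<or> t / 6 \<in> \<int> \<or> (3 * s - t) / 12 \<in> \<int> \<or> (3 * s + t) / 12 \<in> \<int> \<or>
     (s + t) / 4 \<in> \<int> \<or> (s - t) / 4 \<in> \<int>"

text \<open>In lattice coordinates unit length means \<open>c * c + c * d + d * d = 1\<close>, an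
  equation with six integer solutions.\<close>

lemma Lam_unit_vector:
  assumes "plane_pt s t \<in> Lam" "plane_pt s' t' \<in> Lam" "dist (plane_pt s t) (plane_pt s' t') = 1"
  shows "\<bar>s - s'\<bar> = 4 \<and> t = t' \<or> s' - s = 2 \<and> t' - t = 6 \<or> s - s' = 2 \<and> t - t' = 6 \<or>
     s' - s = 2 \<and> t - t' = 6 \<or> s - s' = 2 \<and> t' - t = 6"
proof -
  obtain a b a' b' :: int where ab: "s = 4 * of_int a + 2 * of_int b" "t = 6 * of_int b"
    "s' = 4 * of_int a' + 2 * of_int b'" "t' = 6 * of_int b'"
    using assms(1,2) unfolding plane_pt_in_Lam_iff by blast
  define c d where "c = a - a'" and "d = b - b'"
  have "3 * (4 * real_of_int c + 2 * of_int d)\<^sup>2 + (6 * of_int d)\<^sup>2 = 48"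
    using assms(3) unfolding dist_plane_pt_eq_1 by (simp add: ab c_def d_def algebra_simps)
  then have "real_of_int (c * c + c * d + d * d) = 1"
    by (simp add: power2_eq_square algebra_simps)
  then have eq: "c * c + c * d + d * d = 1" by (simp only: of_int_eq_1_iff)
  then have sq: "(2 * c + d) * (2 * c + d) + 3 * (d * d) = 4" "(2 * d + c) * (2 * d + c) + 3 * (c * c) = 4"
    by (simp_all add: algebra_simps)
  have small: "\<bar>z\<bar> \<le> 1" if "w * w + 3 * (z * z) = 4" for w z :: int
  proof (rule ccontr)
    assume "\<not> \<bar>z\<bar> \<le> 1"
    then have "2 * 2 \<le> \<bar>z\<bar> * \<bar>z\<bar>" by (intro mult_mono) auto
    then show False using that zero_le_square[of w] by (simp add: abs_mult_self_eq)
  qed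
  have "\<bar>c\<bar> \<le> 1" "\<bar>d\<bar> \<le> 1" using small sq by blast+
  then have "c \<in> {-1, 0, 1}" "d \<in> {-1, 0, 1}" by auto
  with eq have "(c = 1 \<and> d = 0) \<or> (c = -1 \<and> d = 0) \<or> (c = 0 \<and> d = 1) \<or> (c = 0 \<and> d = -1) \<or> (c = 1 \<and> d = -1) \<or> (c = -1 \<and> d = 1)"
    by auto
  moreover have "s - s' = 4 * of_int c + 2 * of_int d" "t - t' = 6 * of_int d"
    by (simp_all add: ab c_def d_def)
  ultimately show ?thesis by (elim disjE conjE) auto
qed

lemma mirror_Lam: "plane_pt s t \<in> Lam \<Longrightarrow> s / 2 \<in> \<int> \<and> t / 6 \<in> \<int> \<and> (3 * s - t) / 12 \<in> \<int> \<and> (3 * s + t) / 12 \<in> \<int> \<and>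
     (s + t) / 4 \<in> \<int> \<and> (s - t) / 4 \<in> \<int>"
  unfolding plane_pt_in_Lam_iff by (auto simp: add_divide_distrib diff_divide_distrib)

text \<open>Segments are enlarged to lines: an edge or altitude starts at a lattice point, which
  lies on mirrors of all six families, and its direction is that of one family. For an altitude the
  direction follows from orthogonality, without computing the foot.\<close>

lemma G2_mirror:
  assumes "plane_pt s t \<in> G2"
  shows "mirror s t"
proof -
  consider (edge) A B where "plane_pt s t \<in> closed_segment A B" "A \<in> Lam" "B \<in> Lam" "dist A B = 1"
    | (alt) A B C F where "unit_triangle A B C" "orthogonal (A - F) (B - C)" "plane_pt s t \<in> closed_segment A F"
    using assms unfolding G2_def altitude_def by blast
  then show ?thesis
  proof cases
    case edge
    obtain a a' b b' where AB: "A = plane_pt a a'" "B = plane_pt b b'" using plane_pt_surj by metis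
    from edge(1) obtain u where u: "plane_pt s t = (1 - u) *\<^sub>R A + u *\<^sub>R B" unfolding closed_segment_def by blast
    then have st: "s = a + u * (b - a)" "t = a' + u * (b' - a')"
      by (simp_all add: AB plane_pt_scale plane_pt_add algebra_simps)
    note m = mirror_Lam[OF edge(2)[unfolded AB]]
    consider "a' = b'" | "b' - a' = 3 * (b - a)" | "b' - a' = - 3 * (b - a)"
      using Lam_unit_vector[OF edge(2-4)[unfolded AB]] by (elim disjE conjE) force+
    then show ?thesis
    proof cases
      case 1 then show ?thesis using m by (simp add: mirror_def st)
    next
      case 2
      have "3 * s - t = 3 * a - a'" unfolding st 2 by (simp add: algebra_simps)
      then show ?thesis using m by (simp add: mirror_def)
    next
      case 3
      have "3 * s + t = 3 * a + a'" unfolding st 3 by (simp add: algebra_simps)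
      then show ?thesis using m by (simp add: mirror_def)
    qed
  next
    case alt
    then have ABC: "A \<in> Lam" "B \<in> Lam" "C \<in> Lam" "dist B C = 1" by (auto simp: unit_triangle_def)
    obtain a a' b b' c c' f f' where coords: "A = plane_pt a a'" "B = plane_pt b b'" "C = plane_pt c c'" "F = plane_pt f f'" using plane_pt_surj by metis
    from alt(3) obtain u where u: "plane_pt s t = (1 - u) *\<^sub>R A + u *\<^sub>R F" unfolding closed_segment_def by blast
    then have st: "s - a = u * (f - a)" "t - a' = u * (f' - a')"
      by (simp_all add: coords plane_pt_scale plane_pt_add algebra_simps)
    have "3 * (a - f) * (b - c) + (a' - f') * (b' - c') = 0"
      using alt(2) by (simp add: orthogonal_def coords plane_pt_diff inner_plane_pt)
    then have "u * (3 * (a - f) * (b - c) + (a' - f') * (b' - c')) = 0" by simp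
    then have o: "3 * (s - a) * (b - c) + (t - a') * (b' - c') = 0"
      unfolding st by (simp add: algebra_simps)
    note m = mirror_Lam[OF ABC(1)[unfolded coords]]
    consider "b' = c'" "b \<noteq> c" | "b' - c' = 3 * (b - c)" "b \<noteq> c" | "b' - c' = - 3 * (b - c)" "b \<noteq> c"
      using Lam_unit_vector[OF ABC(2-4)[unfolded coords]] by force
    then show ?thesis
    proof cases
      case 1
      then have "s = a" using o by simp
      then show ?thesis using m by (simp add: mirror_def)
    next
      case 2
      have "3 * (b - c) * ((s + t) - (a + a')) = 0" using o[unfolded 2(1)] by (simp add: algebra_simps)
      then have "s + t = a + a'" using 2 by simp
      then show ?thesis using m by (simp add: mirror_def)
    next
      case 3
      have "3 * (b - c) * ((s - t) - (a - a')) = 0" using o[unfolded 3(1)] by (simp add: algebra_simps)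
      then have "s - t = a - a'" using 3 by simp
      then show ?thesis using m by (simp add: mirror_def)
    qed
  qed
qed

text \<open>A frame consists of a lattice point and a quadrant at it; \<open>base\<close> lists the other two vertices of the three elementary regions at the origin in the first quadrant.\<close>

definition chart :: "int \<Rightarrow> int \<Rightarrow> int \<Rightarrow> int \<Rightarrow> real \<Rightarrow> real \<Rightarrow> point" where
  "chart i j e f x y = plane_pt (2 * of_int i + of_int e * x) (6 * of_int j + of_int f * y)"

definition base :: "((real \<times> real) \<times> (real \<times> real)) set" where
  "base = {((2, 0), (2, 2)), ((1, 3), (2, 2)), ((1, 3), (0, 4))}"

definition alcove :: "int \<Rightarrow> int \<Rightarrow> int \<Rightarrow> int \<Rightarrow> (real \<times> real) \<times> (real \<times> real) \<Rightarrow> point set" where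
  "alcove i j e f = (\<lambda>((m, m'), (c, c')). convex hull {chart i j e f 0 0, chart i j e f m m', chart i j e f c c'})"

definition frames :: "(int \<times> int \<times> int \<times> int) set" where
  "frames = {(i, j, e, f). even (i + j) \<and> e \<in> {1, -1} \<and> f \<in> {1, -1}}"

lemma chart_comb:
  assumes "x + y + z = 1"
  shows "x *\<^sub>R chart i j e f a a' + y *\<^sub>R chart i j e f b b' + z *\<^sub>R chart i j e f c c' =
    chart i j e f (x * a + y * b + z * c) (x * a' + y * b' + z * c')"
proof -
  have "x * k + y * k + z * k = k" for k :: real
    using assms by (simp add: distrib_right[symmetric])
  from this[of "2 * of_int i"] this[of "6 * of_int j"] show ?thesis
    by (simp add: chart_def plane_pt_scale plane_pt_add algebra_simps)
qed

lemma chart_segment: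
  assumes "0 \<le> u" "u \<le> 1"
  shows "chart i j e f ((1 - u) * a + u * b) ((1 - u) * a' + u * b') \<in> closed_segment (chart i j e f a a') (chart i j e f b b')"
proof -
  have "chart i j e f ((1 - u) * a + u * b) ((1 - u) * a' + u * b') =
    (1 - u) *\<^sub>R chart i j e f a a' + u *\<^sub>R chart i j e f b b'"
    by (simp add: chart_def plane_pt_scale plane_pt_add algebra_simps)
  with assms show ?thesis unfolding closed_segment_def by blast
qed

lemma not_multiple:
  fixes x c :: real
  assumes "x = c * of_int m" "\<bar>x\<bar> < c" "x \<noteq> 0"
  shows False
proof -
  have c: "c > 0" using assms(2) by linarith
  have "c * \<bar>of_int m\<bar> < c * 1" using assms(1,2) c by (simp add: abs_mult)
  then have "\<bar>of_int m :: real\<bar> < 1" using c by simp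
  then have "m = 0" by linarith
  with assms show False by simp
qed

text \<open>Here each of the six linear forms is nonzero and smaller in absolute value than the
  spacing of its mirrors. The signs \<open>e\<close>, \<open>f\<close> only permute the forms up to
  sign, and the values at the lattice point are multiples of the spacings because
  \<open>i + j\<close> is even.\<close>

lemma chart_not_mirror:
  assumes fr: "(i, j, e, f) \<in> frames" and xy: "0 < x" "x < 2" "0 < y" "y < 4" "x \<noteq> y" "3 * x \<noteq> y" "x + y < 4"
  shows "chart i j e f x y \<notin> G2"
proof
  assume "chart i j e f x y \<in> G2"
  then have "mirror (2 * of_int i + of_int e * x) (6 * of_int j + of_int f * y)"
    unfolding chart_def by (rule G2_mirror)
  moreover have "even (i - j)" using fr by (auto simp: frames_def)
  then obtain k where "i - j = 2 * k" by blast
  then have i: "i = 2 * k + j" by simp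
  define X Y where "X = of_int e * x" and "Y = of_int f * y"
  have X: "X = x \<or> X = - x" and Y: "Y = y \<or> Y = - y" using fr by (auto simp: frames_def X_def Y_def)
  ultimately consider n :: int where "X = 2 * of_int (n - i)" | n :: int where "Y = 6 * of_int (n - j)"
    | n :: int where "3 * X - Y = 12 * of_int (n - k)" | n :: int where "3 * X + Y = 12 * of_int (n - k - j)"
    | n :: int where "X + Y = 4 * of_int (n - k - 2 * j)" | n :: int where "X - Y = 4 * of_int (n - k + j)"
    unfolding mirror_def X_def[symmetric] Y_def[symmetric]
    by (elim disjE Ints_cases) (auto simp: i field_simps)
  then show False
  proof cases
    case 1 then show ?thesis by (rule not_multiple) (use X xy in auto)
  next
    case 2 then show ?thesis by (rule not_multiple) (use Y xy in auto)
  next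
    case 3 then show ?thesis by (rule not_multiple) (use X Y xy in auto)
  next
    case 4 then show ?thesis by (rule not_multiple) (use X Y xy in auto)
  next
    case 5 then show ?thesis by (rule not_multiple) (use X Y xy in auto)
  next
    case 6 then show ?thesis by (rule not_multiple) (use X Y xy in auto)
  qed
qed


lemma edge_subset_G2: "A \<in> Lam \<Longrightarrow> B \<in> Lam \<Longrightarrow> dist A B = 1 \<Longrightarrow> closed_segment A B \<subseteq> G2"
  unfolding G2_def by blast

lemma altitude_subset_G2:
  assumes "unit_triangle A B C" "F \<in> closed_segment B C" "orthogonal (A - F) (B - C)"
  shows "closed_segment A F \<subseteq> G2"
  using assms unfolding G2_def altitude_def by blast

text \<open>Every side is half of a unit edge or part of an altitude in one of two adjacent unit
  triangles. The ratio 1/2 gives the midpoint of an edge, and 2/3 gives the centroid on an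
  altitude.\<close>

lemma alcove_edges_subset_G2:
  assumes fr: "(i, j, e, f) \<in> frames"
  defines "Q \<equiv> chart i j e f"
  shows "closed_segment (Q 0 0) (Q 2 0) \<subseteq> G2" "closed_segment (Q 0 0) (Q 2 2) \<subseteq> G2" "closed_segment (Q 2 0) (Q 2 2) \<subseteq> G2"
    "closed_segment (Q 0 0) (Q 1 3) \<subseteq> G2" "closed_segment (Q 1 3) (Q 2 2) \<subseteq> G2"
    "closed_segment (Q 0 0) (Q 0 4) \<subseteq> G2" "closed_segment (Q 1 3) (Q 0 4) \<subseteq> G2"
proof -
  have ef: "real_of_int e * real_of_int e = 1" "real_of_int f * real_of_int f = 1"
    using fr by (auto simp: frames_def)
  have inner_Q: "(Q a a' - Q b b') \<bullet> (Q c c' - Q d d') = (3 * (a - b) * (c - d) + (a' - b') * (c' - d')) / 48" for a a' b b' c c' d d'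
  proof -
    have "(Q a a' - Q b b') \<bullet> (Q c c' - Q d d') =
      (3 * (real_of_int e * real_of_int e) * (a - b) * (c - d) + (real_of_int f * real_of_int f) * (a' - b') * (c' - d')) / 48"
      by (simp add: Q_def chart_def plane_pt_diff inner_plane_pt algebra_simps)
    then show ?thesis by (simp add: ef)
  qed
  have orth: "orthogonal (Q a a' - Q b b') (Q c c' - Q d d') \<longleftrightarrow> 3 * (a - b) * (c - d) + (a' - b') * (c' - d') = 0" for a a' b b' c c' d d'
    by (simp add: orthogonal_def inner_Q)
  have dist: "dist (Q a a') (Q b b') = 1 \<longleftrightarrow> 3 * (a - b) * (a - b) + (a' - b') * (a' - b') = 48" for a a' b b'
    unfolding dist_norm norm_eq_1 inner_Q by simp
  have lam: "Q 0 0 \<in> Lam" "Q 4 0 \<in> Lam" "Q 2 6 \<in> Lam" "Q (- 2) 6 \<in> Lam"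
  proof -
    have ev: "even (i + j)" "even (i + 2 * e + j)" "even (i + e + (j + f))" "even (i - e + (j + f))"
      using fr by (auto simp: frames_def)
    show "Q 0 0 \<in> Lam" "Q 4 0 \<in> Lam" "Q 2 6 \<in> Lam" "Q (- 2) 6 \<in> Lam"
      using plane_pt_in_Lam[OF ev(1)] plane_pt_in_Lam[OF ev(2)] plane_pt_in_Lam[OF ev(3)] plane_pt_in_Lam[OF ev(4)]
      by (simp_all add: Q_def chart_def algebra_simps)
  qed
  have seg: "Q c c' \<in> closed_segment (Q a a') (Q b b')"
    if "0 \<le> u" "u \<le> 1" "c = (1 - u) * a + u * b" "c' = (1 - u) * a' + u * b'" for a a' b b' c c' u
    unfolding Q_def that(3,4) by (rule chart_segment[OF that(1,2)])
  have sub: "closed_segment A B \<subseteq> G2" if "closed_segment A C \<subseteq> G2" "B \<in> closed_segment A C" for A B C :: point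
    using that by (meson ends_in_segment(1) order_trans subset_closed_segment)
  have sub': "closed_segment B C \<subseteq> G2" if "closed_segment A C \<subseteq> G2" "B \<in> closed_segment A C" for A B C :: point
    using that by (meson ends_in_segment(2) order_trans subset_closed_segment)
  have T1: "unit_triangle (Q 0 0) (Q 4 0) (Q 2 6)" and T2: "unit_triangle (Q 2 6) (Q 0 0) (Q 4 0)"
    and T3: "unit_triangle (Q 4 0) (Q 0 0) (Q 2 6)" and T4: "unit_triangle (Q 0 0) (Q 2 6) (Q (- 2) 6)"
    and T5: "unit_triangle (Q (- 2) 6) (Q 0 0) (Q 2 6)"
    using lam by (simp_all add: unit_triangle_def dist)
  show "closed_segment (Q 0 0) (Q 2 0) \<subseteq> G2"
    by (rule sub[of _ "Q 4 0"], rule edge_subset_G2) (use lam in \<open>auto simp: dist intro: seg[of "1/2"]\<close>)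
  show "closed_segment (Q 0 0) (Q 1 3) \<subseteq> G2"
    by (rule sub[of _ "Q 2 6"], rule edge_subset_G2) (use lam in \<open>auto simp: dist intro: seg[of "1/2"]\<close>)
  show "closed_segment (Q 0 0) (Q 2 2) \<subseteq> G2"
    by (rule sub[of _ "Q 3 3"], rule altitude_subset_G2[OF T1])
      (auto simp: orth intro: seg[of "1/2"] seg[of "2/3"])
  show "closed_segment (Q 2 0) (Q 2 2) \<subseteq> G2"
    by (subst closed_segment_commute, rule sub'[of "Q 2 6"], rule altitude_subset_G2[OF T2])
      (auto simp: orth intro: seg[of "1/2"] seg[of "2/3"])
  show "closed_segment (Q 1 3) (Q 2 2) \<subseteq> G2"
    by (subst closed_segment_commute, rule sub'[of "Q 4 0"], rule altitude_subset_G2[OF T3])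
      (auto simp: orth intro: seg[of "1/2"] seg[of "2/3"])
  show "closed_segment (Q 0 0) (Q 0 4) \<subseteq> G2"
    by (rule sub[of _ "Q 0 6"], rule altitude_subset_G2[OF T4])
      (auto simp: orth intro: seg[of "1/2"] seg[of "2/3"])
  show "closed_segment (Q 1 3) (Q 0 4) \<subseteq> G2"
    by (subst closed_segment_commute, rule sub'[of "Q (- 2) 6"], rule altitude_subset_G2[OF T5])
      (auto simp: orth intro: seg[of "1/2"] seg[of "2/3"])
qed

lemma alcove_not_collinear:
  assumes fr: "(i, j, e, f) \<in> frames" and b: "((m, m'), (c, c')) \<in> base"
  shows "\<not> collinear {chart i j e f 0 0, chart i j e f m m', chart i j e f c c'}"
proof
  have ef: "real_of_int e \<noteq> 0" "real_of_int f \<noteq> 0"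
    using fr by (auto simp: frames_def)
  assume "collinear {chart i j e f 0 0, chart i j e f m m', chart i j e f c c'}"
  moreover have "chart i j e f 0 0 \<noteq> chart i j e f c c'"
    using b ef by (auto simp: base_def chart_def)
  ultimately obtain u where "chart i j e f m m' = u *\<^sub>R chart i j e f 0 0 + (1 - u) *\<^sub>R chart i j e f c c'"
    unfolding collinear_3_expand by blast
  also have "\<dots> = chart i j e f ((1 - u) * c) ((1 - u) * c')"
    using chart_comb[of u "1 - u" 0 i j e f 0 0 c c' 0 0] by simp
  finally have "m = (1 - u) * c" "m' = (1 - u) * c'"
    using ef by (auto simp: chart_def)
  then show False using b by (auto simp: base_def)
qed

lemma interior_alcove_disjoint_G2:
  assumes fr: "(i, j, e, f) \<in> frames" and b: "B \<in> base"
  shows "interior (alcove i j e f B) \<inter> G2 = {}" "interior (alcove i j e f B) \<noteq> {}"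
proof -
  obtain m m' c c' where B: "B = ((m, m'), (c, c'))" by (metis prod.exhaust)
  have int: "interior (alcove i j e f B) = {chart i j e f (y * m + z * c) (y * m' + z * c') | x y z. 0 < x \<and> 0 < y \<and> 0 < z \<and> x + y + z = 1}"
    unfolding alcove_def B prod.case
  proof (subst interior_convex_hull_3_minimal[OF alcove_not_collinear[OF fr b[unfolded B]]])
    have comb: "x *\<^sub>R chart i j e f 0 0 + y *\<^sub>R chart i j e f m m' + z *\<^sub>R chart i j e f c c' =
      chart i j e f (y * m + z * c) (y * m' + z * c')" if "x + y + z = 1" for x y z
      using chart_comb[OF that, of i j e f 0 0 m m' c c'] by simp
    show "{v. \<exists>x y z. 0 < x \<and> 0 < y \<and> 0 < z \<and> x + y + z = 1 \<and>
        x *\<^sub>R chart i j e f 0 0 + y *\<^sub>R chart i j e f m m' + z *\<^sub>R chart i j e f c c' = v} =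
      {chart i j e f (y * m + z * c) (y * m' + z * c') | x y z. 0 < x \<and> 0 < y \<and> 0 < z \<and> x + y + z = 1}"
      by (rule Collect_cong) (metis comb)
  qed simp
  have "chart i j e f (y * m + z * c) (y * m' + z * c') \<notin> G2" if "0 < x" "0 < y" "0 < z" "x + y + z = 1" for x y z
    by (rule chart_not_mirror[OF fr]) (use that b in \<open>auto simp: B base_def\<close>)
  then show "interior (alcove i j e f B) \<inter> G2 = {}" unfolding int by blast
  have "chart i j e f (1 / 3 * m + 1 / 3 * c) (1 / 3 * m' + 1 / 3 * c') \<in> interior (alcove i j e f B)"
    unfolding int mem_Collect_eq by (rule exI[of _ "1 / 3"], rule exI[of _ "1 / 3"], rule exI[of _ "1 / 3"]) simp
  then show "interior (alcove i j e f B) \<noteq> {}" by blast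
qed

lemma frontier_alcove_subset_G2:
  assumes fr: "(i, j, e, f) \<in> frames" and b: "B \<in> base"
  shows "frontier (alcove i j e f B) \<subseteq> G2"
proof -
  have dim: "DIM(point) = 2" by simp
  have com: "closed_segment (chart i j e f c c') (chart i j e f 0 0) = closed_segment (chart i j e f 0 0) (chart i j e f c c')" for c c'
    by (rule closed_segment_commute)
  from b consider "B = ((2, 0), (2, 2))" | "B = ((1, 3), (2, 2))" | "B = ((1, 3), (0, 4))"
    by (auto simp: base_def)
  then show ?thesis
    by cases (simp_all only: alcove_def prod.case frontier_of_triangle[OF dim] com Un_subset_iff alcove_edges_subset_G2[OF fr] simp_thms)
qed

text \<open>A grid rectangle has lattice points at two opposite corners. The line
  \<open>x + y = 4\<close>, measured from one of them, cuts it into two halves exchanged by a half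
  turn, each consisting of the three alcoves of a frame.\<close>

lemma alcoves_cover: "\<exists>i j e f B. (i, j, e, f) \<in> frames \<and> B \<in> base \<and> q \<in> alcove i j e f B"
proof -
  obtain s t where q: "q = plane_pt s t" using plane_pt_surj by blast
  have in_alcove: "\<exists>B\<in>base. chart i j e f x y \<in> alcove i j e f B" if xy: "0 \<le> x" "x \<le> 2" "0 \<le> y" "x + y \<le> 4" for i j e f x y
  proof -
    have hull: "chart i j e f x y \<in> alcove i j e f ((m, m'), (c, c'))"
      if "0 \<le> u" "0 \<le> v" "u + v \<le> 1" "x = u * m + v * c" "y = u * m' + v * c'" for u v m m' c c'
    proof -
      have "chart i j e f x y = (1 - u - v) *\<^sub>R chart i j e f 0 0 + u *\<^sub>R chart i j e f m m' + v *\<^sub>R chart i j e f c c'"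
        by (subst chart_comb) (use that in auto)
      then show ?thesis
        unfolding alcove_def prod.case convex_hull_3 mem_Collect_eq using that(1-3)
        by (intro exI[of _ "1 - u - v"] exI[of _ u] exI[of _ v]) simp
    qed
    \<comment> \<open>The rays at 30 and 60 degrees are \<open>y = x\<close> and
      \<open>y = 3 * x\<close>. The arguments given to \<open>hull\<close> are barycentric
      coordinates in the resulting sector.\<close>
    consider "y \<le> x" | "x \<le> y" "y \<le> 3 * x" | "3 * x \<le> y" by linarith
    then show ?thesis
    proof cases
      case 1
      have "chart i j e f x y \<in> alcove i j e f ((2, 0), (2, 2))"
        by (rule hull[of "(x - y) / 2" "y / 2"]) (use 1 xy in \<open>auto simp: field_simps\<close>)
      then show ?thesis by (auto simp: base_def)
    next
      case 2
      have "chart i j e f x y \<in> alcove i j e f ((1, 3), (2, 2))"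
        by (rule hull[of "(y - x) / 2" "(3 * x - y) / 4"]) (use 2 xy in \<open>auto simp: field_simps\<close>)
      then show ?thesis by (auto simp: base_def)
    next
      case 3
      have "chart i j e f x y \<in> alcove i j e f ((1, 3), (0, 4))"
        by (rule hull[of x "(y - 3 * x) / 4"]) (use 3 xy in \<open>auto simp: field_simps\<close>)
      then show ?thesis by (auto simp: base_def)
    qed
  qed
  define i j where "i = \<lfloor>s / 2\<rfloor>" and "j = \<lfloor>t / 6\<rfloor>"
  define x y where "x = s - 2 * of_int i" and "y = t - 6 * of_int j"
  have xy: "0 \<le> x" "x \<le> 2" "0 \<le> y" "y \<le> 6"
    unfolding x_def y_def i_def j_def by linarith+
  have "\<exists>i' j' e f x' y'. (i', j', e, f) \<in> frames \<and> q = chart i' j' e f x' y' \<and> 0 \<le> x' \<and> x' \<le> 2 \<and> 0 \<le> y' \<and> x' + y' \<le> 4"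
  proof (cases "even (i + j)")
    case True
    show ?thesis
    proof (cases "x + y \<le> 4")
      case le: True
      have "(i, j, 1, 1) \<in> frames" "q = chart i j 1 1 x y" using True by (auto simp: frames_def q chart_def x_def y_def)
      with xy le show ?thesis by blast
    next
      case False
      have "(i + 1, j + 1, -1, -1) \<in> frames" "q = chart (i + 1) (j + 1) (-1) (-1) (2 - x) (6 - y)"
        using True by (auto simp: frames_def q chart_def x_def y_def)
      moreover have "0 \<le> 2 - x" "2 - x \<le> 2" "0 \<le> 6 - y" "2 - x + (6 - y) \<le> 4" using xy False by auto
      ultimately show ?thesis by blast
    qed
  next
    case odd: False
    show ?thesis
    proof (cases "2 - x + y \<le> 4")
      case True
      have "(i + 1, j, -1, 1) \<in> frames" "q = chart (i + 1) j (-1) 1 (2 - x) y"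
        using odd by (auto simp: frames_def q chart_def x_def y_def)
      moreover have "0 \<le> 2 - x" "2 - x \<le> 2" using xy by auto
      ultimately show ?thesis using xy True by blast
    next
      case False
      have "(i, j + 1, 1, -1) \<in> frames" "q = chart i (j + 1) 1 (-1) x (6 - y)"
        using odd by (auto simp: frames_def q chart_def x_def y_def)
      moreover have "0 \<le> 6 - y" "x + (6 - y) \<le> 4" using xy False by auto
      ultimately show ?thesis using xy by blast
    qed
  qed
  then show ?thesis using in_alcove by blast
qed

text \<open>A component cannot cross the frontier of an alcove it meets, since that frontier belongs
  to the drawing; so it lies in the interior. The interior is connected and avoids the drawing,
  hence it is the whole component.\<close>

lemma elementary_region_iff:
  "elementary_region R \<longleftrightarrow> (\<exists>i j e f B. (i, j, e, f) \<in> frames \<and> B \<in> base \<and> R = alcove i j e f B)"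
proof -
  have comp: "K = interior (alcove i j e f B)"
    if fr: "(i, j, e, f) \<in> frames" and b: "B \<in> base" and K: "K \<in> components (- G2)" and meet: "K \<inter> alcove i j e f B \<noteq> {}" for i j e f B K
  proof
    let ?S = "alcove i j e f B"
    have S: "convex ?S" "closed ?S" unfolding alcove_def by (auto simp: case_prod_unfold compact_imp_closed finite_imp_compact_convex_hull)
    have KG: "K \<inter> frontier ?S = {}"
      using frontier_alcove_subset_G2[OF fr b] in_components_subset[OF K] by blast
    then have "K \<subseteq> ?S"
      using connected_Int_frontier[OF in_components_connected[OF K] meet] by blast
    with KG show sub: "K \<subseteq> interior ?S"
      using S(2) by (auto simp: frontier_def)
    have "interior ?S \<subseteq> - G2" using interior_alcove_disjoint_G2(1)[OF fr b] by blast
    moreover have "K \<inter> interior ?S \<noteq> {}" using sub in_components_nonempty[OF K] by blast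
    ultimately show "interior ?S \<subseteq> K"
      using components_maximal[OF K convex_connected[OF convex_interior[OF S(1)]]] by blast
  qed
  have closure: "closure (interior (alcove i j e f B)) = alcove i j e f B" if "(i, j, e, f) \<in> frames" "B \<in> base" for i j e f B
  proof -
    have S: "convex (alcove i j e f B)" "closed (alcove i j e f B)"
      unfolding alcove_def by (auto simp: case_prod_unfold compact_imp_closed finite_imp_compact_convex_hull)
    show ?thesis
      using convex_closure_interior[OF S(1) interior_alcove_disjoint_G2(2)[OF that]] S(2) by simp
  qed
  show ?thesis
  proof
    assume "elementary_region R"
    then obtain K where K: "K \<in> components (- G2)" "R = closure K" by (auto simp: elementary_region_def)
    then obtain q where "q \<in> K" using in_components_nonempty by blast
    obtain i j e f B where fr: "(i, j, e, f) \<in> frames" "B \<in> base" and qB: "q \<in> alcove i j e f B"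
      using alcoves_cover by blast
    have "K = interior (alcove i j e f B)" by (rule comp[OF fr K(1)]) (use \<open>q \<in> K\<close> qB in blast)
    then have "R = alcove i j e f B" using closure[OF fr] K(2) by simp
    with fr show "\<exists>i j e f B. (i, j, e, f) \<in> frames \<and> B \<in> base \<and> R = alcove i j e f B" by blast
  next
    assume "\<exists>i j e f B. (i, j, e, f) \<in> frames \<and> B \<in> base \<and> R = alcove i j e f B"
    then obtain i j e f B where fr: "(i, j, e, f) \<in> frames" "B \<in> base" and R: "R = alcove i j e f B" by blast
    obtain q where q: "q \<in> interior R" using interior_alcove_disjoint_G2(2)[OF fr] R by blast
    then have "q \<in> - G2" using interior_alcove_disjoint_G2(1)[OF fr] R by blast
    then obtain K where K: "K \<in> components (- G2)" "q \<in> K" using Union_components by blast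
    then have "K = interior R" using comp[OF fr K(1)] q interior_subset R by blast
    then show "elementary_region R" using K(1) closure[OF fr] R by (auto simp: elementary_region_def)
  qed
qed

section \<open>Regions sharing an edge\<close>

definition corner_coord :: "int \<Rightarrow> int" where "corner_coord x = 2 * ((x + 1) div 2)"
definition block_coord :: "int \<Rightarrow> int" where "block_coord x = 2 * (x div 2) + 1"

lemma corner_block_coord: "even (corner_coord x)" "odd (block_coord x)" "corner_coord x \<noteq> block_coord x'" "block_coord x' \<noteq> corner_coord x"
    "corner_coord x = block_coord x + 1 \<or> corner_coord x = block_coord x - 1"
proof -
  show e: "even (corner_coord x)" "odd (block_coord x)" by (simp_all add: corner_coord_def block_coord_def)
  have "odd (block_coord x')" by (simp add: block_coord_def)
  with e show "corner_coord x \<noteq> block_coord x'" "block_coord x' \<noteq> corner_coord x" by metis+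
  show "corner_coord x = block_coord x + 1 \<or> corner_coord x = block_coord x - 1" unfolding corner_coord_def block_coord_def by presburger
qed

lemma corner_coord_flip: "corner_coord (flip x) = 2 * block_coord x - corner_coord x" and block_coord_flip: "block_coord (flip x) = block_coord x"
  and corner_coord_across: "corner_coord (across x) = corner_coord x" and block_coord_across: "block_coord (across x) = 2 * corner_coord x - block_coord x"
  unfolding corner_coord_def block_coord_def flip_def across_def by (cases "even x"; auto elim!: evenE oddE)+

text \<open>A position is the smaller of its corner and its block coordinate, so the two together
  determine it.\<close>

lemma coordinate_eqI:
  assumes "corner_coord x' = corner_coord x" "block_coord x' = block_coord x"
  shows "x' = x"
proof -
  have "z = min (block_coord z) (corner_coord z)" for z unfolding corner_coord_def block_coord_def by (cases "even z") (auto elim!: evenE oddE)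
  then show ?thesis using assms by metis
qed

lemma coordinate_flipI:
  assumes "block_coord x' = block_coord x" "corner_coord x' \<noteq> corner_coord x"
  shows "x' = flip x"
proof (rule coordinate_eqI)
  show "corner_coord x' = corner_coord (flip x)"
    unfolding corner_coord_flip using corner_block_coord(5)[of x] corner_block_coord(5)[of x'] assms by (elim disjE) simp_all
qed (simp add: block_coord_flip assms)

lemma coordinate_acrossI:
  assumes "corner_coord x' = corner_coord x" "block_coord x' \<noteq> block_coord x"
  shows "x' = across x"
proof (rule coordinate_eqI)
  show "block_coord x' = block_coord (across x)"
    unfolding block_coord_across using corner_block_coord(5)[of x] corner_block_coord(5)[of x'] assms by (elim disjE) simp_all
qed (simp add: corner_coord_across assms)

abbreviation mid0 :: "int \<Rightarrow> int \<Rightarrow> bool" where "mid0 \<equiv> is_mid 0"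

text \<open>A region has one lattice point (angle 30 degrees), one midpoint of a unit edge (right
  angle) and one centre of a unit triangle (60 degrees), given by this function and the next two.
  For a region at a midpoint the lattice point is the horizontally neighbouring corner of the
  rectangle.\<close>

fun lattice_pt :: "vert \<Rightarrow> int \<times> int" where
  "lattice_pt (x, y, b) = (if mid0 x y then 2 * block_coord x - corner_coord x else corner_coord x, 3 * corner_coord y)"

fun edge_pt :: "vert \<Rightarrow> int \<times> int" where
  "edge_pt (x, y, b) = (if mid0 x y then (corner_coord x, 3 * corner_coord y) else (block_coord x, 3 * block_coord y))"

fun centre_pt :: "vert \<Rightarrow> int \<times> int" where
  "centre_pt (x, y, b) = (if mid0 x y then (corner_coord x, corner_coord y + 2 * block_coord y)
     else if b then (2 * block_coord x - corner_coord x, corner_coord y + 2 * block_coord y) else (corner_coord x, 4 * block_coord y - corner_coord y))"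

definition int_pt :: "int \<times> int \<Rightarrow> point" where "int_pt = (\<lambda>(s, t). plane_pt (of_int s) (of_int t))"

definition triple :: "vert \<Rightarrow> point set" where
  "triple v = {int_pt (lattice_pt v), int_pt (edge_pt v), int_pt (centre_pt v)}"

definition region :: "vert \<Rightarrow> point set" where "region v = convex hull (triple v)"

definition regular :: "vert \<Rightarrow> bool" where "regular = (\<lambda>(x, y, b). b \<longrightarrow> \<not> mid0 x y)"

lemma int_pt_eq_iff [simp]: "int_pt a = int_pt b \<longleftrightarrow> a = b"
  by (cases a; cases b) (simp add: int_pt_def)

definition side :: "int \<Rightarrow> int" where "side x = (if even x then 1 else -1)"

lemma block_coord_side: "block_coord x = corner_coord x + side x"
  unfolding block_coord_def corner_coord_def side_def by presburger

text \<open>Frames are based at lattice points, so a region at a midpoint is described from the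
  neighbouring corner, with shifted origin and reversed horizontal direction.\<close>

lemma triple_chart:
  "triple (x, y, b) = (if mid0 x y then
      let Q = chart ((x + 1) div 2 + side x) ((y + 1) div 2) (- side x) (side y) in {Q 0 0, Q 2 0, Q 2 2}
    else let Q = chart ((x + 1) div 2) ((y + 1) div 2) (side x) (side y) in
      if b then {Q 0 0, Q 1 3, Q 2 2} else {Q 0 0, Q 1 3, Q 0 4})"
proof -
  define I J where "I = (x + 1) div 2" and "J = (y + 1) div 2"
  have c: "corner_coord x = 2 * I" "corner_coord y = 2 * J" "block_coord x = 2 * I + side x" "block_coord y = 2 * J + side y"
    by (simp_all add: block_coord_side, simp_all add: corner_coord_def I_def J_def)
  have "int_pt (2 * block_coord x - corner_coord x, 3 * corner_coord y) = chart (I + side x) J (- side x) (side y) 0 0"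
    "int_pt (corner_coord x, 3 * corner_coord y) = chart (I + side x) J (- side x) (side y) 2 0"
    "int_pt (corner_coord x, corner_coord y + 2 * block_coord y) = chart (I + side x) J (- side x) (side y) 2 2"
    "int_pt (corner_coord x, 3 * corner_coord y) = chart I J (side x) (side y) 0 0" "int_pt (block_coord x, 3 * block_coord y) = chart I J (side x) (side y) 1 3"
    "int_pt (2 * block_coord x - corner_coord x, corner_coord y + 2 * block_coord y) = chart I J (side x) (side y) 2 2"
    "int_pt (corner_coord x, 4 * block_coord y - corner_coord y) = chart I J (side x) (side y) 0 4"
    by (simp_all add: int_pt_def chart_def c)
  note pts = this
  show ?thesis
  proof (cases "mid0 x y")
    case True
    then show ?thesis
      unfolding I_def[symmetric] J_def[symmetric] triple_def Let_def lattice_pt.simps edge_pt.simps centre_pt.simps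
      by (simp only: if_True pts(1-3))
  next
    case False
    then show ?thesis
      unfolding I_def[symmetric] J_def[symmetric] triple_def Let_def lattice_pt.simps edge_pt.simps centre_pt.simps
      by (cases b) (simp_all only: if_True if_False pts(4-7))
  qed
qed

lemma region_eq_alcove:
  "region (x, y, b) = (if mid0 x y then alcove ((x + 1) div 2 + side x) ((y + 1) div 2) (- side x) (side y) ((2, 0), (2, 2))
    else alcove ((x + 1) div 2) ((y + 1) div 2) (side x) (side y) (if b then ((1, 3), (2, 2)) else ((1, 3), (0, 4))))"
  by (simp add: region_def triple_chart alcove_def Let_def)

lemma frames_of_vert:
  assumes "regular (x, y, b)"
  shows "mid0 x y \<Longrightarrow> ((x + 1) div 2 + side x, (y + 1) div 2, - side x, side y) \<in> frames"
    "\<not> mid0 x y \<Longrightarrow> ((x + 1) div 2, (y + 1) div 2, side x, side y) \<in> frames"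
  by (auto simp: frames_def is_mid_def side_def)

lemma elementary_region_eq: "elementary_region R \<longleftrightarrow> (\<exists>v. regular v \<and> R = region v)"
proof
  assume "\<exists>v. regular v \<and> R = region v"
  then obtain v where v: "regular v" "R = region v" by blast
  obtain x y b where xy: "v = (x, y, b)" using prod_cases3 by blast
  have "((2, 0), (2, 2)) \<in> base" "((1, 3), (2, 2)) \<in> base" "((1, 3), (0, 4)) \<in> base" by (simp_all add: base_def)
  then show "elementary_region R"
    unfolding elementary_region_iff v(2) xy region_eq_alcove
    using frames_of_vert[OF v(1)[unfolded xy]] by (cases "mid0 x y"; cases b; simp; blast)
next
  assume "elementary_region R"
  then obtain i j e f B where fr: "(i, j, e, f) \<in> frames" and B: "B \<in> base" and R: "R = alcove i j e f B"
    unfolding elementary_region_iff by blast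
  have ij: "even (i + j)" and ef: "e = 1 \<or> e = -1" "f = 1 \<or> f = -1" using fr by (auto simp: frames_def)
  define co where "co k s = (if s = 1 then 2 * k else 2 * k - 1)" for k s :: int
  have co: "(co k s + 1) div 2 = k" "side (co k s) = s" if "s = 1 \<or> s = -1" for k s
    using that by (auto simp: co_def side_def)
  have me: "- e = 1 \<or> - e = -1" using ef by auto
  from B consider "B = ((2, 0), (2, 2))" | "B = ((1, 3), (2, 2))" | "B = ((1, 3), (0, 4))"
    by (auto simp: base_def)
  then show "\<exists>v. regular v \<and> R = region v"
  proof cases
    case 1
    have m: "mid0 (co (i + e) (- e)) (co j f)" using ij ef by (auto simp: is_mid_def co[OF me] co[OF ef(2)])
    then have "regular (co (i + e) (- e), co j f, False)" by (simp add: regular_def)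
    from m have "region (co (i + e) (- e), co j f, False) = R"
      by (simp add: region_eq_alcove R 1 co[OF me] co[OF ef(2)])
    with \<open>regular (co (i + e) (- e), co j f, False)\<close> show ?thesis by blast
  next
    case 2
    have m: "\<not> mid0 (co i e) (co j f)" using ij ef by (auto simp: is_mid_def co[OF ef(1)] co[OF ef(2)])
    then have r: "regular (co i e, co j f, True)" by (simp add: regular_def)
    from m have "region (co i e, co j f, True) = R"
      by (simp add: region_eq_alcove R 2 co[OF ef(1)] co[OF ef(2)])
    with r show ?thesis by blast
  next
    case 3
    have m: "\<not> mid0 (co i e) (co j f)" using ij ef by (auto simp: is_mid_def co[OF ef(1)] co[OF ef(2)])
    then have r: "regular (co i e, co j f, False)" by (simp add: regular_def)
    from m have "region (co i e, co j f, False) = R"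
      by (simp add: region_eq_alcove R 3 co[OF ef(1)] co[OF ef(2)])
    with r show ?thesis by blast
  qed
qed

lemma triple_independent:
  assumes "regular v"
  shows "\<not> affine_dependent (triple v)"
proof -
  obtain x y b where xy: "v = (x, y, b)" using prod_cases3 by blast
  note fr = frames_of_vert[OF assms[unfolded xy]]
  have ind: "\<not> affine_dependent {chart i j e f 0 0, chart i j e f m m', chart i j e f c c'}"
    if "(i, j, e, f) \<in> frames" "((m, m'), (c, c')) \<in> base" for i j e f m m' c c'
    using alcove_not_collinear[OF that] unfolding collinear_3_eq_affine_dependent by blast
  have "((2, 0), (2, 2)) \<in> base" "((1, 3), (2, 2)) \<in> base" "((1, 3), (0, 4)) \<in> base" by (simp_all add: base_def)
  note base = this
  show ?thesis
  proof (cases "mid0 x y")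
    case True
    show ?thesis using ind[OF fr(1)[OF True] base(1)] True by (simp add: xy triple_chart Let_def)
  next
    case False
    show ?thesis using ind[OF fr(2)[OF False] base(2)] ind[OF fr(2)[OF False] base(3)] False
      by (simp add: xy triple_chart Let_def)
  qed
qed

lemma lattice_pt_parity: "\<exists>k l. lattice_pt v = (2 * k, 6 * l) \<and> even (k + l)"
proof -
  obtain x y b where v: "v = (x, y, b)" using prod_cases3 by blast
  show ?thesis
  proof (cases "mid0 x y")
    case True
    have "lattice_pt v = (2 * ((x + 1) div 2 + side x), 6 * ((y + 1) div 2))"
      using True by (simp add: v block_coord_side) (simp add: corner_coord_def)
    moreover have "even ((x + 1) div 2 + side x + (y + 1) div 2)"
      using True by (auto simp: is_mid_def side_def)
    ultimately show ?thesis by blast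
  next
    case False
    then show ?thesis by (auto simp: v is_mid_def corner_coord_def)
  qed
qed

text \<open>Midpoints of slanted edges have an odd first coordinate, and midpoints of horizontal
  edges have the wrong parity of \<open>k + l\<close>.\<close>

lemma lattice_pt_neq: "lattice_pt u \<noteq> edge_pt v"
proof
  assume eq: "lattice_pt u = edge_pt v"
  obtain k l where kl: "lattice_pt u = (2 * k, 6 * l)" "even (k + l)" using lattice_pt_parity by blast
  obtain x y b where v: "v = (x, y, b)" using prod_cases3 by blast
  show False
  proof (cases "mid0 x y")
    case True
    then have "k = (x + 1) div 2" "l = (y + 1) div 2" using eq kl(1) by (simp_all add: v corner_coord_def)
    then show ?thesis using kl(2) True by (simp add: is_mid_def)
  next
    case False
    then have "block_coord x = 2 * k" using eq kl(1) by (simp add: v)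
    then show ?thesis using corner_block_coord(2)[of x] by simp
  qed
qed

text \<open>The centres are the vertices whose second coordinate is not divisible by 3.\<close>

lemma centre_pt_neq: "lattice_pt u \<noteq> centre_pt v" "edge_pt u \<noteq> centre_pt v"
proof -
  obtain x y b x' y' b' where uv: "u = (x, y, b)" "v = (x', y', b')" by (metis prod.exhaust)
  have d: "3 dvd snd (lattice_pt u)" "3 dvd snd (edge_pt u)" by (simp_all add: uv)
  have "\<not> 3 dvd snd (centre_pt v)"
    using corner_block_coord(5)[of y'] by (auto simp: uv) presburger+
  with d show "lattice_pt u \<noteq> centre_pt v" "edge_pt u \<noteq> centre_pt v" by auto
qed


text \<open>Vertices of different kinds never coincide, so triangles can share only vertices of the
  same kind.\<close>

lemma card_triple_Int:
  "(\<exists>c \<subseteq> triple u \<inter> triple v. card c = 2) \<longleftrightarrow>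
    lattice_pt u = lattice_pt v \<and> edge_pt u = edge_pt v \<or>
    lattice_pt u = lattice_pt v \<and> centre_pt u = centre_pt v \<or>
    edge_pt u = edge_pt v \<and> centre_pt u = centre_pt v" (is "?L \<longleftrightarrow> ?R")
proof
  assume ?R
  then show ?L
  proof (elim disjE conjE)
    assume e: "lattice_pt u = lattice_pt v" "edge_pt u = edge_pt v"
    then show ?L by (intro exI[of _ "{int_pt (lattice_pt u), int_pt (edge_pt u)}"]) (simp add: triple_def lattice_pt_neq)
  next
    assume e: "lattice_pt u = lattice_pt v" "centre_pt u = centre_pt v"
    then show ?L by (intro exI[of _ "{int_pt (lattice_pt u), int_pt (centre_pt u)}"]) (simp add: triple_def centre_pt_neq)
  next
    assume e: "edge_pt u = edge_pt v" "centre_pt u = centre_pt v"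
    then show ?L by (intro exI[of _ "{int_pt (edge_pt u), int_pt (centre_pt u)}"]) (simp add: triple_def centre_pt_neq)
  qed
next
  assume ?L
  then obtain c where c: "c \<subseteq> triple u \<inter> triple v" "card c = 2" by blast
  from c(2) obtain a b where "c = {a, b}" "a \<noteq> b" unfolding card_2_iff by blast
  with c(1) have ab: "a \<noteq> b" "a \<in> triple u" "b \<in> triple u" "a \<in> triple v" "b \<in> triple v"
    by blast+
  have "(a = int_pt (lattice_pt u) \<and> lattice_pt u = lattice_pt v) \<or> (a = int_pt (edge_pt u) \<and> edge_pt u = edge_pt v) \<or>
      (a = int_pt (centre_pt u) \<and> centre_pt u = centre_pt v)" if "a \<in> triple u" "a \<in> triple v" for a
    using that lattice_pt_neq[of u v] lattice_pt_neq[of v u] centre_pt_neq(1)[of u v] centre_pt_neq(1)[of v u]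
      centre_pt_neq(2)[of u v] centre_pt_neq(2)[of v u]
    unfolding triple_def by (elim insertE emptyE) simp_all
  from this[OF ab(2,4)] this[OF ab(3,5)] ab(1) show ?R by (elim disjE conjE) simp_all
qed

lemma triple_eq_imp:
  assumes "regular u" "regular v" "lattice_pt u = lattice_pt v" "edge_pt u = edge_pt v" "centre_pt u = centre_pt v"
  shows "u = v"
proof -
  obtain x y b x' y' b' where uv: "u = (x, y, b)" "v = (x', y', b')" by (metis prod.exhaust)
  have xy: "x' = x \<and> y' = y"
  proof (cases "mid0 x y"; cases "mid0 x' y'")
    assume m: "mid0 x y" "mid0 x' y'"
    then have "corner_coord x' = corner_coord x" "block_coord x' = block_coord x" "corner_coord y' = corner_coord y" "block_coord y' = block_coord y" using assms(3-5) by (simp_all add: uv)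
    then show ?thesis by (blast intro: coordinate_eqI)
  next
    assume m: "mid0 x y" "\<not> mid0 x' y'"
    then have "corner_coord x = block_coord x'" using assms(4) by (simp add: uv)
    with corner_block_coord(3) show ?thesis by blast
  next
    assume m: "\<not> mid0 x y" "mid0 x' y'"
    then have "corner_coord x' = block_coord x" using assms(4) by (simp add: uv)
    with corner_block_coord(3) show ?thesis by blast
  next
    assume m: "\<not> mid0 x y" "\<not> mid0 x' y'"
    then have "corner_coord x' = corner_coord x" "block_coord x' = block_coord x" "corner_coord y' = corner_coord y" "block_coord y' = block_coord y" using assms(3-4) by (simp_all add: uv)
    then show ?thesis by (blast intro: coordinate_eqI)
  qed
  have "b = b'"
  proof (cases "mid0 x y")
    case True
    then show ?thesis using assms(1,2) xy by (simp add: uv regular_def)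
  next
    case False
    then show ?thesis using assms(5) xy corner_block_coord(3)[of x x] by (cases b; cases b') (simp_all add: uv)
  qed
  with xy show ?thesis by (simp add: uv)
qed

definition region_adj :: "vert \<Rightarrow> vert \<Rightarrow> bool" where
  "region_adj u v \<longleftrightarrow> hex_adj u v \<or> mid_adj 0 u v \<or> bond_adj 0 u v"

lemma region_adj_imp:
  assumes "regular u" "regular v" "region_adj u v"
  shows "u \<noteq> v \<and> (lattice_pt u = lattice_pt v \<and> edge_pt u = edge_pt v \<or>
    lattice_pt u = lattice_pt v \<and> centre_pt u = centre_pt v \<or>
    edge_pt u = edge_pt v \<and> centre_pt u = centre_pt v)"
proof -
  obtain x y b x' y' b' where uv: "u = (x, y, b)" "v = (x', y', b')" by (metis prod.exhaust)
  show ?thesis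
    using assms unfolding region_adj_def uv
    by (elim disjE; auto simp: regular_def is_mid_flip is_mid_across corner_coord_flip block_coord_flip corner_coord_across block_coord_across)
qed

lemma region_adj_if_mid_lattice:
  assumes "regular (x, y, b)" "regular (x', y', b')" "mid0 x y" "\<not> mid0 x' y'"
    and agree: "lattice_pt (x, y, b) = lattice_pt (x', y', b') \<and> edge_pt (x, y, b) = edge_pt (x', y', b') \<or>
    lattice_pt (x, y, b) = lattice_pt (x', y', b') \<and> centre_pt (x, y, b) = centre_pt (x', y', b') \<or>
    edge_pt (x, y, b) = edge_pt (x', y', b') \<and> centre_pt (x, y, b) = centre_pt (x', y', b')"
  shows "hex_adj (x', y', b') (x, y, b)"
proof -
  have "edge_pt (x, y, b) \<noteq> edge_pt (x', y', b')" using assms(3,4) corner_block_coord(3)[of x x'] by simp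
  then have "lattice_pt (x, y, b) = lattice_pt (x', y', b') \<and> centre_pt (x, y, b) = centre_pt (x', y', b')"
    using agree by blast
  then have LO: "2 * block_coord x - corner_coord x = corner_coord x'" "corner_coord y = corner_coord y'" "centre_pt (x, y, b) = centre_pt (x', y', b')"
    using assms(3,4) by (simp, simp, blast)
  have b': b' using LO assms(3,4) corner_block_coord(3)[of x x] by (cases b') simp_all
  have "block_coord y' = block_coord y" "block_coord x' = block_coord x" using LO assms(3,4) b' by simp_all
  moreover have "corner_coord x \<noteq> corner_coord x'" using LO(1) corner_block_coord(3)[of x x] by linarith
  ultimately have "x = flip x'" "y = y'" using LO(2) by (auto intro: coordinate_flipI coordinate_eqI)
  moreover have "\<not> b" using assms(1,3) by (simp add: regular_def)
  ultimately show ?thesis using b' by simp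
qed

text \<open>Two agreeing vertices fix enough corner and block coordinates that the positions can
  differ only by \<open>flip\<close> or \<open>across\<close>, and the kind of the agreeing vertices
  tells which adjacency it is.\<close>

lemma region_adj_if:
  assumes "regular u" "regular v" "u \<noteq> v" and agree: "lattice_pt u = lattice_pt v \<and> edge_pt u = edge_pt v \<or>
    lattice_pt u = lattice_pt v \<and> centre_pt u = centre_pt v \<or>
    edge_pt u = edge_pt v \<and> centre_pt u = centre_pt v"
  shows "region_adj u v \<or> region_adj v u"
proof -
  obtain x y b x' y' b' where uv: "u = (x, y, b)" "v = (x', y', b')" by (metis prod.exhaust)
  show ?thesis
  proof (cases "mid0 x y"; cases "mid0 x' y'")
    assume m: "mid0 x y" "mid0 x' y'"
    then have b: "\<not> b" "\<not> b'" using assms(1,2) by (simp_all add: uv regular_def)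
    from agree m have c: "corner_coord x' = corner_coord x" "corner_coord y' = corner_coord y" and k: "block_coord x' = block_coord x \<or> block_coord y' = block_coord y"
      by (auto simp: uv)
    have "\<not> (block_coord x' = block_coord x \<and> block_coord y' = block_coord y)" using coordinate_eqI c b assms(3) by (auto simp: uv)
    then have "x' = x \<and> y' = across y \<or> x' = across x \<and> y' = y"
      using k c by (blast intro: coordinate_eqI coordinate_acrossI)
    then have "mid_adj 0 u v" using m b by (auto simp: uv)
    then show ?thesis by (simp add: region_adj_def)
  next
    assume "mid0 x y" "\<not> mid0 x' y'"
    from region_adj_if_mid_lattice[OF assms(1,2)[unfolded uv] this agree[unfolded uv]] show ?thesis
      by (simp add: region_adj_def uv)
  next
    assume m: "\<not> mid0 x y" "mid0 x' y'"
    have "lattice_pt v = lattice_pt u \<and> edge_pt v = edge_pt u \<or> lattice_pt v = lattice_pt u \<and> centre_pt v = centre_pt u \<or>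
      edge_pt v = edge_pt u \<and> centre_pt v = centre_pt u" using agree by metis
    from region_adj_if_mid_lattice[OF assms(2,1)[unfolded uv] m(2,1) this[unfolded uv]] show ?thesis
      by (simp add: region_adj_def uv)
  next
    assume m: "\<not> mid0 x y" "\<not> mid0 x' y'"
    from agree show ?thesis
    proof (elim disjE conjE)
      assume "lattice_pt u = lattice_pt v" "edge_pt u = edge_pt v"
      then have "x' = x" "y' = y" using m by (auto simp: uv intro: coordinate_eqI)
      then show ?thesis using assms(3) by (cases b; cases b') (simp_all add: uv region_adj_def)
    next
      assume e: "lattice_pt u = lattice_pt v" "centre_pt u = centre_pt v"
      then have c: "corner_coord x' = corner_coord x" "corner_coord y' = corner_coord y" using m by (simp_all add: uv)
      show ?thesis
      proof (cases "b = b'")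
        case True
        have "\<not> b"
        proof
          assume b
          then have "block_coord x' = block_coord x" "block_coord y' = block_coord y" using e(2) m c True by (simp_all add: uv)
          then have "x' = x" "y' = y" using c by (auto intro: coordinate_eqI)
          then show False using assms(3) True by (simp add: uv)
        qed
        then have "block_coord y' = block_coord y" using e(2) m c True by (simp add: uv)
        then have y: "y' = y" using c by (auto intro: coordinate_eqI)
        have "block_coord x' \<noteq> block_coord x" using assms(3) y True c coordinate_eqI by (auto simp: uv)
        then have "x' = across x" using c by (auto intro: coordinate_acrossI)
        then have "bond_adj 0 u v" using m y \<open>\<not> b\<close> True by (simp add: uv)
        then show ?thesis by (simp add: region_adj_def)
      next
        case False
        then have "block_coord x = corner_coord x \<or> block_coord x' = corner_coord x'" using e(2) m c by (cases b) (simp_all add: uv)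
        then show ?thesis using corner_block_coord(4) by blast
      qed
    next
      assume e: "edge_pt u = edge_pt v" "centre_pt u = centre_pt v"
      then have k: "block_coord x' = block_coord x" "block_coord y' = block_coord y" using m by (simp_all add: uv)
      show ?thesis
      proof (cases "b = b'")
        case True
        then have "corner_coord x' = corner_coord x" "corner_coord y' = corner_coord y" using e(2) m k by (cases b; simp add: uv)+
        then have "x' = x" "y' = y" using k by (auto intro: coordinate_eqI)
        then show ?thesis using assms(3) True by (simp add: uv)
      next
        case False
        then have "corner_coord x' = 2 * block_coord x - corner_coord x" "corner_coord y' = 2 * block_coord y - corner_coord y" using e(2) m k by (cases b; simp add: uv)+
        moreover from this have "corner_coord x' \<noteq> corner_coord x" "corner_coord y' \<noteq> corner_coord y" using corner_block_coord(3)[of x x] corner_block_coord(3)[of y y] by linarith+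
        ultimately have "x' = flip x" "y' = flip y" using k by (auto intro: coordinate_flipI)
        then show ?thesis using False by (cases b) (simp_all add: uv region_adj_def)
      qed
    qed
  qed
qed

lemma region_inj:
  assumes "regular u" "regular v"
  shows "region u = region v \<longleftrightarrow> u = v"
proof -
  have ext: "triple w = {x. x extreme_point_of region w}" if "regular w" for w
    using extreme_point_of_convex_hull_affine_independent[OF triple_independent[OF that]] by (auto simp: region_def)
  show ?thesis
  proof
    assume "region u = region v"
    then have t: "triple u = triple v" using ext assms by simp
    have "lattice_pt u = lattice_pt v" "edge_pt u = edge_pt v" "centre_pt u = centre_pt v"
    proof -
      have "int_pt (lattice_pt u) \<in> triple v" "int_pt (edge_pt u) \<in> triple v" "int_pt (centre_pt u) \<in> triple v"
        unfolding t[symmetric] by (simp_all add: triple_def)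
      then show "lattice_pt u = lattice_pt v" "edge_pt u = edge_pt v" "centre_pt u = centre_pt v"
        using lattice_pt_neq[of u v] lattice_pt_neq[of v u] centre_pt_neq[of u v] centre_pt_neq[of v u]
        by (auto simp: triple_def)
    qed
    then show "u = v" by (rule triple_eq_imp[OF assms])
  qed simp
qed

text \<open>The edges of a triangle are the hulls of two of its vertices, and extreme points recover
  these vertices from the edge. So sharing an edge means sharing two vertices.\<close>

lemma tile_region_iff:
  assumes "regular u" "regular v"
  shows "tile {region u, region v} \<longleftrightarrow> region_adj u v \<or> region_adj v u"
proof -
  note ind = triple_independent[OF assms(1)] triple_independent[OF assms(2)]
  have share: "(\<exists>e. e edge_of region u \<and> e edge_of region v) \<longleftrightarrow> (\<exists>c \<subseteq> triple u \<inter> triple v. card c = 2)"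
  proof
    assume "\<exists>e. e edge_of region u \<and> e edge_of region v"
    then obtain e where e: "e face_of convex hull triple u" "e face_of convex hull triple v" "aff_dim e = 1"
      by (auto simp: edge_of_def region_def)
    then obtain c d where cd: "c \<subseteq> triple u" "e = convex hull c" "d \<subseteq> triple v" "e = convex hull d"
      using face_of_convex_hull_affine_independent[OF ind(1)] face_of_convex_hull_affine_independent[OF ind(2)] by metis
    have ic: "\<not> affine_dependent c" and id: "\<not> affine_dependent d"
      using affine_independent_subset ind cd by blast+
    have "c = d"
      using extreme_point_of_convex_hull_affine_independent[OF ic] extreme_point_of_convex_hull_affine_independent[OF id] cd
      by auto
    moreover have "card c = 2"
      using aff_dim_affine_independent[OF ic] e(3) cd(2) by (simp add: aff_dim_convex_hull)
    ultimately show "\<exists>c \<subseteq> triple u \<inter> triple v. card c = 2" using cd by blast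
  next
    assume "\<exists>c \<subseteq> triple u \<inter> triple v. card c = 2"
    then obtain c where c: "c \<subseteq> triple u" "c \<subseteq> triple v" "card c = 2" by blast
    have ic: "\<not> affine_dependent c" using affine_independent_subset ind(1) c(1) by blast
    have "aff_dim (convex hull c) = 1" using aff_dim_affine_independent[OF ic] c(3) by (simp add: aff_dim_convex_hull)
    then have "convex hull c edge_of region u \<and> convex hull c edge_of region v"
      using face_of_convex_hull_affine_independent[OF ind(1)] face_of_convex_hull_affine_independent[OF ind(2)] c
      by (auto simp: edge_of_def region_def)
    then show "\<exists>e. e edge_of region u \<and> e edge_of region v" by blast
  qed
  have el: "elementary_region (region u)" "elementary_region (region v)" using assms elementary_region_eq by blast+
  have "tile {region u, region v} \<longleftrightarrow> u \<noteq> v \<and> (\<exists>e. e edge_of region u \<and> e edge_of region v)"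
    unfolding tile_def using el region_inj[OF assms] by (auto simp: doubleton_eq_iff)
  also have "\<dots> \<longleftrightarrow> region_adj u v \<or> region_adj v u"
    unfolding share card_triple_Int
    using region_adj_imp[OF assms] region_adj_imp[OF assms(2,1)] region_adj_if[OF assms] by metis
  finally show ?thesis .
qed

section \<open>Regions contained in a dungeon\<close>

text \<open>The parity of \<open>n\<close> becomes a parity of coordinates: lattice points have even
  \<open>i + j\<close>, midpoints of horizontal edges odd \<open>i + j\<close>.\<close>

lemma dungeon_center_grid:
  assumes "dungeon_center n p"
  obtains i j where "p = plane_pt (2 * of_int i) (6 * of_int j)" "even (i + j + int n)"
proof (cases "even n")
  case True
  then have "p \<in> Lam" using assms by (simp add: dungeon_center_def)
  then obtain a b :: int where "p = plane_pt (4 * of_int a + 2 * of_int b) (6 * of_int b)"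
    using plane_pt_surj plane_pt_in_Lam_iff by metis
  then show ?thesis using True by (intro that[of "2 * a + b" b]) auto
next
  case False
  then obtain A B where AB: "A \<in> Lam" "B \<in> Lam" "dist A B = 1" "snd A = snd B" "p = midpoint A B"
    using assms by (auto simp: dungeon_center_def)
  obtain a a' b b' where coords: "A = plane_pt a a'" "B = plane_pt b b'" using plane_pt_surj by metis
  have "a' = b'" using AB(4) by (simp add: coords plane_pt_def)
  then have ab: "\<bar>a - b\<bar> = 4" using Lam_unit_vector[OF AB(1-3)[unfolded coords]] by auto
  obtain k l :: int where kl: "a = 4 * of_int k + 2 * of_int l" "a' = 6 * of_int l"
    using AB(1) unfolding coords plane_pt_in_Lam_iff by blast
  have p: "p = plane_pt ((a + b) / 2) a'"
    unfolding AB(5) coords midpoint_def plane_pt_add plane_pt_scale using \<open>a' = b'\<close> by simp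
  from ab consider "b = a + 4" | "b = a - 4" by linarith
  then show ?thesis
  proof cases
    case 1
    have "p = plane_pt (2 * of_int (2 * k + l + 1)) (6 * of_int l)" unfolding p 1 kl by simp
    then show ?thesis using False by (intro that[of "2 * k + l + 1" l]) auto
  next
    case 2
    have "p = plane_pt (2 * of_int (2 * k + l - 1)) (6 * of_int l)" unfolding p 2 kl by simp
    then show ?thesis using False by (intro that[of "2 * k + l - 1" l]) auto
  qed
qed

lemma in_grid_rectangle_iff:
  "plane_pt s t \<in> grid_rectangle (plane_pt (2 * of_int i0) (6 * of_int j0)) i j \<longleftrightarrow>
    2 * of_int (i0 + i) \<le> s \<and> s \<le> 2 * of_int (i0 + i) + 2 \<and> 6 * of_int (j0 + j) \<le> t \<and> t \<le> 6 * of_int (j0 + j) + 6"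
proof -
  have scale: "x * sqrt 3 / 2 \<le> y * sqrt 3 / 12 \<longleftrightarrow> 6 * x \<le> y" "y * sqrt 3 / 12 \<le> x * sqrt 3 / 2 \<longleftrightarrow> y \<le> 6 * x" for x y :: real
  proof -
    have "x * sqrt 3 / 2 = (6 * x) * (sqrt 3 / 12)" "y * sqrt 3 / 12 = y * (sqrt 3 / 12)" by simp_all
    then show "x * sqrt 3 / 2 \<le> y * sqrt 3 / 12 \<longleftrightarrow> 6 * x \<le> y" "y * sqrt 3 / 12 \<le> x * sqrt 3 / 2 \<longleftrightarrow> y \<le> 6 * x"
      by (simp_all only: mult_le_cancel_right) simp_all
  qed
  have img: "x \<in> (+) p ` S \<longleftrightarrow> x - p \<in> S" for x p :: point and S
  proof
    assume "x - p \<in> S"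
    then show "x \<in> (+) p ` S" by (rule rev_image_eqI) simp
  qed auto
  have "plane_pt s t \<in> grid_rectangle (plane_pt (2 * of_int i0) (6 * of_int j0)) i j \<longleftrightarrow>
    plane_pt (s - 2 * of_int i0) (t - 6 * of_int j0) \<in>
      {of_int i / 2 .. of_int (i + 1) / 2} \<times> {of_int j * sqrt 3 / 2 .. of_int (j + 1) * sqrt 3 / 2}"
    by (simp only: grid_rectangle_def img plane_pt_diff)
  also have "\<dots> \<longleftrightarrow> (of_int i / 2 \<le> (s - 2 * of_int i0) / 4 \<and> (s - 2 * of_int i0) / 4 \<le> of_int (i + 1) / 2) \<and>
      6 * of_int j \<le> t - 6 * of_int j0 \<and> t - 6 * of_int j0 \<le> 6 * of_int (j + 1)"
    by (simp only: plane_pt_def mem_Times_iff fst_conv snd_conv atLeastAtMost_iff scale)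
  also have "\<dots> \<longleftrightarrow> 2 * of_int (i0 + i) \<le> s \<and> s \<le> 2 * of_int (i0 + i) + 2 \<and>
      6 * of_int (j0 + j) \<le> t \<and> t \<le> 6 * of_int (j0 + j) + 6"
    by (auto simp: field_simps)
  finally show ?thesis .
qed

lemma max_consecutive: "2 * max \<bar>i\<bar> \<bar>i + 1\<bar> = \<bar>2 * i + 1\<bar> + 1" for i :: int
  by (cases "i \<ge> 0") auto

lemma in_aztec_dungeon_iff:
  "plane_pt s t \<in> aztec_dungeon (plane_pt (2 * of_int i0) (6 * of_int j0)) n \<longleftrightarrow>
    (\<exists>i j. \<bar>2 * i + 1\<bar> + \<bar>2 * j + 1\<bar> \<le> 2 * int n \<and> 2 * of_int (i0 + i) \<le> s \<and> s \<le> 2 * of_int (i0 + i) + 2 \<and>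
      6 * of_int (j0 + j) \<le> t \<and> t \<le> 6 * of_int (j0 + j) + 6)"
proof -
  have eq: "max \<bar>i\<bar> \<bar>i + 1\<bar> + max \<bar>j\<bar> \<bar>j + 1\<bar> \<le> int n + 1 \<longleftrightarrow> \<bar>2 * i + 1\<bar> + \<bar>2 * j + 1\<bar> \<le> 2 * int n" for i j :: int
    using max_consecutive[of i] max_consecutive[of j] by linarith
  have mem: "q \<in> aztec_dungeon p n \<longleftrightarrow> (\<exists>i j. max \<bar>i\<bar> \<bar>i + 1\<bar> + max \<bar>j\<bar> \<bar>j + 1\<bar> \<le> int n + 1 \<and> q \<in> grid_rectangle p i j)" for p q
    unfolding aztec_dungeon_def by blast
  show ?thesis
    unfolding mem eq in_grid_rectangle_iff ..
qed

lemma region_in_rectangle: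
  assumes "q \<in> triple (x, y, b)"
  shows "\<exists>s t. q = plane_pt s t \<and> \<bar>s - of_int (block_coord x)\<bar> \<le> 1 \<and> \<bar>t - 3 * of_int (block_coord y)\<bar> \<le> 3"
proof -
  have "\<bar>real_of_int (corner_coord x) - of_int (block_coord x)\<bar> = 1" "\<bar>real_of_int (corner_coord y) - of_int (block_coord y)\<bar> = 1"
    using corner_block_coord(5)[of x] corner_block_coord(5)[of y] by auto
  then show ?thesis
    using assms by (auto simp: triple_def int_pt_def split: if_splits)
qed

text \<open>A point strictly inside the rectangle, namely the centroid of the region, lies in no
  other rectangle of the grid. So a region can be contained in a dungeon only if its own rectangle
  is one of those that form it.\<close>

lemma region_centroid:
  "\<exists>s t. plane_pt s t \<in> region (x, y, b) \<and> \<bar>s - of_int (block_coord x)\<bar> < 1 \<and> \<bar>t - 3 * of_int (block_coord y)\<bar> < 3"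
proof -
  define c d where "c = real_of_int (corner_coord x)" and "d = real_of_int (corner_coord y)"
  define k l where "k = real_of_int (block_coord x)" and "l = real_of_int (block_coord y)"
  have cd: "c = k + 1 \<or> c = k - 1" "d = l + 1 \<or> d = l - 1"
    using corner_block_coord(5)[of x] corner_block_coord(5)[of y] by (auto simp: c_def d_def k_def l_def)
  have cent: "plane_pt ((s1 + s2 + s3) / 3) ((t1 + t2 + t3) / 3) \<in> convex hull {plane_pt s1 t1, plane_pt s2 t2, plane_pt s3 t3}" for s1 s2 s3 t1 t2 t3
    unfolding convex_hull_3 mem_Collect_eq
    by (rule exI[of _ "1/3"], rule exI[of _ "1/3"], rule exI[of _ "1/3"]) (simp add: plane_pt_scale plane_pt_add add_divide_distrib)
  show ?thesis
  proof (cases "mid0 x y")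
    case True
    have close: "\<bar>(2 * k - c + c + c) / 3 - k\<bar> < 1 \<and> \<bar>(3 * d + 3 * d + (d + 2 * l)) / 3 - 3 * l\<bar> < 3"
      using cd by (elim disjE) (simp_all add: field_simps)
    have r: "region (x, y, b) = convex hull {plane_pt (2 * k - c) (3 * d), plane_pt c (3 * d), plane_pt c (d + 2 * l)}"
      using True by (simp add: region_def triple_def int_pt_def c_def d_def k_def l_def)
    show ?thesis
      unfolding k_def[symmetric] l_def[symmetric] r
      using cent[of "2 * k - c" c c "3 * d" "3 * d" "d + 2 * l"] close by blast
  next
    case False
    show ?thesis
    proof (cases b)
      case True
      have close: "\<bar>(c + k + (2 * k - c)) / 3 - k\<bar> < 1 \<and> \<bar>(3 * d + 3 * l + (d + 2 * l)) / 3 - 3 * l\<bar> < 3"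
        using cd by (elim disjE) (simp_all add: field_simps)
      have r: "region (x, y, b) = convex hull {plane_pt c (3 * d), plane_pt k (3 * l), plane_pt (2 * k - c) (d + 2 * l)}"
        using True False by (simp add: region_def triple_def int_pt_def c_def d_def k_def l_def)
      show ?thesis
        unfolding k_def[symmetric] l_def[symmetric] r
        using cent[of c k "2 * k - c" "3 * d" "3 * l" "d + 2 * l"] close by blast
    next
      case b: False
      have close: "\<bar>(c + k + c) / 3 - k\<bar> < 1 \<and> \<bar>(3 * d + 3 * l + (4 * l - d)) / 3 - 3 * l\<bar> < 3"
        using cd by (elim disjE) (simp_all add: field_simps)
      have r: "region (x, y, b) = convex hull {plane_pt c (3 * d), plane_pt k (3 * l), plane_pt c (4 * l - d)}"
        using b False by (simp add: region_def triple_def int_pt_def c_def d_def k_def l_def)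
      show ?thesis
        unfolding k_def[symmetric] l_def[symmetric] r
        using cent[of c k c "3 * d" "3 * l" "4 * l - d"] close by blast
    qed
  qed
qed

lemma block_coord_shift: "block_coord (x + 2 * i) = block_coord x + 2 * i"
  by (simp add: block_coord_def)

lemma region_subset_dungeon_iff:
  "region (x + 2 * i0, y + 2 * j0, b) \<subseteq> aztec_dungeon (plane_pt (2 * of_int i0) (6 * of_int j0)) n \<longleftrightarrow>
    \<bar>2 * (x div 2) + 1\<bar> + \<bar>2 * (y div 2) + 1\<bar> \<le> 2 * int n" (is "?R \<subseteq> ?D \<longleftrightarrow> ?I")
proof
  assume sub: "?R \<subseteq> ?D"
  obtain s t where st: "plane_pt s t \<in> ?R" "\<bar>s - of_int (block_coord (x + 2 * i0))\<bar> < 1" "\<bar>t - 3 * of_int (block_coord (y + 2 * j0))\<bar> < 3"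
    using region_centroid by blast
  then obtain i j where ij: "\<bar>2 * i + 1\<bar> + \<bar>2 * j + 1\<bar> \<le> 2 * int n" "2 * of_int (i0 + i) \<le> s" "s \<le> 2 * of_int (i0 + i) + 2"
      "6 * of_int (j0 + j) \<le> t" "t \<le> 6 * of_int (j0 + j) + 6"
    using sub in_aztec_dungeon_iff by blast
  have "real_of_int i < of_int (x div 2) + 1" "of_int (x div 2) < real_of_int i + 1"
    "real_of_int j < of_int (y div 2) + 1" "of_int (y div 2) < real_of_int j + 1"
    using st(2,3) ij(2-5) by (auto simp: block_coord_shift block_coord_def)
  then have "i = x div 2" "j = y div 2" by linarith+
  with ij(1) show ?I by simp
next
  assume ?I
  have "triple (x + 2 * i0, y + 2 * j0, b) \<subseteq> grid_rectangle (plane_pt (2 * of_int i0) (6 * of_int j0)) (x div 2) (y div 2)"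
  proof
    fix q assume "q \<in> triple (x + 2 * i0, y + 2 * j0, b)"
    then obtain s t where "q = plane_pt s t" "\<bar>s - of_int (block_coord (x + 2 * i0))\<bar> \<le> 1" "\<bar>t - 3 * of_int (block_coord (y + 2 * j0))\<bar> \<le> 3"
      using region_in_rectangle by blast
    then show "q \<in> grid_rectangle (plane_pt (2 * of_int i0) (6 * of_int j0)) (x div 2) (y div 2)"
      by (auto simp: in_grid_rectangle_iff block_coord_shift block_coord_def)
  qed
  moreover have "convex (grid_rectangle p i j)" for p i j
    unfolding grid_rectangle_def by (intro convex_translation convex_Times convex_real_interval)
  ultimately have "?R \<subseteq> grid_rectangle (plane_pt (2 * of_int i0) (6 * of_int j0)) (x div 2) (y div 2)"
    unfolding region_def by (rule hull_minimal)
  also have "max \<bar>x div 2\<bar> \<bar>x div 2 + 1\<bar> + max \<bar>y div 2\<bar> \<bar>y div 2 + 1\<bar> \<le> int n + 1"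
    using \<open>?I\<close> max_consecutive[of "x div 2"] max_consecutive[of "y div 2"] by linarith
  then have "grid_rectangle (plane_pt (2 * of_int i0) (6 * of_int j0)) (x div 2) (y div 2) \<subseteq> ?D"
    unfolding aztec_dungeon_def by blast
  finally show "?R \<subseteq> ?D" .
qed

section \<open>Tilings as matchings\<close>

lemma T_eq_pmsum:
  assumes "finite {R. elementary_region R \<and> R \<subseteq> U}"
  shows "real (T U) = pmsum {R. elementary_region R \<and> R \<subseteq> U} (\<lambda>t. of_bool (tile t))"
proof -
  let ?V = "{R. elementary_region R \<and> R \<subseteq> U}"
  have "(\<Prod>t\<in>M. of_bool (tile t)) = (of_bool (\<forall>t\<in>M. tile t) :: real)" if "partition_on ?V M" for M
    using finite_elements[OF assms that] by (induction M rule: finite_induct) auto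
  then have "pmsum ?V (\<lambda>t. of_bool (tile t)) = (\<Sum>M | partition_on ?V M. of_bool (\<forall>t\<in>M. tile t))"
    unfolding pmsum_def by (intro sum.cong) auto
  also have "\<dots> = real (card {M \<in> {M. partition_on ?V M}. \<forall>t\<in>M. tile t})"
    using finitely_many_partition_on[OF assms] by (simp add: of_bool_def sum.If_cases Int_def)
  also have "{M \<in> {M. partition_on ?V M}. \<forall>t\<in>M. tile t} = tilings U"
    by (auto simp: tilings_def)
  finally show ?thesis by (simp add: T_def)
qed

definition shift :: "int \<Rightarrow> int \<Rightarrow> vert \<Rightarrow> vert" where
  "shift i j = (\<lambda>(x, y, b). (x + 2 * i, y + 2 * j, b))"

text \<open>Moving the centre of the dungeon to the origin changes the parity of a corner by that of
  \<open>n\<close>, which turns \<open>is_mid 0\<close> into \<open>is_mid n\<close>.\<close>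

lemma region_adj_shift:
  assumes "even (i + j + int n)"
  shows "region_adj (shift i j u) (shift i j v) \<longleftrightarrow> hex_adj u v \<or> mid_adj n u v \<or> bond_adj n u v"
    "is_mid 0 (x + 2 * i) (y + 2 * j) = is_mid n x y"
proof -
  have d: "(z + 2 * k + 1) div 2 = (z + 1) div 2 + k" for z k :: int by presburger
  show m: "is_mid 0 (x + 2 * i) (y + 2 * j) = is_mid n x y" for x y
    using assms unfolding is_mid_def d by presburger
  have f: "flip (z + 2 * k) = flip z + 2 * k" "across (z + 2 * k) = across z + 2 * k" for z k
    by (simp_all add: flip_def across_def)
  show "region_adj (shift i j u) (shift i j v) \<longleftrightarrow> hex_adj u v \<or> mid_adj n u v \<or> bond_adj n u v"
    by (cases u; cases v) (simp add: region_adj_def shift_def m f)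
qed

lemma T_aztec_dungeon:
  assumes "dungeon_center n p"
  shows "real (T (aztec_dungeon p n)) = tilings_formula n"
proof -
  obtain i j where p: "p = plane_pt (2 * of_int i) (6 * of_int j)" and ij: "even (i + j + int n)"
    using dungeon_center_grid[OF assms] .
  define f where "f = region \<circ> shift i j"
  have reg: "regular (shift i j (x, y, b)) \<longleftrightarrow> (b \<longrightarrow> \<not> is_mid n x y)" for x y b
    by (simp add: shift_def regular_def region_adj_shift(2)[OF ij])
  then have regV: "regular (shift i j v)" if "v \<in> dungeon_verts n" for v
    using that by (cases v) (auto simp: dungeon_verts_def)
  have inj: "inj_on f (dungeon_verts n)"
    using region_inj[OF regV regV] by (auto simp: inj_on_def f_def shift_def)
  have V: "{R. elementary_region R \<and> R \<subseteq> aztec_dungeon p n} = f ` dungeon_verts n"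
  proof (intro set_eqI iffI)
    fix R assume "R \<in> {R. elementary_region R \<and> R \<subseteq> aztec_dungeon p n}"
    then obtain w where w: "regular w" "R = region w" "R \<subseteq> aztec_dungeon p n"
      using elementary_region_eq by blast
    obtain x y b where xy: "w = (x, y, b)" using prod_cases3 by blast
    have ws: "w = shift i j (x - 2 * i, y - 2 * j, b)" by (simp add: shift_def xy)
    have "(x - 2 * i, y - 2 * j, b) \<in> dungeon_verts n"
      using w region_subset_dungeon_iff[of "x - 2 * i" i "y - 2 * j" j b n] reg[of "x - 2 * i" "y - 2 * j" b]
      unfolding dungeon_verts_def p ws by (simp add: shift_def)
    then show "R \<in> f ` dungeon_verts n" using w(2) ws by (auto simp: f_def)
  next
    fix R assume "R \<in> f ` dungeon_verts n"
    then obtain v where v: "v \<in> dungeon_verts n" "R = f v" by blast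
    obtain x y b where xy: "v = (x, y, b)" using prod_cases3 by blast
    have "elementary_region R" using regV[OF v(1)] v(2) elementary_region_eq unfolding f_def o_apply by blast
    moreover have "R \<subseteq> aztec_dungeon p n"
      using v region_subset_dungeon_iff[of x i y j b n] by (simp add: p f_def shift_def xy dungeon_verts_def)
    ultimately show "R \<in> {R. elementary_region R \<and> R \<subseteq> aztec_dungeon p n}" by blast
  qed
  have pair: "tile (f ` {a, b}) \<longleftrightarrow> is_edge (\<lambda>a b. hex_adj a b \<or> mid_adj n a b \<or> bond_adj n a b) {a, b}"
    if "a \<in> dungeon_verts n" "b \<in> dungeon_verts n" for a b
    using tile_region_iff[OF regV[OF that(1)] regV[OF that(2)]]
    by (simp add: f_def region_adj_shift(1)[OF ij])
  have weight: "of_bool (tile (f ` e)) = dungeon_weight n e" if e: "e \<subseteq> dungeon_verts n" for e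
  proof (cases "\<exists>a b. e = {a, b}")
    case True
    then show ?thesis using e pair by (auto simp: dungeon_weight_def simp del: is_edge_pair)
  next
    case False
    have "\<not> tile (f ` e)"
    proof
      assume "tile (f ` e)"
      then obtain R S where RS: "f ` e = {R, S}" by (auto simp: tile_def)
      then obtain a b where ab: "a \<in> e" "b \<in> e" "R = f a" "S = f b" by (metis imageE insertI1 insertI2)
      then have "f ` e = f ` {a, b}" using RS by simp
      then have "e = {a, b}" using inj_on_image_eq_iff[OF inj e, of "{a, b}"] ab e by blast
      with False show False by blast
    qed
    moreover have "\<not> is_edge R e" for R using False by (auto simp: is_edge_def)
    ultimately show ?thesis by (simp add: dungeon_weight_def)
  qed
  have "real (T (aztec_dungeon p n)) = pmsum (f ` dungeon_verts n) (\<lambda>t. of_bool (tile t))"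
    using T_eq_pmsum[of "aztec_dungeon p n"] finite_dungeon_verts by (simp add: V)
  also have "\<dots> = pmsum (dungeon_verts n) (dungeon_weight n)"
    unfolding pmsum_image[OF inj] by (rule pmsum_cong[OF weight])
  finally show ?thesis by (simp add: pmsum_dungeon tilings_formula_def)
qed

theorem corollary3p2:
  fixes p :: "nat \<Rightarrow> real \<times> real"
  assumes "\<And>n. dungeon_center n (p n)"
  shows "T (aztec_dungeon (p 0) 0) = 1 \<and>
         T (aztec_dungeon (p 1) 1) = 2 \<and>
         T (aztec_dungeon (p 2) 2) = 13 \<and>
         T (aztec_dungeon (p 3) 3) = 13 ^ 3 \<and>
         T (aztec_dungeon (p 4) 4) = 2 * 13 ^ 5 \<and>
         T (aztec_dungeon (p 5) 5) = 13 ^ 8 \<and>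
         (\<forall>n \<ge> 5. T (aztec_dungeon (p (n + 1)) (n + 1)) =
            13 ^ (4 * n - 8) * T (aztec_dungeon (p (n - 5)) (n - 5)))"
proof -
  have eq: "T (aztec_dungeon (p n) n) = k" if "tilings_formula n = real k" for n k
    using T_aztec_dungeon[OF assms[of n]] that by simp
  have "T (aztec_dungeon (p (n + 1)) (n + 1)) = 13 ^ (4 * n - 8) * T (aztec_dungeon (p (n - 5)) (n - 5))" if "n \<ge> 5" for n
  proof (rule eq)
    \<comment> \<open>Since \<open>n \<ge> 5\<close>, both truncated subtractions are exact, and the
      exponent becomes \<open>4 * m + 12\<close>.\<close>
    define m where "m = n - 5"
    have n: "n + 1 = m + 6" "4 * n - 8 = 4 * m + 12" using that by (simp_all add: m_def)
    show "tilings_formula (n + 1) = real (13 ^ (4 * n - 8) * T (aztec_dungeon (p (n - 5)) (n - 5)))"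
      unfolding n m_def[symmetric] tilings_formula_add_6 by (simp add: T_aztec_dungeon[OF assms])
  qed
  moreover have "T (aztec_dungeon (p 0) 0) = 1" "T (aztec_dungeon (p 1) 1) = 2" "T (aztec_dungeon (p 2) 2) = 13"
    "T (aztec_dungeon (p 3) 3) = 13 ^ 3" "T (aztec_dungeon (p 4) 4) = 2 * 13 ^ 5" "T (aztec_dungeon (p 5) 5) = 13 ^ 8"
    by (rule eq, simp only: tilings_formula_small of_nat_1 of_nat_numeral of_nat_mult of_nat_power)+
  ultimately show ?thesis by blast
qed

end
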